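(* Let $G$ be a connected reductive group over $\mathbb{C}$ of simply connected type, and let $G/H$ be a spherical homogeneous space with trivial divisor class group. Let $G/H\hookrightarrow Z_0$ be the associated closed embedding into the toric variety $Z_0$ with dense torus $\mathbb{T}$, and let $\psi:\operatorname{trop}_{\mathbb{T}}(Z_0)\to\mathcal{N}_{\mathbb{Q}}$ be the associated piecewise projection (all defined in the context). If $Y\subseteq G/H$ is a closed subvariety, then $$\operatorname{trop}_G(Y)=\psi\left(\operatorname{trop}_{\mathbb{T}}(Y)\right).$$
   Context: **Spherical data.** The ground field is $\mathbb{C}$. $G$ is a connected reductive group with a fixed Borel subgroup $B$; $G$ is of simply connected type if $G=G^{ss}\times C$ with $G^{ss}$ semisimple simply connected and $C$ a torus. $G/H$ is a spherical homogeneous space: a normal variety with a dense $B$-orbit. $G$ acts on rational functions by $(gf)(x)=f(g^{-1}x)$. Let $\mathbb{C}(G/H)^{(B)}$ be the set of nonzero $f\in\mathbb{C}(G/H)$ with $gf=\chi_f(g)f$ for all $g\in B$, for some character $\chi_f$ of $B$. The characters $\chi_f$ form a lattice $\mathcal{M}$, and $f\mapsto \chi_f$ identifies $\mathbb{C}(G/H)^{(B)}/\mathbb{C}^*$ with $\mathcal{M}$. Put $\mathcal{N}=\operatorname{Hom}(\mathcal{M},\mathbb{Z})$, $\mathcal{N}_{\mathbb{Q}}=\mathcal{N}\otimes\mathbb{Q}$. The $G$-invariant $\mathbb{Q}$-valued valuations on $\mathbb{C}(G/H)^*$ trivial on $\mathbb{C}^*$ inject into $\mathcal{N}_{\mathbb{Q}}$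 by restriction to $B$ semi-invariant functions; the image is the valuation cone $\mathcal{V}$. The colors are the prime divisors $D_1,\dots,D_r$ of $G/H$ that are $B$-stable but not $G$-stable. **Spherical tropicalization.** Let $\mathbb{C}\{\!\{t\}\!\}$ be the field of Puiseux series, and let $\nu$ be its valuation, giving the lowest exponent of $t$ with nonzero coefficient ($\nu(0)=\infty$). For $\gamma\in Y(\mathbb{C}\{\!\{t\}\!\})$ let $\nu_\gamma\in\mathcal{V}$ be the valuation $f\mapsto\nu(\gamma^*(gf))$, where for given $f$ the element $g\in G$ is sufficiently general: the image of $\gamma$ lies in the domain of $gf$ and $\nu(\gamma^*(gf))$ attains its minimum over $g$ (both hold on open subsets of $G$). Then $\operatorname{trop}_G(Y):=\{\nu_\gamma:\gamma\in Y(\mathbb{C}\{\!\{t\}\!\})\}\subseteq\mathcal{V}\subseteq\mathcal{N}_{\mathbb{Q}}$. **The toric variety $Z_0$.** Since the class group is trivial, $D_i=V(f_i)$ for a regular, $B$ semi-invariant function $f_i$ on $G/H$. Let $s_i$ be the dimension of the $G$-module spanned by $G\cdot f_i$, and choose a basis $f_{i1}=f_i,f_{i2},\dots,f_{is_i}$ of it contained in $G\cdot f_i$. Let $g_1,\dots,g_m\in\Gamma(G/H,\mathcal{O}^*_{G/H})$ represent a basis of the free abelian group $\Gamma(G/H,\mathcal{O}^*_{G/H})/\mathbb{C}^*$ (the $g_k$ are $G$-eigenvectors). The characters of the $f_i$ and $g_k$ form a basis of $\mathcal{M}$; let $v_1,\dots,v_r,w_1,\dots,w_m$ be the dual basis of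 $\mathcal{N}$, giving $\mathcal{N}_{\mathbb{Q}}\cong\mathbb{Q}^{r+m}$. Define $$Z_0=(\mathbb{C}^{s_1}\setminus\{0\})\times\cdots\times(\mathbb{C}^{s_r}\setminus\{0\})\times(\mathbb{C}^* )^m,$$ with dense torus $\mathbb{T}$. The map $x\mapsto (f_{ij}(x))_{i,j}\times(g_k(x))_k$ is a closed embedding $G/H\hookrightarrow Z_0$. **Toric tropicalization and $\psi$.** Write $\overline{\mathbb{Q}}=\mathbb{Q}\cup\{\infty\}$. The (extended) toric tropicalization of $Z_0$ is $$\operatorname{trop}_{\mathbb{T}}(Z_0)=(\overline{\mathbb{Q}}^{s_1}\setminus\{(\infty,\dots,\infty)\})\times\cdots\times(\overline{\mathbb{Q}}^{s_r}\setminus\{(\infty,\dots,\infty)\})\times\mathbb{Q}^m,$$ and $\operatorname{trop}_{\mathbb{T}}(Y)=\{(\nu(f_{ij}(\gamma))_{i,j},\nu(g_k(\gamma))_k):\gamma\in Y(\mathbb{C}\{\!\{t\}\!\})\}$. The map $\psi:\operatorname{trop}_{\mathbb{T}}(Z_0)\to\mathcal{N}_{\mathbb{Q}}$ is $$\psi(a_{11},\dots,a_{rs_r},b_1,\dots,b_m)=\Big(\min_{1\le j\le s_1}a_{1j},\dots,\min_{1\le j\le s_r}a_{rj},b_1,\dots,b_m\Big).$$ *)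

theory Defs
  imports
    "HOL-Analysis.Analysis"
    "HOL-Algebra.Solvable_Groups"
    "HOL-Computational_Algebra.Formal_Laurent_Series"
    "HOL-Library.Extended"
begin

section \<open>Puiseux series\<close>

text \<open>A Puiseux series is given by its coefficients: \<open>a q\<close> is the coefficient of the power of
  \<open>t\<close> with exponent \<open>q\<close>.\<close>

definition puiseux_carrier :: "(rat \<Rightarrow> complex) set" where
  "puiseux_carrier = {a. \<exists>n::nat. n > 0 \<and>
     (\<exists>N::int. \<forall>q. a q \<noteq> 0 \<longrightarrow> (\<exists>k\<ge>N. q = of_int k / of_nat n))}"

typedef puiseux = puiseux_carrier
  morphisms pcoeff Abs_puiseux
proof
  show "(\<lambda>_. 0) \<in> puiseux_carrier"
    by (auto simp: puiseux_carrier_def intro: exI[of _ "1::nat"])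
qed

definition pconv :: "(rat \<Rightarrow> complex) \<Rightarrow> (rat \<Rightarrow> complex) \<Rightarrow> rat \<Rightarrow> complex" where
  "pconv a b q = (\<Sum>r | a r \<noteq> 0 \<and> b (q - r) \<noteq> 0. a r * b (q - r))"

definition puiseux_const :: "complex \<Rightarrow> puiseux" where
  "puiseux_const c = Abs_puiseux (\<lambda>q. if q = 0 then c else 0)"

text \<open>The field laws are inherited from the subfields of Laurent series in the \<open>n\<close>-th roots
  of \<open>t\<close>.\<close>

definition from_fls :: "nat \<Rightarrow> complex fls \<Rightarrow> rat \<Rightarrow> complex" where
  "from_fls n F q = (if q * of_nat n \<in> \<int> then fls_nth F \<lfloor>q * of_nat n\<rfloor> else 0)"

lemma from_fls_int: "n > 0 \<Longrightarrow> from_fls n F (of_int k / of_nat n) = fls_nth F k"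
  by (simp add: from_fls_def)

lemma from_fls_nz: "n > 0 \<Longrightarrow> from_fls n F q \<noteq> 0 \<Longrightarrow> \<exists>k. q = of_int k / of_nat n \<and> fls_nth F k \<noteq> 0"
  unfolding from_fls_def
  by (auto split: if_splits elim!: Ints_cases simp: field_simps)

lemma from_fls_carrier:
  assumes "n > 0"
  shows "from_fls n F \<in> puiseux_carrier"
proof -
  have "\<exists>k\<ge>fls_subdegree F. q = of_int k / of_nat n" if "from_fls n F q \<noteq> 0" for q
    using from_fls_nz[OF assms that] fls_subdegree_leI[of F] by blast
  then show ?thesis
    unfolding puiseux_carrier_def using assms by blast
qed

lemma from_fls_ex:
  assumes "n > 0" "\<And>q. a q \<noteq> 0 \<Longrightarrow> (\<exists>k\<ge>N. q = of_int k / of_nat n)"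
  shows "\<exists>F. a = from_fls n F"
proof -
  define F where "F = Abs_fls (\<lambda>k. a (of_int k / of_nat n))"
  have "fls_nth F k = a (of_int k / of_nat n)" for k
    unfolding F_def
  proof (subst nth_Abs_fls_lower_bound[of N])
    show "\<forall>k<N. a (of_int k / of_nat n) = 0"
      using assms by (force simp: field_simps)
  qed simp
  then have "a q = from_fls n F q" for q
    using assms(1) assms(2)[of q] from_fls_nz[OF assms(1), of F q] from_fls_int[OF assms(1), of F]
    by (metis)
  then show ?thesis by blast
qed

lemma pcoeff_ex: "\<exists>n>0. \<forall>m>0. \<exists>F. pcoeff a = from_fls (n * m) F"
proof -
  obtain n N where n: "n > 0" "\<And>q. pcoeff a q \<noteq> 0 \<Longrightarrow> (\<exists>k\<ge>N. q = of_int k / of_nat n)"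
    using pcoeff[of a] unfolding puiseux_carrier_def by blast
  have "\<exists>F. pcoeff a = from_fls (n * m) F" if "m > 0" for m
  proof (rule from_fls_ex[where N = "N * int m"])
    fix q assume "pcoeff a q \<noteq> 0"
    then obtain k where "k \<ge> N" "q = of_int k / of_nat n" using n by blast
    then show "\<exists>k\<ge>N * int m. q = of_int k / of_nat (n * m)"
      using that by (intro exI[of _ "k * int m"]) (auto simp: field_simps)
  qed (use n that in auto)
  then show ?thesis using n by blast
qed

lemma puiseux_cases3:
  obtains n F G K where "n > 0" "a = Abs_puiseux (from_fls n F)"
    "b = Abs_puiseux (from_fls n G)" "c = Abs_puiseux (from_fls n K)"
proof -
  obtain k l m where *: "k > 0" "l > 0" "m > 0" "\<forall>m>0. \<exists>F. pcoeff a = from_fls (k * m) F"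
     "\<forall>m>0. \<exists>F. pcoeff b = from_fls (l * m) F" "\<forall>k>0. \<exists>F. pcoeff c = from_fls (m * k) F"
    using pcoeff_ex by metis
  have "k * (l * m) = l * (k * m)" "k * (l * m) = m * (k * l)" by auto
  with * obtain F G K where "pcoeff a = from_fls (k * (l * m)) F"
     "pcoeff b = from_fls (k * (l * m)) G" "pcoeff c = from_fls (k * (l * m)) K"
    by (metis mult_pos_pos)
  then show ?thesis using that[of "k * (l * m)"] * by (metis mult_pos_pos pcoeff_inverse)
qed

instantiation puiseux :: field
begin

definition "0 = Abs_puiseux (\<lambda>_. 0)"
definition "1 = Abs_puiseux (\<lambda>q. if q = 0 then 1 else 0)"
definition "a + b = Abs_puiseux (\<lambda>q. pcoeff a q + pcoeff b q)"
definition "- a = Abs_puiseux (\<lambda>q. - pcoeff a q)"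
definition "a - b = Abs_puiseux (\<lambda>q. pcoeff a q - pcoeff b q)"
definition "a * b = Abs_puiseux (pconv (pcoeff a) (pcoeff b))"
definition "inverse a = (if a = 0 then 0 else SOME b. b * a = (1::puiseux))"
definition "a div b = a * inverse (b::puiseux)"

lemma from_fls_simps:
  assumes "n > 0"
  shows "Abs_puiseux (from_fls n F) + Abs_puiseux (from_fls n G) = Abs_puiseux (from_fls n (F + G))"
    and "Abs_puiseux (from_fls n F) - Abs_puiseux (from_fls n G) = Abs_puiseux (from_fls n (F - G))"
    and "- Abs_puiseux (from_fls n F) = Abs_puiseux (from_fls n (- F))"
    and "0 = Abs_puiseux (from_fls n 0)"
    and "1 = Abs_puiseux (from_fls n 1)"
    and "Abs_puiseux (from_fls n F) = Abs_puiseux (from_fls n G) \<longleftrightarrow> F = G"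
    and "Abs_puiseux (from_fls n F) * Abs_puiseux (from_fls n G) = Abs_puiseux (from_fls n (F * G))"
proof -
  note c = Abs_puiseux_inverse[OF from_fls_carrier[OF assms]]
  show "Abs_puiseux (from_fls n F) + Abs_puiseux (from_fls n G) = Abs_puiseux (from_fls n (F + G))"
    unfolding plus_puiseux_def c by (rule arg_cong[of _ _ Abs_puiseux]) (auto simp: from_fls_def)
  show "Abs_puiseux (from_fls n F) - Abs_puiseux (from_fls n G) = Abs_puiseux (from_fls n (F - G))"
    unfolding minus_puiseux_def c by (rule arg_cong[of _ _ Abs_puiseux]) (auto simp: from_fls_def)
  show "- Abs_puiseux (from_fls n F) = Abs_puiseux (from_fls n (- F))"
    unfolding uminus_puiseux_def c by (rule arg_cong[of _ _ Abs_puiseux]) (auto simp: from_fls_def)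
  show "0 = Abs_puiseux (from_fls n 0)"
    unfolding zero_puiseux_def by (rule arg_cong[of _ _ Abs_puiseux]) (auto simp: from_fls_def)
  show "1 = Abs_puiseux (from_fls n 1)"
    unfolding one_puiseux_def using assms
    by (intro arg_cong[of _ _ Abs_puiseux] ext) (auto simp: from_fls_def elim!: Ints_cases)
  show "Abs_puiseux (from_fls n F) = Abs_puiseux (from_fls n G) \<longleftrightarrow> F = G"
    by (metis c fls_eqI from_fls_int[OF assms])
  show "Abs_puiseux (from_fls n F) * Abs_puiseux (from_fls n G) = Abs_puiseux (from_fls n (F * G))"
    unfolding times_puiseux_def c
  proof (intro arg_cong[of _ _ Abs_puiseux] ext)
    fix q
    define I where "I = {i. fls_nth F i \<noteq> 0 \<and> from_fls n G (q - of_int i / of_nat n) \<noteq> 0}"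
    have S: "{r. from_fls n F r \<noteq> 0 \<and> from_fls n G (q - r) \<noteq> 0} = (\<lambda>i. of_int i / of_nat n) ` I"
      unfolding I_def using from_fls_nz[OF assms, of F] from_fls_int[OF assms] by (auto simp: image_iff)
    have "inj (\<lambda>i::int. of_int i / of_nat n :: rat)" using assms by (auto simp: inj_def)
    then have P: "pconv (from_fls n F) (from_fls n G) q =
      (\<Sum>i\<in>I. fls_nth F i * from_fls n G (q - of_int i / of_nat n))"
      unfolding pconv_def S
      by (subst sum.reindex) (auto intro: inj_on_subset simp: from_fls_int[OF assms])
    show "pconv (from_fls n F) (from_fls n G) q = from_fls n (F * G) q"
    proof (cases "\<exists>k::int. q = of_int k / of_nat n")
      case True
      then obtain k where k: "q = of_int k / of_nat n" by blast
      have G: "from_fls n G (q - of_int i / of_nat n) = fls_nth G (k - i)" for i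
        using from_fls_int[OF assms, of G "k - i"] by (simp add: k diff_divide_distrib)
      have "(\<Sum>i\<in>I. fls_nth F i * fls_nth G (k - i)) =
            (\<Sum>i=fls_subdegree F..k - fls_subdegree G. fls_nth F i * fls_nth G (k - i))"
        using fls_subdegree_leI[of F] fls_subdegree_leI[of G]
        by (intro sum.mono_neutral_left) (force simp: I_def G)+
      then show ?thesis
        using P unfolding G by (simp only: k from_fls_int[OF assms] fls_times_nth(2))
    next
      case False
      have "I = {}"
      proof (rule ccontr)
        assume "I \<noteq> {}"
        then obtain i where "from_fls n G (q - of_int i / of_nat n) \<noteq> 0" unfolding I_def by blast
        then obtain k where "q - of_int i / of_nat n = of_int k / (of_nat n :: rat)"
          using from_fls_nz[OF assms] by blast
        then have "q = of_int (k + i) / of_nat n" by (simp add: add_divide_distrib algebra_simps)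
        then show False using False by blast
      qed
      then show ?thesis using False P from_fls_nz[OF assms, of "F * G" q] by auto
    qed
  qed
qed

lemma puiseux_inverse_ex: "a \<noteq> 0 \<Longrightarrow> \<exists>b. b * a = (1::puiseux)"
proof -
  assume "a \<noteq> 0"
  obtain n F G K where *: "n > 0" "a = Abs_puiseux (from_fls n F)"
     using puiseux_cases3[of a a a] by metis
  with \<open>a \<noteq> 0\<close> have "F \<noteq> 0" using from_fls_simps(4)[of n] by auto
  then have "Abs_puiseux (from_fls n (inverse F)) * a = 1"
    unfolding * by (simp add: from_fls_simps[OF *(1)])
  then show ?thesis by blast
qed

instance
proof
  fix a b c :: puiseux
  obtain n F G K where *: "n > 0" "a = Abs_puiseux (from_fls n F)"
    "b = Abs_puiseux (from_fls n G)" "c = Abs_puiseux (from_fls n K)" by (rule puiseux_cases3)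
  note s = from_fls_simps[OF *(1)]
  show "a + b + c = a + (b + c)" "a * b * c = a * (b * c)" "(a + b) * c = a * c + b * c"
    "a + b = b + a" "a * b = b * a"
    "0 + a = a" "1 * a = a" "- a + a = 0" "a - b = a + - b" "(0::puiseux) \<noteq> 1"
    by (simp_all add: * s algebra_simps)
  show "a \<noteq> 0 \<Longrightarrow> inverse a * a = 1"
    using someI_ex[OF puiseux_inverse_ex[of a]] by (simp add: inverse_puiseux_def)
  show "a div b = a * inverse b" by (rule divide_puiseux_def)
  show "inverse (0::puiseux) = 0" by (simp add: inverse_puiseux_def)
qed

end

definition puiseux_val :: "puiseux \<Rightarrow> rat extended" where
  "puiseux_val a = (if a = 0 then Pinf else Fin (LEAST q. pcoeff a q \<noteq> 0))"


section \<open>Spaces with functions\<close>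

text \<open>Varieties over the complex numbers are treated as sets of closed points with a topology and
  a sheaf of complex functions. \<open>fs_reg X U f\<close> says that \<open>f\<close> is regular on the open set \<open>U\<close>; it
  only depends on the values of \<open>f\<close> on \<open>U\<close>.\<close>

record 'p fspace =
  fs_top :: "'p topology"
  fs_reg :: "'p set \<Rightarrow> ('p \<Rightarrow> complex) \<Rightarrow> bool"

abbreviation fs_points :: "('p, 'x) fspace_scheme \<Rightarrow> 'p set" where
  "fs_points X \<equiv> topspace (fs_top X)"

text \<open>Polynomial functions in a given set of coordinate functions.\<close>

inductive_set poly_fun :: "('p \<Rightarrow> complex) set \<Rightarrow> ('p \<Rightarrow> complex) set"
  for cs :: "('p \<Rightarrow> complex) set" where
  const: "(\<lambda>_. c) \<in> poly_fun cs"
| coord: "x \<in> cs \<Longrightarrow> x \<in> poly_fun cs"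
| add: "p \<in> poly_fun cs \<Longrightarrow> q \<in> poly_fun cs \<Longrightarrow> (\<lambda>x. p x + q x) \<in> poly_fun cs"
| mult: "p \<in> poly_fun cs \<Longrightarrow> q \<in> poly_fun cs \<Longrightarrow> (\<lambda>x. p x * q x) \<in> poly_fun cs"

definition zariski :: "('p \<Rightarrow> complex) set \<Rightarrow> 'p topology" where
  "zariski cs = topology_generated_by {{x. p x \<noteq> 0} |p. p \<in> poly_fun cs}"

text \<open>Intended for locally closed subsets \<open>S\<close> of the affine space with coordinates \<open>cs\<close>.\<close>

definition zariski_space :: "('p \<Rightarrow> complex) set \<Rightarrow> 'p set \<Rightarrow> 'p fspace" where
  "zariski_space cs S = (let T = subtopology (zariski cs) S in
    \<lparr>fs_top = T,
     fs_reg = (\<lambda>U f. openin T U \<and>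
       (\<forall>x\<in>U. \<exists>V p q. openin T V \<and> x \<in> V \<and> V \<subseteq> U \<and> p \<in> poly_fun cs \<and> q \<in> poly_fun cs \<and>
          (\<forall>y\<in>V. q y \<noteq> 0 \<and> f y = p y / q y)))\<rparr>)"

definition fs_morphism :: "'p fspace \<Rightarrow> 'q fspace \<Rightarrow> ('p \<Rightarrow> 'q) \<Rightarrow> bool" where
  "fs_morphism X Y \<phi> \<longleftrightarrow> continuous_map (fs_top X) (fs_top Y) \<phi> \<and>
     (\<forall>U f. fs_reg Y U f \<longrightarrow> fs_reg X {x \<in> fs_points X. \<phi> x \<in> U} (f \<circ> \<phi>))"

definition fs_iso :: "'p fspace \<Rightarrow> 'q fspace \<Rightarrow> ('p \<Rightarrow> 'q) \<Rightarrow> bool" where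
  "fs_iso X Y \<phi> \<longleftrightarrow> fs_morphism X Y \<phi> \<and>
     (\<exists>\<psi>. fs_morphism Y X \<psi> \<and> (\<forall>x\<in>fs_points X. \<psi> (\<phi> x) = x) \<and> (\<forall>y\<in>fs_points Y. \<phi> (\<psi> y) = y))"

definition irreducible_in :: "'p topology \<Rightarrow> 'p set \<Rightarrow> bool" where
  "irreducible_in T W \<longleftrightarrow> W \<subseteq> topspace T \<and> W \<noteq> {} \<and>
     (\<forall>C D. closedin T C \<longrightarrow> closedin T D \<longrightarrow> W \<subseteq> C \<union> D \<longrightarrow> W \<subseteq> C \<or> W \<subseteq> D)"

section \<open>Rational functions and divisors\<close>

text \<open>In this section \<open>X\<close> is an irreducible variety. A rational function is represented by its
  regular representative on the largest possible domain, so \<open>dom F\<close> is its domain of definition.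
  An identity between rational functions is stated on some nonempty open set.\<close>

definition generically :: "'p fspace \<Rightarrow> ('p \<Rightarrow> bool) \<Rightarrow> bool" where
  "generically X P \<longleftrightarrow> (\<exists>V. openin (fs_top X) V \<and> V \<noteq> {} \<and> (\<forall>x\<in>V. P x))"

definition rational_funs :: "'p fspace \<Rightarrow> ('p \<rightharpoonup> complex) set" where
  "rational_funs X = {F. dom F \<noteq> {} \<and> fs_reg X (dom F) (the \<circ> F) \<and>
     (\<forall>U f. fs_reg X U f \<longrightarrow> dom F \<subseteq> U \<longrightarrow> (\<forall>x\<in>dom F. F x = Some (f x)) \<longrightarrow> U = dom F)}"

definition of_regular :: "'p fspace \<Rightarrow> ('p \<Rightarrow> complex) \<Rightarrow> ('p \<rightharpoonup> complex)" where
  "of_regular X f = (\<lambda>x. if x \<in> fs_points X then Some (f x) else None)"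

definition nonzero_rational_funs :: "'p fspace \<Rightarrow> ('p \<rightharpoonup> complex) set" where
  "nonzero_rational_funs X = {F \<in> rational_funs X. \<exists>x\<in>dom F. F x \<noteq> Some 0}"

text \<open>The local ring at the generic point of an irreducible closed subset \<open>W\<close> and its maximal
  ideal. For a point \<open>x\<close> the local ring at \<open>x\<close> is \<open>local_ring X {x}\<close>.\<close>

definition local_ring :: "'p fspace \<Rightarrow> 'p set \<Rightarrow> ('p \<rightharpoonup> complex) set" where
  "local_ring X W = {F \<in> rational_funs X. dom F \<inter> W \<noteq> {}}"

definition local_ideal :: "'p fspace \<Rightarrow> 'p set \<Rightarrow> ('p \<rightharpoonup> complex) set" where
  "local_ideal X W = {F \<in> local_ring X W. \<forall>x\<in>dom F \<inter> W. F x = Some 0}"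

text \<open>All local rings are integrally closed in the function field.\<close>

definition normal_fspace :: "'p fspace \<Rightarrow> bool" where
  "normal_fspace X \<longleftrightarrow> irreducible_in (fs_top X) (fs_points X) \<and>
     (\<forall>x\<in>fs_points X. \<forall>F\<in>rational_funs X. \<forall>n>0. \<forall>A.
        (\<forall>i<n. A i \<in> local_ring X {x}) \<longrightarrow>
        generically X (\<lambda>y. the (F y) ^ n + (\<Sum>i<n. the (A i y) * the (F y) ^ i) = 0) \<longrightarrow>
        F \<in> local_ring X {x})"

text \<open>Codimension one means maximal among the proper irreducible closed subsets.\<close>

definition prime_divisors :: "'p fspace \<Rightarrow> 'p set set" where
  "prime_divisors X = {D. closedin (fs_top X) D \<and> irreducible_in (fs_top X) D \<and> D \<noteq> fs_points X \<and>
     (\<forall>W. closedin (fs_top X) W \<longrightarrow> irreducible_in (fs_top X) W \<longrightarrow> D \<subseteq> W \<longrightarrow>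
        W = D \<or> W = fs_points X)}"

definition uniformizer :: "'p fspace \<Rightarrow> 'p set \<Rightarrow> ('p \<rightharpoonup> complex) \<Rightarrow> bool" where
  "uniformizer X D P \<longleftrightarrow> P \<in> local_ideal X D \<and>
     (\<forall>F\<in>local_ideal X D. \<exists>Q\<in>local_ring X D. generically X (\<lambda>x. the (F x) = the (Q x) * the (P x)))"

text \<open>\<open>F\<close> has order \<open>n\<close> along the prime divisor \<open>D\<close>: it is a unit of the discrete valuation ring
  \<open>local_ring X D\<close> times the \<open>n\<close>-th power of a uniformizer.\<close>

definition has_order :: "'p fspace \<Rightarrow> 'p set \<Rightarrow> ('p \<rightharpoonup> complex) \<Rightarrow> int \<Rightarrow> bool" where
  "has_order X D F n \<longleftrightarrow> (\<exists>P U. uniformizer X D P \<and> U \<in> local_ring X D - local_ideal X D \<and>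
     generically X (\<lambda>x. the (F x) = the (U x) * the (P x) powi n))"

text \<open>Every Weil divisor is principal.\<close>

definition trivial_class_group :: "'p fspace \<Rightarrow> bool" where
  "trivial_class_group X \<longleftrightarrow>
     (\<forall>n :: 'p set \<Rightarrow> int. finite {D \<in> prime_divisors X. n D \<noteq> 0} \<longrightarrow>
        (\<exists>F\<in>nonzero_rational_funs X. \<forall>D\<in>prime_divisors X. has_order X D F (n D)))"

section \<open>Linear algebraic groups\<close>

text \<open>Linear algebraic groups over the complex numbers are Zariski closed subgroups of a general
  linear group.\<close>

definition GL :: "(complex^'n^'n) monoid" where
  "GL = \<lparr>carrier = {A. invertible A}, mult = (**), one = mat 1\<rparr>"

definition mat_coords :: "(complex^'n^'n \<Rightarrow> complex) set" where
  "mat_coords = {(\<lambda>A. A $ i $ j) |i j. True}"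

abbreviation mat_space :: "(complex^'n^'n) set \<Rightarrow> (complex^'n^'n) fspace" where
  "mat_space \<equiv> zariski_space mat_coords"

abbreviation subgrp :: "(complex^'n^'n) set \<Rightarrow> (complex^'n^'n) monoid" where
  "subgrp G \<equiv> GL\<lparr>carrier := G\<rparr>"

definition algebraic_group :: "(complex^'n^'n) set \<Rightarrow> bool" where
  "algebraic_group G \<longleftrightarrow> subgroup G GL \<and> closedin (fs_top (mat_space (carrier GL))) G"

definition zariski_connected :: "(complex^'n^'n) set \<Rightarrow> bool" where
  "zariski_connected G \<longleftrightarrow> connected_space (fs_top (mat_space G))"

definition unipotent :: "complex^'n^'n \<Rightarrow> bool" where
  "unipotent A \<longleftrightarrow> (\<exists>k. (((**) (A - mat 1)) ^^ k) (mat 1) = 0)"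

definition connected_reductive :: "(complex^'n^'n) set \<Rightarrow> bool" where
  "connected_reductive G \<longleftrightarrow> algebraic_group G \<and> zariski_connected G \<and>
     (\<forall>U. algebraic_group U \<and> zariski_connected U \<and> U \<lhd> subgrp G \<and> (\<forall>u\<in>U. unipotent u)
        \<longrightarrow> U = {mat 1})"

definition semisimple :: "(complex^'n^'n) set \<Rightarrow> bool" where
  "semisimple G \<longleftrightarrow> algebraic_group G \<and> zariski_connected G \<and>
     (\<forall>R. algebraic_group R \<and> zariski_connected R \<and> R \<lhd> subgrp G \<and> solvable (subgrp R)
        \<longrightarrow> R = {mat 1})"

definition borel_subgroup :: "(complex^'n^'n) set \<Rightarrow> (complex^'n^'n) set \<Rightarrow> bool" where
  "borel_subgroup G B \<longleftrightarrow>
     algebraic_group B \<and> zariski_connected B \<and> solvable (subgrp B) \<and> B \<subseteq> G \<and>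
     (\<forall>B'. algebraic_group B' \<and> zariski_connected B' \<and> solvable (subgrp B') \<and> B \<subseteq> B' \<and> B' \<subseteq> G
        \<longrightarrow> B' = B)"

text \<open>The torus of rank \<open>k\<close> as a set of sequences that are \<open>1\<close> from position \<open>k\<close> on.\<close>

definition Gm :: "nat \<Rightarrow> (nat \<Rightarrow> complex) set" where
  "Gm k = {z. (\<forall>i<k. z i \<noteq> 0) \<and> (\<forall>i\<ge>k. z i = 1)}"

definition torus :: "(complex^'n^'n) set \<Rightarrow> bool" where
  "torus C \<longleftrightarrow> algebraic_group C \<and>
     (\<exists>k \<phi>. fs_iso (zariski_space {(\<lambda>z. z i) |i. True} (Gm k)) (mat_space C) \<phi> \<and>
        (\<forall>z\<in>Gm k. \<forall>w\<in>Gm k. \<phi> (\<lambda>i. z i * w i) = \<phi> z ** \<phi> w))"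

definition prod_mat_space ::
  "(complex^'n^'n) set \<Rightarrow> (complex^'n^'n) set \<Rightarrow> ((complex^'n^'n) \<times> (complex^'n^'n)) fspace" where
  "prod_mat_space S C =
     zariski_space ({x \<circ> fst |x. x \<in> mat_coords} \<union> {x \<circ> snd |x. x \<in> mat_coords}) (S \<times> C)"

text \<open>\<open>G\<close> is, as an algebraic group, the product of a simply connected semisimple group \<open>S\<close> and a
  torus \<open>C\<close>. For semisimple complex groups the algebraic notion of simple connectedness agrees
  with the topological one, in the Euclidean topology.\<close>

definition simply_connected_type :: "(complex^'n^'n) set \<Rightarrow> bool" where
  "simply_connected_type G \<longleftrightarrow> (\<exists>S C. semisimple S \<and> simply_connected S \<and> torus C \<and>
     fs_iso (prod_mat_space S C) (mat_space G) (\<lambda>(s, c). s ** c) \<and>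
     (\<forall>s\<in>S. \<forall>c\<in>C. s ** c = c ** s))"

section \<open>Spherical homogeneous spaces\<close>

text \<open>The points of \<open>G/H\<close> are the cosets \<open>g <#\<^bsub>GL\<^esub> H\<close>, with the quotient topology; the regular
  functions are those whose pullback to \<open>G\<close> is regular. The group acts by \<open>(g, P) \<mapsto> g <#\<^bsub>GL\<^esub> P\<close>.\<close>

definition homogeneous_space ::
  "(complex^'n^'n) set \<Rightarrow> (complex^'n^'n) set \<Rightarrow> (complex^'n^'n) set fspace" where
  "homogeneous_space G H =
    (let T = topology (\<lambda>U. U \<subseteq> (\<lambda>g. g <#\<^bsub>GL\<^esub> H) ` G \<and>
                           openin (fs_top (mat_space G)) {g \<in> G. g <#\<^bsub>GL\<^esub> H \<in> U}) in
     \<lparr>fs_top = T,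
      fs_reg = (\<lambda>U f. openin T U \<and>
        fs_reg (mat_space G) {g \<in> G. g <#\<^bsub>GL\<^esub> H \<in> U} (\<lambda>g. f (g <#\<^bsub>GL\<^esub> H)))\<rparr>)"

lemma openin_homogeneous_space:
  "openin (fs_top (homogeneous_space G H)) U \<longleftrightarrow>
     U \<subseteq> (\<lambda>g. g <#\<^bsub>GL\<^esub> H) ` G \<and> openin (fs_top (mat_space G)) {g \<in> G. g <#\<^bsub>GL\<^esub> H \<in> U}"
proof -
  let ?pre = "\<lambda>U. {g \<in> G. g <#\<^bsub>GL\<^esub> H \<in> U}"
  let ?P = "\<lambda>U. U \<subseteq> (\<lambda>g. g <#\<^bsub>GL\<^esub> H) ` G \<and> openin (fs_top (mat_space G)) (?pre U)"
  have "?P (S \<inter> T)" if "?P S" "?P T" for S T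
  proof -
    have "?pre (S \<inter> T) = ?pre S \<inter> ?pre T" by auto
    with that show ?thesis by (metis (no_types, lifting) openin_Int le_infI1)
  qed
  moreover have "?P (\<Union>K)" if "\<forall>U\<in>K. ?P U" for K
  proof -
    have "?pre (\<Union>K) = \<Union>(?pre ` K)" by auto
    moreover have "openin (fs_top (mat_space G)) (\<Union>(?pre ` K))"
      using that by (intro openin_Union) blast
    moreover have "\<Union>K \<subseteq> (\<lambda>g. g <#\<^bsub>GL\<^esub> H) ` G" using that by (intro Union_least) blast
    ultimately show ?thesis by simp
  qed
  ultimately have "istopology ?P" unfolding istopology_def by blast
  then show ?thesis
    by (simp only: homogeneous_space_def Let_def topology_inverse' fspace.select_convs)
qed

text \<open>The normality condition is always satisfied; it is kept as part of the usual definition.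
  That the homogeneous space is a variety is a theorem and not a condition.\<close>

definition spherical ::
  "(complex^'n^'n) set \<Rightarrow> (complex^'n^'n) set \<Rightarrow> (complex^'n^'n) set \<Rightarrow> bool" where
  "spherical G B H \<longleftrightarrow> normal_fspace (homogeneous_space G H) \<and>
     (\<exists>x\<in>fs_points (homogeneous_space G H).
        fs_top (homogeneous_space G H) closure_of ((\<lambda>b. b <#\<^bsub>GL\<^esub> x) ` B) =
        fs_points (homogeneous_space G H))"

definition stable :: "(complex^'n^'n) set \<Rightarrow> (complex^'n^'n) set set \<Rightarrow> bool" where
  "stable K D \<longleftrightarrow> (\<forall>g\<in>K. (\<lambda>x. g <#\<^bsub>GL\<^esub> x) ` D = D)"

definition colors ::
  "(complex^'n^'n) set \<Rightarrow> (complex^'n^'n) set \<Rightarrow> (complex^'n^'n) set \<Rightarrow> (complex^'n^'n) set set set" where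
  "colors G B H = {D \<in> prime_divisors (homogeneous_space G H). stable B D \<and> \<not> stable G D}"

text \<open>The translate \<open>(g f)(x) = f (g\<^sup>-\<^sup>1 x)\<close>, for partial as well as for total functions.\<close>

definition translate ::
  "complex^'n^'n \<Rightarrow> ((complex^'n^'n) set \<Rightarrow> 'v) \<Rightarrow> (complex^'n^'n) set \<Rightarrow> 'v" where
  "translate g F = (\<lambda>x. F (inv\<^bsub>GL\<^esub> g <#\<^bsub>GL\<^esub> x))"

text \<open>A character is a homomorphism of algebraic groups to the multiplicative group.\<close>

definition characters :: "(complex^'n^'n) set \<Rightarrow> (complex^'n^'n \<Rightarrow> complex) set" where
  "characters B = {\<omega> \<in> extensional B. fs_reg (mat_space B) B \<omega> \<and> (\<forall>b\<in>B. \<omega> b \<noteq> 0) \<and>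
     (\<forall>b\<in>B. \<forall>c\<in>B. \<omega> (b ** c) = \<omega> b * \<omega> c)}"

definition semi_invariant ::
  "(complex^'n^'n) set \<Rightarrow> (complex^'n^'n) set \<Rightarrow> (complex^'n^'n) set \<Rightarrow>
   ((complex^'n^'n) set \<rightharpoonup> complex) \<Rightarrow> (complex^'n^'n \<Rightarrow> complex) \<Rightarrow> bool" where
  "semi_invariant G B H F \<omega> \<longleftrightarrow> F \<in> nonzero_rational_funs (homogeneous_space G H) \<and>
     \<omega> \<in> characters B \<and> (\<forall>b\<in>B. translate b F = map_option (\<lambda>z. \<omega> b * z) \<circ> F)"

definition weight ::
  "(complex^'n^'n) set \<Rightarrow> (complex^'n^'n) set \<Rightarrow> (complex^'n^'n) set \<Rightarrow>
   ((complex^'n^'n) set \<rightharpoonup> complex) \<Rightarrow> (complex^'n^'n \<Rightarrow> complex)" where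
  "weight G B H F = (THE \<omega>. semi_invariant G B H F \<omega>)"

definition weight_lattice ::
  "(complex^'n^'n) set \<Rightarrow> (complex^'n^'n) set \<Rightarrow> (complex^'n^'n) set \<Rightarrow> (complex^'n^'n \<Rightarrow> complex) set" where
  "weight_lattice G B H = {\<omega>. \<exists>F. semi_invariant G B H F \<omega>}"

section \<open>Puiseux points and tropicalization\<close>

text \<open>A point of the closed subset \<open>Y\<close> of \<open>X\<close> over the field of Puiseux series is a morphism from
  the spectrum of that field to \<open>Y\<close>. It is given by the irreducible closed subset \<open>W\<close> whose generic
  point is its image, and a local homomorphism from the local ring along \<open>W\<close> to the field of
  Puiseux series, written here as a compatible family \<open>\<phi> U\<close> of homomorphisms on the rings of regular
  functions on the open sets \<open>U\<close> that meet \<open>W\<close>.\<close>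

type_synonym 'p puiseux_point = "'p set \<times> ('p set \<Rightarrow> ('p \<Rightarrow> complex) \<Rightarrow> puiseux)"

definition puiseux_points :: "'p fspace \<Rightarrow> 'p set \<Rightarrow> 'p puiseux_point set" where
  "puiseux_points X Y = {(W, \<phi>).
     closedin (fs_top X) W \<and> irreducible_in (fs_top X) W \<and> W \<subseteq> Y \<and>
     (\<forall>U. openin (fs_top X) U \<and> U \<inter> W \<noteq> {} \<longrightarrow>
        (\<forall>c. \<phi> U (\<lambda>_. c) = puiseux_const c) \<and>
        (\<forall>f h. fs_reg X U f \<and> fs_reg X U h \<longrightarrow>
           \<phi> U (\<lambda>x. f x + h x) = \<phi> U f + \<phi> U h \<and> \<phi> U (\<lambda>x. f x * h x) = \<phi> U f * \<phi> U h) \<and>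
        (\<forall>f. fs_reg X U f \<longrightarrow> (\<phi> U f = 0 \<longleftrightarrow> (\<forall>x\<in>U \<inter> W. f x = 0))) \<and>
        (\<forall>V f h. fs_reg X U f \<and> openin (fs_top X) V \<and> V \<subseteq> U \<and> V \<inter> W \<noteq> {} \<and> (\<forall>x\<in>V. h x = f x)
           \<longrightarrow> \<phi> V h = \<phi> U f))}"

text \<open>The image of the point lies in the domain of the rational function \<open>F\<close>.\<close>

definition defined_at :: "'p puiseux_point \<Rightarrow> ('p \<rightharpoonup> complex) \<Rightarrow> bool" where
  "defined_at \<gamma> F \<longleftrightarrow> dom F \<inter> fst \<gamma> \<noteq> {}"

definition pullback :: "'p puiseux_point \<Rightarrow> ('p \<rightharpoonup> complex) \<Rightarrow> puiseux" where
  "pullback \<gamma> F = snd \<gamma> (dom F) (the \<circ> F)"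

text \<open>The valuation attached to \<open>\<gamma>\<close>: the value of the valuation of Puiseux series on the pullback of
  a sufficiently general translate of \<open>F\<close>, that is, of \<open>translate g F\<close> for all \<open>g\<close> in a nonempty open
  subset of \<open>G\<close>. For regular \<open>F\<close> this is the minimum over all \<open>g\<close>; for rational \<open>F\<close> it is the
  difference of the general values for numerator and denominator.\<close>

definition spherical_val ::
  "(complex^'n^'n) set \<Rightarrow> (complex^'n^'n) set puiseux_point \<Rightarrow> ((complex^'n^'n) set \<rightharpoonup> complex) \<Rightarrow> rat" where
  "spherical_val G \<gamma> F = (THE a. \<exists>U. openin (fs_top (mat_space G)) U \<and> U \<noteq> {} \<and>
     (\<forall>g\<in>U. defined_at \<gamma> (translate g F) \<and> puiseux_val (pullback \<gamma> (translate g F)) = Fin a))"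

text \<open>An element of the rational span of the dual of the weight lattice is written as a rational
  valued function on the weight lattice. The value does not depend on the chosen semi-invariant.\<close>

definition spherical_trop ::
  "(complex^'n^'n) set \<Rightarrow> (complex^'n^'n) set \<Rightarrow> (complex^'n^'n) set \<Rightarrow> (complex^'n^'n) set set \<Rightarrow>
   ((complex^'n^'n \<Rightarrow> complex) \<Rightarrow> rat) set" where
  "spherical_trop G B H Y =
     (\<lambda>\<gamma>. \<lambda>\<omega>\<in>weight_lattice G B H. spherical_val G \<gamma> (SOME F. semi_invariant G B H F \<omega>)) `
       puiseux_points (homogeneous_space G H) Y"

section \<open>The toric embedding\<close>

text \<open>\<open>f i 0\<close> is an equation of the color \<open>D i\<close>, and \<open>f i 0, \<dots>, f i (s i - 1)\<close> is a basis of the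
  span of its translates that consists of translates.\<close>

definition color_equations ::
  "(complex^'n^'n) set \<Rightarrow> (complex^'n^'n) set \<Rightarrow> (complex^'n^'n) set \<Rightarrow>
   nat \<Rightarrow> (nat \<Rightarrow> (complex^'n^'n) set set) \<Rightarrow> (nat \<Rightarrow> nat) \<Rightarrow>
   (nat \<Rightarrow> nat \<Rightarrow> (complex^'n^'n) set \<Rightarrow> complex) \<Rightarrow> bool" where
  "color_equations G B H r D s f \<longleftrightarrow> (let X = homogeneous_space G H; P = fs_points X in
     \<forall>i<r.
       fs_reg X P (f i 0) \<and>
       (\<exists>\<omega>. semi_invariant G B H (of_regular X (f i 0)) \<omega>) \<and>
       {x \<in> P. f i 0 x = 0} = D i \<and> has_order X (D i) (of_regular X (f i 0)) 1 \<and>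
       0 < s i \<and>
       (\<forall>j<s i. \<exists>g\<in>G. \<forall>x\<in>P. f i j x = translate g (f i 0) x) \<and>
       (\<forall>c. (\<forall>x\<in>P. (\<Sum>j<s i. c j * f i j x) = 0) \<longrightarrow> (\<forall>j<s i. c j = 0)) \<and>
       (\<forall>g\<in>G. \<exists>c. \<forall>x\<in>P. translate g (f i 0) x = (\<Sum>j<s i. c j * f i j x)))"

definition units :: "'p fspace \<Rightarrow> ('p \<Rightarrow> complex) set" where
  "units X = {u. fs_reg X (fs_points X) u \<and> (\<forall>x\<in>fs_points X. u x \<noteq> 0)}"

text \<open>The classes of \<open>g 0, \<dots>, g (m - 1)\<close> form a basis of the group of units modulo constants.\<close>

definition unit_basis :: "'p fspace \<Rightarrow> nat \<Rightarrow> (nat \<Rightarrow> 'p \<Rightarrow> complex) \<Rightarrow> bool" where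
  "unit_basis X m g \<longleftrightarrow> (\<forall>k<m. g k \<in> units X) \<and>
     (\<forall>u\<in>units X. \<exists>c e. \<forall>x\<in>fs_points X. u x = c * (\<Prod>k<m. g k x powi (e k :: int))) \<and>
     (\<forall>c e. (\<forall>x\<in>fs_points X. (\<Prod>k<m. g k x powi (e k :: int)) = c) \<longrightarrow> (\<forall>k<m. e k = 0))"

text \<open>The weights of the \<open>f i 0\<close> and the \<open>g k\<close> form a basis of the weight lattice. The dual basis
  identifies the rational span of the dual lattice with the space of pairs of rational coordinate
  vectors: the coordinates of \<open>l\<close> in the dual basis are its values on these weights. The map
  \<open>psi\<close> below takes values in these coordinates.\<close>

definition dual_coords ::
  "(complex^'n^'n) set \<Rightarrow> (complex^'n^'n) set \<Rightarrow> (complex^'n^'n) set \<Rightarrow>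
   nat \<Rightarrow> (nat \<Rightarrow> nat \<Rightarrow> (complex^'n^'n) set \<Rightarrow> complex) \<Rightarrow>
   nat \<Rightarrow> (nat \<Rightarrow> (complex^'n^'n) set \<Rightarrow> complex) \<Rightarrow>
   ((complex^'n^'n \<Rightarrow> complex) \<Rightarrow> rat) \<Rightarrow> (nat \<Rightarrow> rat) \<times> (nat \<Rightarrow> rat)" where
  "dual_coords G B H r f m g l = (let X = homogeneous_space G H in
     (\<lambda>i\<in>{..<r}. l (weight G B H (of_regular X (f i 0))),
      \<lambda>k\<in>{..<m}. l (weight G B H (of_regular X (g k)))))"

text \<open>Extended rationals are the elements other than \<open>Minf\<close> of the type \<open>rat extended\<close>.\<close>

definition toric_trop_Z0 ::
  "nat \<Rightarrow> (nat \<Rightarrow> nat) \<Rightarrow> nat \<Rightarrow> ((nat \<Rightarrow> nat \<Rightarrow> rat extended) \<times> (nat \<Rightarrow> rat extended)) set" where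
  "toric_trop_Z0 r s m =
     (\<Pi>\<^sub>E i\<in>{..<r}. {a \<in> {..<s i} \<rightarrow>\<^sub>E - {Minf}. \<exists>j<s i. a j \<noteq> Pinf}) \<times> ({..<m} \<rightarrow>\<^sub>E range Fin)"

definition toric_trop ::
  "(complex^'n^'n) set fspace \<Rightarrow>
   nat \<Rightarrow> (nat \<Rightarrow> nat) \<Rightarrow> (nat \<Rightarrow> nat \<Rightarrow> (complex^'n^'n) set \<Rightarrow> complex) \<Rightarrow>
   nat \<Rightarrow> (nat \<Rightarrow> (complex^'n^'n) set \<Rightarrow> complex) \<Rightarrow> (complex^'n^'n) set set \<Rightarrow>
   ((nat \<Rightarrow> nat \<Rightarrow> rat extended) \<times> (nat \<Rightarrow> rat extended)) set" where
  "toric_trop X r s f m g Y =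
     (\<lambda>\<gamma>. (\<lambda>i\<in>{..<r}. \<lambda>j\<in>{..<s i}. puiseux_val (pullback \<gamma> (of_regular X (f i j))),
           \<lambda>k\<in>{..<m}. puiseux_val (pullback \<gamma> (of_regular X (g k))))) ` puiseux_points X Y"

definition psi ::
  "nat \<Rightarrow> (nat \<Rightarrow> nat) \<Rightarrow> nat \<Rightarrow>
   (nat \<Rightarrow> nat \<Rightarrow> rat extended) \<times> (nat \<Rightarrow> rat extended) \<Rightarrow> (nat \<Rightarrow> rat) \<times> (nat \<Rightarrow> rat)" where
  "psi r s m = (\<lambda>(a, b)\<in>toric_trop_Z0 r s m.
     (\<lambda>i\<in>{..<r}. THE q. Fin q = Min (a i ` {..<s i}),
      \<lambda>k\<in>{..<m}. THE q. Fin q = b k))"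

end

(* For a Puiseux point gamma the lowest exponents of the pullbacks of f_i1, ..., f_is have a minimum v,
   attained since the f_ij have no common zero. The coefficient of t^v in the pullback of the translate
   g f_i is a linear functional of g f_i, so it is a regular function of g, and it does not vanish
   identically because some f_ij is itself a translate. Hence the general translate of f_i has value v
   at gamma. Two nonempty open subsets of G meet since a connected algebraic group is irreducible.

   The units are G-eigenvectors: translation permutes the countably many classes of units modulo
   constants, so for points x and y the function u(g x) / u(g y) of g has only countably many values.
   By Amitsur's trick (uncountably many elements of an algebra of countable dimension over the complex
   numbers are linearly dependent), which also gives the Nullstellensatz, it is constant. *)
theory Submission
  imports Defs "HOL-Library.Function_Algebras" "HOL-Computational_Algebra.Fundamental_Theorem_Algebra"
begin

section \<open>Functions, polynomial functions and Amitsur's trick\<close>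

text \<open>Both sides are images of the same set of Puiseux points, so a pointwise identity is
  enough. Two choices shape the spherical side. \<open>spherical_val\<close> is a \<open>THE\<close>
  over nonempty open subsets of G, so irreducibility must come first. The value at a weight is taken
  on a semi-invariant picked by \<open>SOME\<close>; a dense B-orbit shows that it is a nonzero
  multiple of the color equation or unit at hand, and this factor c is carried through the lemmas on
  values. Units must be eigenvectors for two reasons: their weights have to exist, and, as psi takes
  no minimum in their coordinates, all translates of a unit must have the same value. Countably many
  values are turned into constancy inside the ring of polynomials in the matrix entries. Regular
  functions are only local quotients, so Amitsur's argument is carried out for P - c Q modulo a
  prime ideal, with divisors of powers of K in place of invertible elements. With Q = 1 it yields
  the Nullstellensatz, which supplies the divisibility needed when it is applied again to
  units.\<close>

definition fscale :: "complex \<Rightarrow> ('p \<Rightarrow> complex) \<Rightarrow> 'p \<Rightarrow> complex" where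
  "fscale c f = (\<lambda>x. c * f x)"

lemma fscale_apply: "fscale c f x = c * f x"
  by (simp add: fscale_def)

text \<open>The domain type stays arbitrary, so the same vector space serves functions on points
  and, in \<open>evaluations\<close>, functionals on functions.\<close>

interpretation fun_vs: vector_space fscale
  by standard (auto simp: fun_eq_iff fscale_apply plus_fun_apply zero_fun_apply times_fun_apply algebra_simps)

lemma sum_fun_apply: "(\<Sum>i\<in>S. f i) x = (\<Sum>i\<in>S. f i x)"
  for f :: "'i \<Rightarrow> 'p \<Rightarrow> complex"
  by (induction S rule: infinite_finite_induct) (auto simp: plus_fun_apply zero_fun_apply times_fun_apply one_fun_apply)

lemma prod_fun_apply: "(\<Prod>i\<in>S. f i) x = (\<Prod>i\<in>S. f i x)"
  for f :: "'i \<Rightarrow> 'p \<Rightarrow> complex"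
  by (induction S rule: infinite_finite_induct) (auto simp: plus_fun_apply zero_fun_apply times_fun_apply one_fun_apply)

lemma power_fun_apply: "(f ^ n) x = f x ^ n"
  for f :: "'p \<Rightarrow> complex"
  by (induction n) (auto simp: times_fun_apply one_fun_apply)

declare plus_fun_apply [simp del] zero_fun_apply [simp del] times_fun_apply [simp del]
  one_fun_apply [simp del]

lemma minus_fun_apply: "(f - g) x = f x - g x" "(- f) x = - f x" for f g :: "'p \<Rightarrow> complex"
  by auto

lemmas fun_apply = plus_fun_apply zero_fun_apply times_fun_apply one_fun_apply fscale_apply
  minus_fun_apply sum_fun_apply prod_fun_apply power_fun_apply

section \<open>Ring operations on polynomial functions\<close>

lemma poly_fun_add: "p \<in> poly_fun cs \<Longrightarrow> q \<in> poly_fun cs \<Longrightarrow> p + q \<in> poly_fun cs"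
  unfolding plus_fun_def by (rule poly_fun.add)

lemma poly_fun_mult: "p \<in> poly_fun cs \<Longrightarrow> q \<in> poly_fun cs \<Longrightarrow> p * q \<in> poly_fun cs"
  unfolding times_fun_def by (rule poly_fun.mult)

lemma poly_fun_zero: "0 \<in> poly_fun cs"
  unfolding zero_fun_def by (rule poly_fun.const)

lemma poly_fun_one: "1 \<in> poly_fun cs"
  unfolding one_fun_def by (rule poly_fun.const)

lemma poly_fun_scale: "p \<in> poly_fun cs \<Longrightarrow> fscale c p \<in> poly_fun cs"
  unfolding fscale_def by (intro poly_fun.mult poly_fun.const)

lemma poly_fun_uminus: "p \<in> poly_fun cs \<Longrightarrow> - p \<in> poly_fun cs"
  using poly_fun_scale[of p cs "-1"] by (simp add: fscale_def fun_Compl_def)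

lemma poly_fun_diff: "p \<in> poly_fun cs \<Longrightarrow> q \<in> poly_fun cs \<Longrightarrow> p - q \<in> poly_fun cs"
  using poly_fun_add[of p cs "- q"] poly_fun_uminus[of q cs] by simp

lemma poly_fun_sum: "(\<And>i. i \<in> S \<Longrightarrow> f i \<in> poly_fun cs) \<Longrightarrow> (\<Sum>i\<in>S. f i) \<in> poly_fun cs"
  by (induction S rule: infinite_finite_induct) (auto simp: poly_fun_zero poly_fun_add)

lemma poly_fun_prod: "(\<And>i. i \<in> S \<Longrightarrow> f i \<in> poly_fun cs) \<Longrightarrow> (\<Prod>i\<in>S. f i) \<in> poly_fun cs"
  by (induction S rule: infinite_finite_induct) (auto simp: poly_fun_one poly_fun_mult)

lemma poly_fun_power: "f \<in> poly_fun cs \<Longrightarrow> f ^ n \<in> poly_fun cs"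
  by (induction n) (auto simp: poly_fun_one poly_fun_mult)

text \<open>Monomials are written as words in the coordinates. Different words may give the same
  function; what matters is that countably many coordinates have countably many words, so that the
  ring has countable dimension.\<close>

lemma poly_fun_span_monomials:
  "p \<in> poly_fun cs \<Longrightarrow> p \<in> fun_vs.span (prod_list ` lists cs)"
proof (induction rule: poly_fun.induct)
  case (const c)
  have "(1 :: 'a \<Rightarrow> complex) \<in> prod_list ` lists cs" by (rule image_eqI[of _ _ "[]"]) auto
  then have "fscale c 1 \<in> fun_vs.span (prod_list ` lists cs)"
    by (intro fun_vs.span_scale fun_vs.span_base)
  moreover have "fscale c 1 = (\<lambda>_::'a. c)" by (simp add: fun_eq_iff fun_apply)
  ultimately show ?case by (simp only:)
next
  case (coord x)
  then have "x \<in> prod_list ` lists cs" by (intro image_eqI[of _ _ "[x]"]) auto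
  then show ?case by (rule fun_vs.span_base)
next
  case (add p q)
  then show ?case using fun_vs.span_add[of p _ q] by (simp add: plus_fun_def)
next
  case (mult p q)
  let ?M = "prod_list ` lists cs"
  have base: "a * b \<in> ?M" if ab: "a \<in> ?M" "b \<in> ?M" for a b
  proof -
    from ab obtain k l where "k \<in> lists cs" "l \<in> lists cs" "a = prod_list k" "b = prod_list l" by auto
    then show ?thesis by (intro image_eqI[of _ _ "k @ l"]) auto
  qed
  have "a * q \<in> fun_vs.span ?M" if a: "a \<in> ?M" for a
    using mult.IH(2)
  proof (induction rule: fun_vs.span_induct_alt)
    case base
    then show ?case by (simp add: fun_vs.span_zero)
  next
    case (step c x y)
    have "a * (fscale c x + y) = fscale c (a * x) + a * y" by (auto simp: fun_eq_iff fun_apply algebra_simps)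
    then show ?case using step base[OF a]
      by (simp add: fun_vs.span_add fun_vs.span_scale fun_vs.span_base)
  qed
  with mult.IH(1) have "p * q \<in> fun_vs.span ?M"
  proof (induction rule: fun_vs.span_induct_alt)
    case base
    then show ?case by (simp add: fun_vs.span_zero)
  next
    case (step c x y)
    have "(fscale c x + y) * q = fscale c (x * q) + y * q" by (auto simp: fun_eq_iff fun_apply algebra_simps)
    then show ?case using step by (simp add: fun_vs.span_add fun_vs.span_scale)
  qed
  then show ?case by (simp add: times_fun_def)
qed

section \<open>Ideals of the ring of polynomial functions\<close>

definition poly_ideal :: "('p \<Rightarrow> complex) set \<Rightarrow> ('p \<Rightarrow> complex) set \<Rightarrow> bool" where
  "poly_ideal cs J \<longleftrightarrow> J \<subseteq> poly_fun cs \<and> 0 \<in> J \<and> (\<forall>a\<in>J. \<forall>b\<in>J. a + b \<in> J) \<and>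
     (\<forall>a\<in>poly_fun cs. \<forall>b\<in>J. a * b \<in> J)"

lemma poly_ideal_add: "poly_ideal cs J \<Longrightarrow> a \<in> J \<Longrightarrow> b \<in> J \<Longrightarrow> a + b \<in> J"
  and poly_ideal_mult: "poly_ideal cs J \<Longrightarrow> a \<in> poly_fun cs \<Longrightarrow> b \<in> J \<Longrightarrow> a * b \<in> J"
  and poly_ideal_zero: "poly_ideal cs J \<Longrightarrow> 0 \<in> J"
  and poly_ideal_sub: "poly_ideal cs J \<Longrightarrow> J \<subseteq> poly_fun cs"
  by (auto simp: poly_ideal_def)

lemma poly_ideal_scale: "poly_ideal cs J \<Longrightarrow> b \<in> J \<Longrightarrow> fscale c b \<in> J"
  using poly_ideal_mult[of cs J "\<lambda>_. c" b] poly_fun.const[of c cs]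
  by (simp add: fscale_def times_fun_def)

lemma poly_ideal_diff: "poly_ideal cs J \<Longrightarrow> a \<in> J \<Longrightarrow> b \<in> J \<Longrightarrow> a - b \<in> J"
  using poly_ideal_add[of cs J a "fscale (-1) b"] poly_ideal_scale[of cs J b "-1"]
  by simp

lemma poly_ideal_sum: "poly_ideal cs J \<Longrightarrow> (\<And>i. i \<in> S \<Longrightarrow> f i \<in> J) \<Longrightarrow> (\<Sum>i\<in>S. f i) \<in> J"
  by (induction S rule: infinite_finite_induct) (auto simp: poly_ideal_zero intro: poly_ideal_add)

definition prime_poly_ideal :: "('p \<Rightarrow> complex) set \<Rightarrow> ('p \<Rightarrow> complex) set \<Rightarrow> bool" where
  "prime_poly_ideal cs J \<longleftrightarrow> poly_ideal cs J \<and> 1 \<notin> J \<and>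
     (\<forall>a\<in>poly_fun cs. \<forall>b\<in>poly_fun cs. a * b \<in> J \<longrightarrow> a \<in> J \<or> b \<in> J)"

lemma prime_poly_idealD:
  "prime_poly_ideal cs J \<Longrightarrow> a * b \<in> J \<Longrightarrow> a \<in> poly_fun cs \<Longrightarrow> b \<in> poly_fun cs \<Longrightarrow> a \<in> J \<or> b \<in> J"
  by (auto simp: prime_poly_ideal_def)

lemma prime_poly_ideal_power:
  "prime_poly_ideal cs J \<Longrightarrow> a ^ n \<in> J \<Longrightarrow> a \<in> poly_fun cs \<Longrightarrow> a \<in> J"
proof (induction n)
  case 0
  then show ?case by (simp only: power_0 prime_poly_ideal_def)
next
  case (Suc n)
  then show ?case using prime_poly_idealD[of cs J a "a ^ n"] by (auto simp: poly_fun_power)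
qed

text \<open>Multisets rather than sets, because the linear factors of a binary form may
  repeat.\<close>

lemma prime_poly_ideal_prod_mset:
  assumes "prime_poly_ideal cs J" "\<And>i. i \<in># S \<Longrightarrow> f i \<in> poly_fun cs" "(\<Prod>i\<in>#S. f i) \<in> J"
  shows "\<exists>i\<in>#S. f i \<in> J"
proof -
  \<comment> \<open>Membership of the partial products in the ring is carried along, since primality
    speaks only of elements of \<open>poly_fun cs\<close>.\<close>
  have "(\<Prod>i\<in>#S. f i) \<in> poly_fun cs \<and> ((\<Prod>i\<in>#S. f i) \<in> J \<longrightarrow> (\<exists>i\<in>#S. f i \<in> J))"
    using assms(2)
  proof (induction S)
    case empty
    then show ?case using assms(1) poly_fun_one[of cs]
      unfolding prime_poly_ideal_def image_mset_empty prod_mset_empty by blast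
  next
    case (add x S)
    then have "f x \<in> poly_fun cs" "(\<Prod>i\<in>#S. f i) \<in> poly_fun cs"
      "(\<Prod>i\<in>#S. f i) \<in> J \<Longrightarrow> \<exists>i\<in>#S. f i \<in> J" by auto
    then show ?case using prime_poly_idealD[OF assms(1), of "f x" "\<Prod>i\<in>#S. f i"]
        poly_fun_mult[of "f x" cs "\<Prod>i\<in>#S. f i"]
      unfolding image_mset_add_mset prod_mset.add_mset by auto
  qed
  then show ?thesis using assms(3) by blast
qed

section \<open>Amitsur's argument\<close>

lemma prod_mset_fun_apply: "(\<Prod>i\<in>#S. f i) x = (\<Prod>i\<in>#S. f i x)"
  for f :: "'i \<Rightarrow> 'p \<Rightarrow> complex"
  by (induction S) (auto simp: fun_apply)

lemma poly_ideal_cong: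
  assumes "poly_ideal cs J" "a - b \<in> J"
  shows "a \<in> J \<longleftrightarrow> b \<in> J"
proof -
  have "a = (a - b) + b" "b = a - (a - b)" by (simp_all add: fun_eq_iff)
  then show ?thesis using assms poly_ideal_add poly_ideal_diff by metis
qed

text \<open>Pigeonhole: with finite fibres only, L would be a countable union of finite
  sets.\<close>

lemma uncountable_common_value:
  assumes "uncountable L" "\<And>x. x \<in> L \<Longrightarrow> F x \<in> T" "countable T"
  obtains t where "t \<in> T" "infinite {x \<in> L. F x = t}"
proof -
  have "L \<subseteq> (\<Union>t\<in>T. {x \<in> L. F x = t})" using assms(2) by auto
  then have "\<exists>t\<in>T. infinite {x \<in> L. F x = t}"
    using assms(1,3) by (meson countable_UN countable_finite countable_subset)
  then show ?thesis using that by blast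
qed

text \<open>The factor \<open>v ^ Suc d\<close> makes the identity hold at \<open>v = 0\<close> and for every degree of the form.\<close>

lemma binary_form_factor:
  assumes "finite S" "c0 \<in> S" "al c0 \<noteq> (0::complex)"
  shows "\<exists>c d n R. c \<noteq> 0 \<and>
    (\<forall>u v. v ^ Suc d * (\<Sum>c\<in>S. al c * (\<Prod>e\<in>S - {c}. u - e * v)) =
       c * v ^ Suc n * (\<Prod>e\<in>#R. u - e * v))"
proof -
  \<comment> \<open>The binary form, dehomogenized at v = 1.\<close>
  define h where "h = (\<Sum>c\<in>S. smult (al c) (\<Prod>e\<in>S - {c}. [:- e, 1:]))"
  have h: "poly h z = (\<Sum>c\<in>S. al c * (\<Prod>e\<in>S - {c}. z - e))" for z
    by (simp add: h_def poly_sum poly_prod)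
  \<comment> \<open>At \<open>c0\<close> every other summand has a vanishing factor, so h is not the
    zero polynomial and can be factored.\<close>
  have "poly h c0 = al c0 * (\<Prod>e\<in>S - {c0}. c0 - e)"
  proof -
    have "(\<Prod>e\<in>S - {c}. c0 - e) = 0" if "c \<noteq> c0" "c \<in> S" for c
      using that assms by (intro prod_zero) auto
    then have "(\<Sum>c\<in>S. al c * (\<Prod>e\<in>S - {c}. c0 - e)) = (\<Sum>c\<in>{c0}. al c * (\<Prod>e\<in>S - {c}. c0 - e))"
      using assms by (intro sum.mono_neutral_right) auto
    then show ?thesis by (simp add: h)
  qed
  also have "\<dots> \<noteq> 0" using assms by auto
  finally have "h \<noteq> 0" by auto
  from alg_closed_imp_factorization[OF this] obtain R
    where R: "size R = degree h" "h = smult (lead_coeff h) (\<Prod>x\<in>#R. [:- x, 1:])"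
    by (elim exE conjE)
  have hR: "poly h z = lead_coeff h * (\<Prod>e\<in>#R. z - e)" for z
    by (subst R(2)) (simp add: poly_prod_mset image_mset.compositionality o_def)
  \<comment> \<open>The degree of the form: each summand is a product of card S - 1 linear forms.
    The degree of h, which is the size of R, may be smaller, hence two separate powers of v.\<close>
  define n where "n = card S - 1"
  have "v ^ Suc (size R) * (\<Sum>c\<in>S. al c * (\<Prod>e\<in>S - {c}. u - e * v)) =
       lead_coeff h * v ^ Suc n * (\<Prod>e\<in>#R. u - e * v)" for u v
  proof (cases "v = 0")
    case False
    have "(\<Prod>e\<in>S - {c}. u - e * v) = v ^ n * (\<Prod>e\<in>S - {c}. u / v - e)" if "c \<in> S" for c
    proof -
      have "(\<Prod>e\<in>S - {c}. u - e * v) = (\<Prod>e\<in>S - {c}. v * (u / v - e))"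
        using False by (intro prod.cong) (auto simp: field_simps)
      then show ?thesis using that assms by (simp add: prod.distrib n_def)
    qed
    then have 1: "(\<Sum>c\<in>S. al c * (\<Prod>e\<in>S - {c}. u - e * v)) = v ^ n * poly h (u / v)"
      unfolding h sum_distrib_left by (intro sum.cong) auto
    have "(\<Prod>e\<in>#R. u - e * v) = (\<Prod>e\<in>#R. v * (u / v - e))"
      using False by (intro arg_cong[of _ _ prod_mset] image_mset_cong) (auto simp: field_simps)
    also have "\<dots> = v ^ size R * (\<Prod>e\<in>#R. u / v - e)"
      by (simp add: prod_mset.distrib)
    finally show ?thesis unfolding 1 hR by (simp add: algebra_simps)
  qed simp
  moreover have "lead_coeff h \<noteq> 0" using \<open>h \<noteq> 0\<close> by simp
  ultimately show ?thesis by (intro exI conjI allI)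
qed

text \<open>Modulo J, each P - c Q divides a power of K, with a cofactor b in a space of countable
  dimension. Infinitely many c share the exponent N and a finite-dimensional space for b, so some of
  the cofactors are linearly dependent. Clearing denominators turns the dependence into a binary
  form in P and Q that lies in J. Over the complex numbers the form splits into linear factors, and
  primality puts one of them into J.\<close>

lemma amitsur:
  assumes J: "prime_poly_ideal cs J" and cs: "countable cs"
    and P: "P \<in> poly_fun cs" and Q: "Q \<in> poly_fun cs" "Q \<notin> J" and K: "K \<in> poly_fun cs" "K \<notin> J"
    and L: "uncountable L"
    and inv: "\<And>c. c \<in> L \<Longrightarrow> \<exists>n. \<exists>b\<in>poly_fun cs. K ^ n - (P - fscale c Q) * b \<in> J"
  shows "\<exists>c. P - fscale c Q \<in> J"
proof (rule ccontr)
  assume no: "\<nexists>c. P - fscale c Q \<in> J"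
  note id = J[unfolded prime_poly_ideal_def, THEN conjunct1]
  let ?M = "prod_list ` lists cs"
  define lin where "lin c = P - fscale c Q" for c
  have lin: "lin c \<in> poly_fun cs" "lin c \<notin> J" for c
    using no P Q by (auto simp: lin_def intro: poly_fun_diff poly_fun_scale)
  have "\<forall>c\<in>L. \<exists>n b F. b \<in> poly_fun cs \<and> K ^ n - lin c * b \<in> J \<and>
      finite F \<and> F \<subseteq> ?M \<and> b \<in> fun_vs.span F"
  proof
    fix c assume "c \<in> L"
    then obtain n b where b: "b \<in> poly_fun cs" "K ^ n - lin c * b \<in> J"
      using inv unfolding lin_def by blast
    then obtain F r where "finite F" "F \<subseteq> ?M" "b = (\<Sum>a\<in>F. fscale (r a) a)"
      using poly_fun_span_monomials[OF b(1)] unfolding fun_vs.span_explicit by blast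
    then have "finite F" "F \<subseteq> ?M" "b \<in> fun_vs.span F"
      by (auto intro!: fun_vs.span_sum fun_vs.span_scale intro: fun_vs.span_base)
    with b show "\<exists>n b F. b \<in> poly_fun cs \<and> K ^ n - lin c * b \<in> J \<and>
      finite F \<and> F \<subseteq> ?M \<and> b \<in> fun_vs.span F" by blast
  qed
  from this[unfolded bchoice_iff] obtain n b F where nbF: "\<forall>c\<in>L. b c \<in> poly_fun cs \<and>
      K ^ n c - lin c * b c \<in> J \<and> finite (F c) \<and> F c \<subseteq> ?M \<and> b c \<in> fun_vs.span (F c)"
    by (elim exE)
  have b: "b c \<in> poly_fun cs" "K ^ n c - lin c * b c \<in> J"
    and F: "finite (F c) \<and> F c \<subseteq> ?M" "b c \<in> fun_vs.span (F c)" if "c \<in> L" for c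
    using bspec[OF nbF that] by simp_all
  \<comment> \<open>There are only countably many pairs of an exponent and a finite set of
    monomials, so infinitely many c share one pair (N, T).\<close>
  have "countable ?M" using cs by auto
  then have "countable ((UNIV :: nat set) \<times> {F. finite F \<and> F \<subseteq> ?M})"
    by (intro countable_SIGMA countable_Collect_finite_subset) auto
  moreover have "(n c, F c) \<in> UNIV \<times> {F. finite F \<and> F \<subseteq> ?M}" if "c \<in> L" for c
    using F(1)[OF that] by simp
  ultimately obtain t where t: "t \<in> (UNIV :: nat set) \<times> {F. finite F \<and> F \<subseteq> ?M}"
    and inf: "infinite {c \<in> L. (n c, F c) = t}"
    using uncountable_common_value[OF L, of "\<lambda>c. (n c, F c)"] by blast
  obtain N T where NT: "t = (N, T)" by (cases t)
  with t have T: "finite T" by auto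
  \<comment> \<open>One element more than T has, which forces a linear relation among the b
    c.\<close>
  obtain S where S: "S \<subseteq> {c \<in> L. (n c, F c) = (N, T)}" "finite S" "card S = Suc (card T)"
    using infinite_arbitrarily_large[OF inf, of "Suc (card T)"] unfolding NT by (elim exE conjE)
  have bS: "b c \<in> poly_fun cs" "K ^ N - lin c * b c \<in> J" "b c \<in> fun_vs.span T" if "c \<in> S" for c
    using that S(1) b[of c] F(2)[of c] by auto
  have KN: "K ^ N \<notin> J" using prime_poly_ideal_power[OF J _ K(1)] K(2) by blast
  \<comment> \<open>Equal cofactors for c and e would give (c - e) Q b in J, hence b in J and then K
    ^ N in J.\<close>
  have inj: "inj_on b S"
  proof (rule inj_onI, rule ccontr)
    fix c e assume ce: "c \<in> S" "e \<in> S" "b c = b e" "c \<noteq> e"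
    have "(K ^ N - lin c * b c) - (K ^ N - lin e * b c) = fscale (c - e) (Q * b c)"
      by (auto simp: fun_eq_iff fun_apply lin_def algebra_simps)
    then have "fscale (c - e) (Q * b c) \<in> J"
      using poly_ideal_diff[OF id bS(2)[OF ce(1)] bS(2)[OF ce(2)]] ce(3) by simp
    then have "fscale (1 / (c - e)) (fscale (c - e) (Q * b c)) \<in> J" by (rule poly_ideal_scale[OF id])
    then have "Q * b c \<in> J" using ce(4) by simp
    then have "b c \<in> J" using prime_poly_idealD[OF J _ Q(1) bS(1)[OF ce(1)]] Q(2) by blast
    then have "lin c * b c \<in> J" using poly_ideal_mult[OF id lin(1)] by blast
    then have "K ^ N \<in> J" using poly_ideal_cong[OF id bS(2)[OF ce(1)]] by blast
    with KN show False ..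
  qed
  have "fun_vs.dependent (b ` S)"
  proof (rule ccontr)
    assume "\<not> fun_vs.dependent (b ` S)"
    then have "card (b ` S) \<le> card T"
      using fun_vs.independent_span_bound[OF T] bS(3) by blast
    then show False using card_image[OF inj] S(3) by simp
  qed
  then obtain u v where uv: "(\<Sum>w\<in>b ` S. fscale (u w) w) = 0" "v \<in> b ` S" "u v \<noteq> 0"
    using fun_vs.dependent_finite[of "b ` S"] S(2) by auto
  define al where "al c = u (b c)" for c
  have al: "(\<Sum>c\<in>S. fscale (al c) (b c)) = 0"
    using uv(1) by (simp add: sum.reindex[OF inj] al_def)
  from uv obtain c0 where c0: "c0 \<in> S" "al c0 \<noteq> 0" by (auto simp: al_def)
  \<comment> \<open>H arises from the relation among the b c by multiplying with all
    \<open>lin e\<close> and replacing each lin c * b c by K ^ N modulo J.\<close>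
  define H where "H = (\<Sum>c\<in>S. fscale (al c) (\<Prod>e\<in>S - {c}. lin e))"
  have "K ^ N * H - (\<Prod>e\<in>S. lin e) * (\<Sum>c\<in>S. fscale (al c) (b c)) =
      (\<Sum>c\<in>S. fscale (al c) ((\<Prod>e\<in>S - {c}. lin e) * (K ^ N - lin c * b c)))"
  proof -
    have "(\<Prod>e\<in>S. lin e) = (\<Prod>e\<in>S - {c}. lin e) * lin c" if "c \<in> S" for c
      using prod.remove[OF S(2) that, of lin] by (simp only: mult.commute)
    then have "(\<Prod>e\<in>S. lin e) * (\<Sum>c\<in>S. fscale (al c) (b c)) =
        (\<Sum>c\<in>S. fscale (al c) ((\<Prod>e\<in>S - {c}. lin e) * lin c * b c))"
      unfolding sum_distrib_left by (intro sum.cong refl) (simp add: fun_eq_iff fun_apply)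
    moreover have "K ^ N * H = (\<Sum>c\<in>S. fscale (al c) ((\<Prod>e\<in>S - {c}. lin e) * K ^ N))"
      unfolding H_def sum_distrib_left by (intro sum.cong refl) (simp add: fun_eq_iff fun_apply)
    moreover have "fscale a (p * (k - l * b)) = fscale a (p * k) - fscale a (p * l * b)"
      for a and p k l b :: "'a \<Rightarrow> complex" by (simp add: fun_eq_iff fun_apply algebra_simps)
    ultimately show ?thesis by (simp only: sum_subtractf)
  qed
  also have "\<dots> \<in> J"
    using bS(2) lin(1)
    by (intro poly_ideal_sum[OF id] poly_ideal_scale[OF id] poly_ideal_mult[OF id] poly_fun_prod) auto
  finally have "K ^ N * H \<in> J" unfolding al by simp
  moreover have Hp: "H \<in> poly_fun cs"
    unfolding H_def by (intro poly_fun_sum poly_fun_scale poly_fun_prod lin)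
  ultimately have HJ: "H \<in> J"
    using prime_poly_idealD[OF J _ poly_fun_power[OF K(1)] Hp] KN by blast
  \<comment> \<open>H x is a binary form in u = P x and v = Q x whose coefficients do not depend on
    x, so its factorization is an identity of functions.\<close>
  obtain c d l R where c: "c \<noteq> 0" and
    "\<forall>u v. v ^ Suc d * (\<Sum>c\<in>S. al c * (\<Prod>e\<in>S - {c}. u - e * v)) =
       c * v ^ Suc l * (\<Prod>e\<in>#R. u - e * v)"
    using binary_form_factor[OF S(2) c0(1), of al, OF c0(2)] by (elim exE conjE)
  then have fac: "v ^ Suc d * (\<Sum>c\<in>S. al c * (\<Prod>e\<in>S - {c}. u - e * v)) =
       c * v ^ Suc l * (\<Prod>e\<in>#R. u - e * v)" for u v by blast
  have "Q ^ Suc d * H = fscale c (Q ^ Suc l * (\<Prod>e\<in>#R. lin e))"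
  proof
    fix x
    show "(Q ^ Suc d * H) x = fscale c (Q ^ Suc l * (\<Prod>e\<in>#R. lin e)) x"
      unfolding H_def times_fun_apply power_fun_apply sum_fun_apply fscale_apply
        prod_fun_apply prod_mset_fun_apply lin_def fun_diff_def fac mult.assoc[symmetric] ..
  qed
  then have "fscale c (Q ^ Suc l * (\<Prod>e\<in>#R. lin e)) \<in> J"
    using poly_ideal_mult[OF id poly_fun_power[OF Q(1)] HJ, of "Suc d"] by (simp only:)
  from poly_ideal_scale[OF id this, of "1 / c"]
  have QJ: "Q ^ Suc l * (\<Prod>e\<in>#R. lin e) \<in> J" using c by simp
  have "(\<Prod>e\<in>#R. lin e) \<in> poly_fun cs"
    by (induction R) (auto intro: poly_fun_one poly_fun_mult lin)
  then have "Q ^ Suc l \<in> J \<or> (\<Prod>e\<in>#R. lin e) \<in> J"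
    by (intro prime_poly_idealD[OF J QJ] poly_fun_power Q)
  then have "(\<Prod>e\<in>#R. lin e) \<in> J"
    using prime_poly_ideal_power[OF J _ Q(1), of "Suc l"] Q(2) by blast
  from prime_poly_ideal_prod_mset[OF J lin(1) this] obtain e where "lin e \<in> J" by (rule bexE)
  with lin(2) show False ..
qed


section \<open>The Nullstellensatz\<close>

text \<open>The ideal generated by J and a, written through congruence modulo J.\<close>

definition ideal_insert :: "('p \<Rightarrow> complex) set \<Rightarrow> ('p \<Rightarrow> complex) set \<Rightarrow> ('p \<Rightarrow> complex) \<Rightarrow>
    ('p \<Rightarrow> complex) set" where
  "ideal_insert cs J a = {p \<in> poly_fun cs. \<exists>b\<in>poly_fun cs. p - a * b \<in> J}"

lemma poly_ideal_insert:
  assumes J: "poly_ideal cs J" and a: "a \<in> poly_fun cs"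
  shows "poly_ideal cs (ideal_insert cs J a)" "J \<subseteq> ideal_insert cs J a" "a \<in> ideal_insert cs J a"
proof -
  have 0: "p - a * 0 = p" for p :: "'a \<Rightarrow> complex" by (simp add: fun_eq_iff fun_apply)
  show "J \<subseteq> ideal_insert cs J a"
  proof
    fix p assume p: "p \<in> J"
    then have "p \<in> poly_fun cs" using poly_ideal_sub[OF J] by (rule subsetD[rotated])
    then show "p \<in> ideal_insert cs J a"
      unfolding ideal_insert_def using p poly_fun_zero[of cs] by (intro CollectI conjI bexI[of _ 0]) (simp_all only: 0)
  qed
  have "a - a * 1 = 0" by (simp add: fun_eq_iff fun_apply)
  then show "a \<in> ideal_insert cs J a"
    unfolding ideal_insert_def using a poly_fun_one[of cs] poly_ideal_zero[OF J]
    by (intro CollectI conjI bexI[of _ 1]) (simp_all only:)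
  show "poly_ideal cs (ideal_insert cs J a)"
    unfolding poly_ideal_def
  proof (intro conjI ballI)
    show "ideal_insert cs J a \<subseteq> poly_fun cs" by (auto simp: ideal_insert_def)
    show "0 \<in> ideal_insert cs J a"
      using \<open>J \<subseteq> ideal_insert cs J a\<close> poly_ideal_zero[OF J] by (rule subsetD)
  next
    fix p q assume "p \<in> ideal_insert cs J a" "q \<in> ideal_insert cs J a"
    then obtain b c where *: "p \<in> poly_fun cs" "q \<in> poly_fun cs" "b \<in> poly_fun cs" "c \<in> poly_fun cs"
      "p - a * b \<in> J" "q - a * c \<in> J" by (auto simp: ideal_insert_def)
    have "p + q - a * (b + c) = (p - a * b) + (q - a * c)" by (simp add: fun_eq_iff fun_apply algebra_simps)
    then have "p + q - a * (b + c) \<in> J" using poly_ideal_add[OF J *(5,6)] by (simp only:)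
    then show "p + q \<in> ideal_insert cs J a"
      unfolding ideal_insert_def using * by (intro CollectI conjI bexI[of _ "b + c"] poly_fun_add)
  next
    fix p q assume "p \<in> poly_fun cs" "q \<in> ideal_insert cs J a"
    then obtain c where *: "p \<in> poly_fun cs" "q \<in> poly_fun cs" "c \<in> poly_fun cs"
      "q - a * c \<in> J" by (auto simp: ideal_insert_def)
    have "p * q - a * (p * c) = p * (q - a * c)" by (simp add: fun_eq_iff fun_apply algebra_simps)
    then have "p * q - a * (p * c) \<in> J" using poly_ideal_mult[OF J *(1,4)] by (simp only:)
    then show "p * q \<in> ideal_insert cs J a"
      unfolding ideal_insert_def using * by (intro CollectI conjI bexI[of _ "p * c"] poly_fun_mult)
  qed
qed

text \<open>Zorn's lemma gives an ideal M containing J and maximal among those without a power of K;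
  such an ideal is prime. If a differed from every constant modulo M, each a - c would divide a
  power of K modulo M, and Amitsur's argument would put some a - c into M after all. So the residue
  ring is the field of complex numbers, and M plays the role of a point where K does not
  vanish.\<close>

lemma nullstellensatz:
  assumes cs: "countable cs" and J: "poly_ideal cs J" and K: "K \<in> poly_fun cs" "\<And>n. K ^ n \<notin> J"
  obtains M where "poly_ideal cs M" "J \<subseteq> M" "K \<notin> M" "\<And>a. a \<in> poly_fun cs \<Longrightarrow> \<exists>c. a - fscale c 1 \<in> M"
proof -
  define Z where "Z = {I. poly_ideal cs I \<and> J \<subseteq> I \<and> (\<forall>n. K ^ n \<notin> I)}"
  have "\<exists>M\<in>Z. \<forall>X\<in>Z. M \<subseteq> X \<longrightarrow> X = M"
  proof (rule subset_Zorn_nonempty)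
    have "J \<in> Z" using J K(2) by (simp add: Z_def)
    then show "Z \<noteq> {}" by blast
  next
    fix C assume C: "C \<noteq> {}" "subset.chain Z C"
    then have CZ: "I \<in> Z" if "I \<in> C" for I using that by (auto simp: subset.chain_def)
    then have Cid: "poly_ideal cs I" if "I \<in> C" for I using that by (auto simp: Z_def)
    have "poly_ideal cs (\<Union>C)"
      unfolding poly_ideal_def
    proof (intro conjI ballI)
      show "\<Union>C \<subseteq> poly_fun cs" using poly_ideal_sub[OF Cid] by (rule Union_least)
      show "0 \<in> \<Union>C" using C(1) poly_ideal_zero[OF Cid] by blast
    next
      fix a b assume "a \<in> \<Union>C" "b \<in> \<Union>C"
      then obtain A B where *: "A \<in> C" "a \<in> A" "B \<in> C" "b \<in> B" by (elim UnionE)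
      then have "A \<subseteq> B \<or> B \<subseteq> A" using C(2) by (auto simp: subset.chain_def)
      then show "a + b \<in> \<Union>C"
        using * poly_ideal_add[OF Cid[of A], of a b] poly_ideal_add[OF Cid[of B], of a b]
        by (meson UnionI subsetD)
    next
      fix a b assume "a \<in> poly_fun cs" "b \<in> \<Union>C"
      then show "a * b \<in> \<Union>C" using poly_ideal_mult[OF Cid] by (meson UnionE UnionI)
    qed
    moreover have "J \<subseteq> \<Union>C" using C(1) CZ unfolding Z_def by blast
    moreover have "K ^ n \<notin> \<Union>C" for n using CZ unfolding Z_def by blast
    ultimately show "\<Union>C \<in> Z" unfolding Z_def by (intro CollectI conjI allI)
  qed
  then obtain M where MZ: "M \<in> Z" and max: "\<And>X. X \<in> Z \<Longrightarrow> M \<subseteq> X \<Longrightarrow> X = M" by blast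
  then have M: "poly_ideal cs M" "J \<subseteq> M" "K ^ n \<notin> M" for n by (simp_all add: Z_def)
  have KM: "K \<notin> M" "1 \<notin> M" using M(3)[of 1] M(3)[of 0] by (simp_all only: power_one_right power_0 not_False_eq_True)
  \<comment> \<open>By maximality, adding an element a outside M produces a power of K in the
    ideal.\<close>
  have inv: "\<exists>n. \<exists>b\<in>poly_fun cs. K ^ n - a * b \<in> M" if a: "a \<in> poly_fun cs" "a \<notin> M" for a
  proof -
    note ins = poly_ideal_insert[OF M(1) a(1)]
    have "ideal_insert cs M a \<notin> Z"
    proof
      assume "ideal_insert cs M a \<in> Z"
      from max[OF this ins(2)] ins(3) a(2) show False by simp
    qed
    moreover have "J \<subseteq> ideal_insert cs M a" using M(2) ins(2) by (rule subset_trans)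
    ultimately obtain n where "K ^ n \<in> ideal_insert cs M a" using ins(1) by (auto simp: Z_def)
    then show ?thesis by (auto simp: ideal_insert_def)
  qed
  have prime: "prime_poly_ideal cs M"
    unfolding prime_poly_ideal_def
  proof (intro conjI ballI impI M(1) KM(2), rule ccontr)
    fix a b assume ab: "a \<in> poly_fun cs" "b \<in> poly_fun cs" "a * b \<in> M" "\<not> (a \<in> M \<or> b \<in> M)"
    then obtain n c m d where *: "c \<in> poly_fun cs" "K ^ n - a * c \<in> M" "d \<in> poly_fun cs" "K ^ m - b * d \<in> M"
      using inv[of a] inv[of b] by auto
    \<comment> \<open>The product of the congruences K ^ n = a c and K ^ m = b d, expanded so that
      every summand is visibly in M.\<close>
    have "K ^ (n + m) = K ^ m * (K ^ n - a * c) + (a * c) * (K ^ m - b * d) + (c * d) * (a * b)"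
      by (simp add: fun_eq_iff fun_apply algebra_simps power_add)
    moreover have "\<dots> \<in> M"
      by (intro poly_ideal_add[OF M(1)] poly_ideal_mult[OF M(1) _ *(2)] poly_ideal_mult[OF M(1) _ *(4)]
          poly_ideal_mult[OF M(1) _ ab(3)] poly_fun_mult poly_fun_power K(1) ab *)
    ultimately have "K ^ (n + m) \<in> M" by (simp only:)
    with M(3) show False ..
  qed
  have "\<exists>c. a - fscale c 1 \<in> M" if a: "a \<in> poly_fun cs" for a
  proof (rule ccontr)
    assume no: "\<not> ?thesis"
    have "\<exists>c. a - fscale c 1 \<in> M"
    proof (rule amitsur[OF prime cs a poly_fun_one KM(2) K(1) KM(1), of UNIV])
      show "uncountable (UNIV :: complex set)" by (rule uncountable_UNIV_complex)
      fix c :: complex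
      show "\<exists>n. \<exists>b\<in>poly_fun cs. K ^ n - (a - fscale c 1) * b \<in> M"
        using no by (intro inv poly_fun_diff a poly_fun_scale poly_fun_one) blast
    qed
    with no show False ..
  qed
  then show ?thesis using that M(1,2) KM(1) by (meson subsetI)
qed

section \<open>The Zariski topology and regular functions\<close>

text \<open>The generating sets are a basis and not merely a subbasis, because the sets p \<noteq> 0
  and q \<noteq> 0 meet in the set p q \<noteq> 0.\<close>

lemma openin_zariski_iff:
  "openin (zariski cs) U \<longleftrightarrow> (\<forall>x\<in>U. \<exists>p\<in>poly_fun cs. p x \<noteq> 0 \<and> (\<forall>y. p y \<noteq> 0 \<longrightarrow> y \<in> U))"
proof
  let ?B = "{{x. p x \<noteq> 0} |p. p \<in> poly_fun cs}"
  assume "openin (zariski cs) U"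
  then have "generate_topology_on ?B U"
    unfolding zariski_def by (rule openin_topology_generated_by)
  then show "\<forall>x\<in>U. \<exists>p\<in>poly_fun cs. p x \<noteq> 0 \<and> (\<forall>y. p y \<noteq> 0 \<longrightarrow> y \<in> U)"
  proof induction
    case Empty
    then show ?case by simp
  next
    case (Int a b)
    show ?case
    proof
      fix x assume "x \<in> a \<inter> b"
      then obtain p q where "p \<in> poly_fun cs" "q \<in> poly_fun cs" "p x \<noteq> 0" "q x \<noteq> 0"
        "\<forall>y. p y \<noteq> 0 \<longrightarrow> y \<in> a" "\<forall>y. q y \<noteq> 0 \<longrightarrow> y \<in> b" using Int.IH by blast
      then show "\<exists>p\<in>poly_fun cs. p x \<noteq> 0 \<and> (\<forall>y. p y \<noteq> 0 \<longrightarrow> y \<in> a \<inter> b)"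
        by (intro bexI[OF _ poly_fun.mult[of p cs q]]) auto
    qed
  next
    case (UN K)
    show ?case
    proof
      fix x assume "x \<in> \<Union>K"
      then obtain k where "k \<in> K" "x \<in> k" ..
      with UN.IH obtain p where "p \<in> poly_fun cs" "p x \<noteq> 0" "\<forall>y. p y \<noteq> 0 \<longrightarrow> y \<in> k" by blast
      with \<open>k \<in> K\<close> show "\<exists>p\<in>poly_fun cs. p x \<noteq> 0 \<and> (\<forall>y. p y \<noteq> 0 \<longrightarrow> y \<in> \<Union>K)" by blast
    qed
  next
    case (Basis s)
    then show ?case by auto
  qed
next
  assume *: "\<forall>x\<in>U. \<exists>p\<in>poly_fun cs. p x \<noteq> 0 \<and> (\<forall>y. p y \<noteq> 0 \<longrightarrow> y \<in> U)"
  have "U = \<Union>{{x. p x \<noteq> 0} |p. p \<in> poly_fun cs \<and> {x. p x \<noteq> 0} \<subseteq> U}"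
    using * by (auto simp: subset_eq) (metis (mono_tags, lifting) mem_Collect_eq)
  moreover have "openin (zariski cs) \<dots>"
    unfolding zariski_def
    by (intro openin_Union) (auto intro: topology_generated_by_Basis)
  ultimately show "openin (zariski cs) U" by simp
qed

lemma fs_top_zariski_space: "fs_top (zariski_space cs S) = subtopology (zariski cs) S"
  by (simp add: zariski_space_def Let_def)

lemma topspace_zariski: "topspace (zariski cs) = UNIV"
proof -
  have "openin (zariski cs) UNIV"
    unfolding openin_zariski_iff by (auto intro: bexI[OF _ poly_fun.const[of 1]])
  then show ?thesis using openin_subset by blast
qed

lemma fs_points_zariski_space [simp]: "fs_points (zariski_space cs S) = S"
  by (simp add: fs_top_zariski_space topspace_zariski)

lemma openin_zariski_space:
  "openin (fs_top (zariski_space cs S)) U \<longleftrightarrow> U \<subseteq> S \<and>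
     (\<forall>x\<in>U. \<exists>p\<in>poly_fun cs. p x \<noteq> 0 \<and> (\<forall>y\<in>S. p y \<noteq> 0 \<longrightarrow> y \<in> U))" (is "?L \<longleftrightarrow> ?R")
proof
  assume ?L
  then obtain T where "openin (zariski cs) T" "U = T \<inter> S"
    by (auto simp: fs_top_zariski_space openin_subtopology)
  then show ?R unfolding openin_zariski_iff by blast
next
  assume R: ?R
  define T where "T = \<Union>{{x. p x \<noteq> 0} |p. p \<in> poly_fun cs \<and> {x\<in>S. p x \<noteq> 0} \<subseteq> U}"
  have "openin (zariski cs) T"
    unfolding zariski_def T_def
    by (intro openin_Union) (auto intro: topology_generated_by_Basis)
  moreover have "U = T \<inter> S"
  proof
    show "T \<inter> S \<subseteq> U" by (auto simp: T_def)
    show "U \<subseteq> T \<inter> S"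
    proof
      fix x assume "x \<in> U"
      with R obtain p where "p \<in> poly_fun cs" "p x \<noteq> 0" "\<forall>y\<in>S. p y \<noteq> 0 \<longrightarrow> y \<in> U" "x \<in> S" by blast
      then show "x \<in> T \<inter> S" by (auto simp: T_def intro!: exI[of _ "{x. p x \<noteq> 0}"])
    qed
  qed
  ultimately show ?L by (auto simp: fs_top_zariski_space openin_subtopology)
qed

lemma openin_zariski_space_basic:
  "p \<in> poly_fun cs \<Longrightarrow> openin (fs_top (zariski_space cs S)) {x \<in> S. p x \<noteq> 0}"
  unfolding openin_zariski_space by auto

text \<open>The neighbourhood in the definition is absorbed into the denominator: the fraction is
  expanded by a polynomial that is nonzero at x and vanishes on S outside the neighbourhood. Then
  the identity with cleared denominators holds on U wherever the denominator is nonzero.\<close>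

lemma fs_reg_zariski_space:
  "fs_reg (zariski_space cs S) U f \<longleftrightarrow> openin (fs_top (zariski_space cs S)) U \<and>
     (\<forall>x\<in>U. \<exists>p\<in>poly_fun cs. \<exists>q\<in>poly_fun cs. q x \<noteq> 0 \<and> (\<forall>y\<in>U. q y \<noteq> 0 \<longrightarrow> f y * q y = p y))"
  (is "?L \<longleftrightarrow> ?O \<and> (\<forall>x\<in>U. ?R x)")
proof
  assume L: ?L
  have "?R x" if x: "x \<in> U" for x
  proof -
    have U: "U \<subseteq> S" using L by (auto simp: zariski_space_def Let_def openin_subtopology)
    from L x obtain V p q where V: "openin (fs_top (zariski_space cs S)) V" "x \<in> V" "V \<subseteq> U"
      and pq: "p \<in> poly_fun cs" "q \<in> poly_fun cs" "\<And>y. y \<in> V \<Longrightarrow> q y \<noteq> 0 \<and> f y = p y / q y"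
      unfolding zariski_space_def Let_def fspace.select_convs by meson
    from V obtain h where h: "h \<in> poly_fun cs" "h x \<noteq> 0" "\<And>y. y \<in> S \<Longrightarrow> h y \<noteq> 0 \<Longrightarrow> y \<in> V"
      unfolding openin_zariski_space by blast
    show ?thesis
      using pq(3)[OF V(2)] pq(3)[OF h(3)] h(2) U
      by (intro bexI[OF _ poly_fun.mult[OF pq(1) h(1)]] bexI[OF _ poly_fun.mult[OF pq(2) h(1)]]) auto
  qed
  with L show "?O \<and> (\<forall>x\<in>U. ?R x)"
    by (auto simp: zariski_space_def Let_def)
next
  assume R: "?O \<and> (\<forall>x\<in>U. ?R x)"
  have "\<exists>V p q. openin (fs_top (zariski_space cs S)) V \<and> x \<in> V \<and> V \<subseteq> U \<and> p \<in> poly_fun cs \<and>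
      q \<in> poly_fun cs \<and> (\<forall>y\<in>V. q y \<noteq> 0 \<and> f y = p y / q y)" if x: "x \<in> U" for x
  proof -
    obtain p q where pq: "p \<in> poly_fun cs" "q \<in> poly_fun cs" "q x \<noteq> 0"
      "\<forall>y\<in>U. q y \<noteq> 0 \<longrightarrow> f y * q y = p y" using R x by blast
    have U: "openin (fs_top (zariski_space cs S)) U" using R by blast
    have "openin (fs_top (zariski_space cs S)) (U \<inter> {x\<in>S. q x \<noteq> 0})"
      by (intro openin_Int U openin_zariski_space_basic pq(2))
    moreover have "x \<in> U \<inter> {x\<in>S. q x \<noteq> 0}" using x pq(3) openin_subset[OF U] by auto
    moreover have "\<forall>y\<in>U \<inter> {x\<in>S. q x \<noteq> 0}. q y \<noteq> 0 \<and> f y = p y / q y"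
      using pq(4) by (auto simp: field_simps)
    ultimately show ?thesis using pq(1,2) by (meson inf_le1)
  qed
  then show ?L using R by (simp add: zariski_space_def Let_def)
qed

lemma fs_regE:
  assumes "fs_reg (zariski_space cs S) U f" "x \<in> U"
  obtains p q where "p \<in> poly_fun cs" "q \<in> poly_fun cs" "q x \<noteq> 0"
    "\<forall>y\<in>U. q y \<noteq> 0 \<longrightarrow> f y * q y = p y"
  using assms unfolding fs_reg_zariski_space by blast

lemma fs_reg_openin: "fs_reg (zariski_space cs S) U f \<Longrightarrow> openin (fs_top (zariski_space cs S)) U"
  by (simp add: fs_reg_zariski_space)

lemma fs_reg_poly:
  "openin (fs_top (zariski_space cs S)) U \<Longrightarrow> p \<in> poly_fun cs \<Longrightarrow> fs_reg (zariski_space cs S) U p"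
  unfolding fs_reg_zariski_space
  by (intro conjI ballI bexI[of _ p] bexI[OF _ poly_fun.const[of 1]]) auto

lemma fs_reg_add:
  assumes "fs_reg (zariski_space cs S) U f" "fs_reg (zariski_space cs S) U h"
  shows "fs_reg (zariski_space cs S) U (\<lambda>x. f x + h x)"
  unfolding fs_reg_zariski_space
proof (intro conjI ballI)
  fix x assume "x \<in> U"
  obtain p q where 1: "p \<in> poly_fun cs" "q \<in> poly_fun cs" "q x \<noteq> 0"
    "\<forall>y\<in>U. q y \<noteq> 0 \<longrightarrow> f y * q y = p y" using fs_regE[OF assms(1) \<open>x \<in> U\<close>] .
  obtain p' q' where 2: "p' \<in> poly_fun cs" "q' \<in> poly_fun cs" "q' x \<noteq> 0"
    "\<forall>y\<in>U. q' y \<noteq> 0 \<longrightarrow> h y * q' y = p' y" using fs_regE[OF assms(2) \<open>x \<in> U\<close>] .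
  note * = 1 2
  show "\<exists>p\<in>poly_fun cs. \<exists>q\<in>poly_fun cs. q x \<noteq> 0 \<and> (\<forall>y\<in>U. q y \<noteq> 0 \<longrightarrow> (f y + h y) * q y = p y)"
  proof (rule bexI[where x = "(\<lambda>y. p y * q' y + p' y * q y)"], rule bexI[where x = "(\<lambda>y. q y * q' y)"],
      intro conjI ballI impI)
    show "(\<lambda>y. p y * q' y + p' y * q y) \<in> poly_fun cs" "(\<lambda>y. q y * q' y) \<in> poly_fun cs"
      by (intro poly_fun.add poly_fun.mult *)+
    show "q x * q' x \<noteq> 0" using * by simp
    fix y assume "y \<in> U" "q y * q' y \<noteq> 0"
    then have "f y * q y = p y" "h y * q' y = p' y" using * by auto
    then show "(f y + h y) * (q y * q' y) = p y * q' y + p' y * q y"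
      by (simp add: algebra_simps flip: \<open>f y * q y = p y\<close>)
  qed
qed (use assms fs_reg_openin in blast)

lemma fs_reg_mult:
  assumes "fs_reg (zariski_space cs S) U f" "fs_reg (zariski_space cs S) U h"
  shows "fs_reg (zariski_space cs S) U (\<lambda>x. f x * h x)"
  unfolding fs_reg_zariski_space
proof (intro conjI ballI)
  fix x assume "x \<in> U"
  obtain p q where 1: "p \<in> poly_fun cs" "q \<in> poly_fun cs" "q x \<noteq> 0"
    "\<forall>y\<in>U. q y \<noteq> 0 \<longrightarrow> f y * q y = p y" using fs_regE[OF assms(1) \<open>x \<in> U\<close>] .
  obtain p' q' where 2: "p' \<in> poly_fun cs" "q' \<in> poly_fun cs" "q' x \<noteq> 0"
    "\<forall>y\<in>U. q' y \<noteq> 0 \<longrightarrow> h y * q' y = p' y" using fs_regE[OF assms(2) \<open>x \<in> U\<close>] .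
  note * = 1 2
  show "\<exists>p\<in>poly_fun cs. \<exists>q\<in>poly_fun cs. q x \<noteq> 0 \<and> (\<forall>y\<in>U. q y \<noteq> 0 \<longrightarrow> (f y * h y) * q y = p y)"
  proof (rule bexI[where x = "(\<lambda>y. p y * p' y)"], rule bexI[where x = "(\<lambda>y. q y * q' y)"],
      intro conjI ballI impI)
    show "(\<lambda>y. p y * p' y) \<in> poly_fun cs" "(\<lambda>y. q y * q' y) \<in> poly_fun cs"
      by (intro poly_fun.add poly_fun.mult *)+
    show "q x * q' x \<noteq> 0" using * by simp
    fix y assume "y \<in> U" "q y * q' y \<noteq> 0"
    then have "f y * q y = p y" "h y * q' y = p' y" using * by auto
    then show "(f y * h y) * (q y * q' y) = p y * p' y"
      by (simp add: algebra_simps flip: \<open>f y * q y = p y\<close> \<open>h y * q' y = p' y\<close>)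
  qed
qed (use assms fs_reg_openin in blast)

lemma fs_reg_inverse:
  assumes "fs_reg (zariski_space cs S) U f" "\<And>x. x \<in> U \<Longrightarrow> f x \<noteq> 0"
  shows "fs_reg (zariski_space cs S) U (\<lambda>x. inverse (f x))"
  unfolding fs_reg_zariski_space
proof (intro conjI ballI)
  fix x assume x: "x \<in> U"
  obtain p q where *: "p \<in> poly_fun cs" "q \<in> poly_fun cs"
    "q x \<noteq> 0" "\<forall>y\<in>U. q y \<noteq> 0 \<longrightarrow> f y * q y = p y"
    using fs_regE[OF assms(1) x] .
  show "\<exists>p\<in>poly_fun cs. \<exists>q\<in>poly_fun cs. q x \<noteq> 0 \<and> (\<forall>y\<in>U. q y \<noteq> 0 \<longrightarrow> inverse (f y) * q y = p y)"
  \<comment> \<open>The fraction q / p is expanded by q, so that a nonzero denominator also ensures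
    q y \<noteq> 0, where f y * q y = p y is known.\<close>
  proof (rule bexI[where x = "(\<lambda>y. q y * q y)"], rule bexI[where x = "(\<lambda>y. p y * q y)"],
      intro conjI ballI impI)
    show "(\<lambda>y. q y * q y) \<in> poly_fun cs" "(\<lambda>y. p y * q y) \<in> poly_fun cs"
      by (intro poly_fun.add poly_fun.mult *)+
    show "p x * q x \<noteq> 0" using * assms(2)[OF x] x by (auto simp flip: *(4)[rule_format])
    fix y assume y: "y \<in> U" "p y * q y \<noteq> 0"
    then have "f y * q y = p y" using * by auto
    then show "inverse (f y) * (p y * q y) = q y * q y"
      using assms(2)[OF y(1)] by (simp add: field_simps flip: \<open>f y * q y = p y\<close>)
  qed
qed (use assms fs_reg_openin in blast)

lemma fs_reg_mono:
  assumes "fs_reg (zariski_space cs S) U f" "openin (fs_top (zariski_space cs S)) V" "V \<subseteq> U"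
  shows "fs_reg (zariski_space cs S) V f"
  unfolding fs_reg_zariski_space
proof (intro conjI ballI assms(2))
  fix x assume "x \<in> V"
  then have "x \<in> U" using assms(3) by blast
  obtain p q where *: "p \<in> poly_fun cs" "q \<in> poly_fun cs" "q x \<noteq> 0"
    "\<forall>y\<in>U. q y \<noteq> 0 \<longrightarrow> f y * q y = p y" using fs_regE[OF assms(1) \<open>x \<in> U\<close>] .
  show "\<exists>p\<in>poly_fun cs. \<exists>q\<in>poly_fun cs. q x \<noteq> 0 \<and> (\<forall>y\<in>V. q y \<noteq> 0 \<longrightarrow> f y * q y = p y)"
    using *(3,4) assms(3) by (intro bexI[OF _ *(1)] bexI[OF _ *(2)]) auto
qed

lemma fs_reg_cong:
  assumes "\<And>x. x \<in> U \<Longrightarrow> f x = h x"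
  shows "fs_reg (zariski_space cs S) U f \<longleftrightarrow> fs_reg (zariski_space cs S) U h"
  using assms unfolding fs_reg_zariski_space by simp

lemma openin_fs_reg_nonzero:
  assumes "fs_reg (zariski_space cs S) U f"
  shows "openin (fs_top (zariski_space cs S)) {x \<in> U. f x \<noteq> 0}"
proof (subst openin_subopen, intro ballI)
  fix x assume x: "x \<in> {x \<in> U. f x \<noteq> 0}"
  then have "x \<in> U" by simp
  obtain p q where *: "p \<in> poly_fun cs" "q \<in> poly_fun cs"
    "q x \<noteq> 0" "\<forall>y\<in>U. q y \<noteq> 0 \<longrightarrow> f y * q y = p y"
    using fs_regE[OF assms \<open>x \<in> U\<close>] .
  note U = fs_reg_openin[OF assms]
  show "\<exists>T. openin (fs_top (zariski_space cs S)) T \<and> x \<in> T \<and> T \<subseteq> {x \<in> U. f x \<noteq> 0}"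
  proof (intro exI conjI)
    show "openin (fs_top (zariski_space cs S)) (U \<inter> {x \<in> S. p x * q x \<noteq> 0})"
      by (intro openin_Int U openin_zariski_space_basic poly_fun.mult *)
    show "x \<in> U \<inter> {x \<in> S. p x * q x \<noteq> 0}"
      using x * openin_subset[OF U] by (auto simp flip: *(4)[rule_format])
    show "U \<inter> {x \<in> S. p x * q x \<noteq> 0} \<subseteq> {x \<in> U. f x \<noteq> 0}"
      using *(4) by auto
  qed
qed

lemma openin_pullback_poly:
  assumes "\<And>x. x \<in> S \<Longrightarrow> \<tau> x \<in> T" "\<And>p. p \<in> poly_fun ds \<Longrightarrow> (\<lambda>x. p (\<tau> x)) \<in> poly_fun cs"
    and U: "openin (fs_top (zariski_space ds T)) U"
  shows "openin (fs_top (zariski_space cs S)) {x \<in> S. \<tau> x \<in> U}"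
  unfolding openin_zariski_space
proof (intro conjI ballI)
  fix x assume "x \<in> {x \<in> S. \<tau> x \<in> U}"
  then obtain p where p: "p \<in> poly_fun ds" "p (\<tau> x) \<noteq> 0" "\<forall>y\<in>T. p y \<noteq> 0 \<longrightarrow> y \<in> U"
    using U unfolding openin_zariski_space by blast
  then show "\<exists>p\<in>poly_fun cs. p x \<noteq> 0 \<and> (\<forall>y\<in>S. p y \<noteq> 0 \<longrightarrow> y \<in> {x \<in> S. \<tau> x \<in> U})"
    using assms(1) by (intro bexI[OF _ assms(2)[OF p(1)]]) auto
qed auto

text \<open>Serves the left and right translations of G and the inclusion of B in G.\<close>

lemma fs_reg_pullback_poly:
  assumes "\<And>x. x \<in> S \<Longrightarrow> \<tau> x \<in> T" "\<And>p. p \<in> poly_fun ds \<Longrightarrow> (\<lambda>x. p (\<tau> x)) \<in> poly_fun cs"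
    and f: "fs_reg (zariski_space ds T) U f"
  shows "fs_reg (zariski_space cs S) {x \<in> S. \<tau> x \<in> U} (\<lambda>x. f (\<tau> x))"
  unfolding fs_reg_zariski_space
proof (intro conjI ballI)
  show "openin (fs_top (zariski_space cs S)) {x \<in> S. \<tau> x \<in> U}"
    by (rule openin_pullback_poly[where \<tau> = \<tau>, OF assms(1,2) fs_reg_openin[OF f]])
  fix x assume "x \<in> {x \<in> S. \<tau> x \<in> U}"
  then have "\<tau> x \<in> U" by simp
  obtain p q where pq: "p \<in> poly_fun ds" "q \<in> poly_fun ds"
    "q (\<tau> x) \<noteq> 0" "\<forall>y\<in>U. q y \<noteq> 0 \<longrightarrow> f y * q y = p y"
    using fs_regE[OF f \<open>\<tau> x \<in> U\<close>] .
  then show "\<exists>p\<in>poly_fun cs. \<exists>q\<in>poly_fun cs. q x \<noteq> 0 \<and>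
      (\<forall>y\<in>{x \<in> S. \<tau> x \<in> U}. q y \<noteq> 0 \<longrightarrow> f (\<tau> y) * q y = p y)"
    by (intro bexI[OF _ assms(2)[OF pq(1)]] bexI[OF _ assms(2)[OF pq(2)]]) auto
qed

section \<open>Polynomial functions of matrices\<close>

lemma poly_fun_sum': "(\<And>i. i \<in> S \<Longrightarrow> f i \<in> poly_fun cs) \<Longrightarrow> (\<lambda>x. \<Sum>i\<in>S. f i x) \<in> poly_fun cs"
proof -
  assume "\<And>i. i \<in> S \<Longrightarrow> f i \<in> poly_fun cs"
  moreover have "(\<lambda>x. \<Sum>i\<in>S. f i x) = sum f S" by (simp add: fun_eq_iff fun_apply)
  ultimately show ?thesis using poly_fun_sum[of S f cs] by (simp only:)
qed

lemma poly_fun_prod': "(\<And>i. i \<in> S \<Longrightarrow> f i \<in> poly_fun cs) \<Longrightarrow> (\<lambda>x. \<Prod>i\<in>S. f i x) \<in> poly_fun cs"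
proof -
  assume "\<And>i. i \<in> S \<Longrightarrow> f i \<in> poly_fun cs"
  moreover have "(\<lambda>x. \<Prod>i\<in>S. f i x) = prod f S" by (simp add: fun_eq_iff fun_apply)
  ultimately show ?thesis using poly_fun_prod[of S f cs] by (simp only:)
qed

lemma poly_fun_power': "f \<in> poly_fun cs \<Longrightarrow> (\<lambda>x. f x ^ n) \<in> poly_fun cs"
proof -
  assume "f \<in> poly_fun cs"
  moreover have "(\<lambda>x. f x ^ n) = f ^ n" by (simp add: fun_eq_iff fun_apply)
  ultimately show ?thesis using poly_fun_power[of f cs n] by (simp only:)
qed

lemma mat_coord: "(\<lambda>A :: complex^'n^'n. A $ i $ j) \<in> mat_coords"
  by (auto simp: mat_coords_def)

lemma poly_fun_mat_coord: "(\<lambda>A :: complex^'n^'n. A $ i $ j) \<in> poly_fun mat_coords"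
  by (rule poly_fun.coord[OF mat_coord])

lemma finite_mat_coords: "finite (mat_coords :: (complex^'n^'n \<Rightarrow> complex) set)"
proof -
  have "mat_coords = range (\<lambda>(i, j) (A :: complex^'n^'n). A $ i $ j)"
    by (auto simp: mat_coords_def)
  moreover have "finite (range (\<lambda>(i, j) (A :: complex^'n^'n). A $ i $ j))"
    by (rule finite_imageI[OF finite_class.finite_UNIV])
  ultimately show ?thesis by (simp only:)
qed

lemma poly_fun_compose_coords:
  fixes \<tau> :: "'p \<Rightarrow> complex^'n^'n"
  assumes "p \<in> poly_fun mat_coords" "\<And>i j. (\<lambda>x. \<tau> x $ i $ j) \<in> poly_fun cs"
  shows "(\<lambda>x. p (\<tau> x)) \<in> poly_fun cs"
  using assms(1)
proof induction
  case (coord x)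
  then show ?case using assms(2) by (auto simp: mat_coords_def)
qed (auto intro: poly_fun.intros)

lemma poly_fun_det:
  fixes \<tau> :: "'p \<Rightarrow> complex^'n^'n"
  assumes "\<And>i j. (\<lambda>x. \<tau> x $ i $ j) \<in> poly_fun cs"
  shows "(\<lambda>x. det (\<tau> x)) \<in> poly_fun cs"
  unfolding det_def by (intro poly_fun_sum' poly_fun.mult poly_fun_prod' poly_fun.const assms)

lemma poly_fun_translate:
  assumes "p \<in> poly_fun mat_coords"
  shows "(\<lambda>x. p (a ** x ** b)) \<in> poly_fun mat_coords"
  by (rule poly_fun_compose_coords[OF assms])
    (auto simp: matrix_matrix_mult_def intro!: poly_fun_sum' poly_fun.mult poly_fun.const poly_fun_mat_coord)

lemma poly_fun_left_translate:
  assumes "p \<in> poly_fun mat_coords"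
  shows "(\<lambda>x. p (a ** x)) \<in> poly_fun mat_coords"
  using poly_fun_translate[OF assms, of a "mat 1"] by simp

lemma poly_fun_right_translate:
  assumes "p \<in> poly_fun mat_coords"
  shows "(\<lambda>x. p (x ** a)) \<in> poly_fun mat_coords"
  using poly_fun_translate[OF assms, of "mat 1" a] by simp

lemma matrix_inv_inverse:
  assumes "invertible (A :: complex^'n^'n)"
  shows "A ** matrix_inv A = mat 1" "matrix_inv A ** A = mat 1"
  using assms someI_ex[of "\<lambda>A'. A ** A' = mat 1 \<and> A' ** A = mat 1"]
  unfolding invertible_def matrix_inv_def by blast+

text \<open>Cramer's rule for column j of the inverse, the solution of A x = e_j. The right side is
  polynomial in the entries of A.\<close>

lemma matrix_inv_component:
  assumes "invertible (A :: complex^'n^'n)"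
  shows "matrix_inv A $ i $ j * det A =
    det (\<chi> a b. if b = i then (if a = j then 1 else 0) else A $ a $ b)"
proof -
  have "A ** matrix_inv A = mat 1" using assms by (rule matrix_inv_inverse)
  then have "(A *v (\<chi> k. matrix_inv A $ k $ j)) $ a = (if a = j then 1 else 0)" for a
    by (simp add: matrix_vector_mult_def matrix_matrix_mult_def mat_def vec_eq_iff)
  then have "(\<chi> a b. if b = i then (A *v (\<chi> k. matrix_inv A $ k $ j)) $ a else A $ a $ b) =
      (\<chi> a b. if b = i then (if a = j then 1 else 0) else A $ a $ b)"
    by (simp add: vec_eq_iff)
  then show ?thesis
    using cramer_lemma[of i A "\<chi> k. matrix_inv A $ k $ j"] by simp
qed

text \<open>Multiplying by a power of the determinant clears the denominators of the inverse matrix.\<close>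

lemma poly_fun_matrix_inv:
  assumes "p \<in> poly_fun mat_coords"
  shows "\<exists>q\<in>poly_fun mat_coords. \<exists>N. \<forall>x. invertible x \<longrightarrow> q x = p (matrix_inv x) * det x ^ N"
  using assms
proof induction
  case (const c)
  show ?case by (rule bexI[OF _ poly_fun.const[of c]]) (auto intro: exI[of _ 0])
next
  case (coord x)
  then obtain i j where x: "x = (\<lambda>A. A $ i $ j)" by (auto simp: mat_coords_def)
  have comp: "(\<lambda>A. A $ a $ b) \<in> poly_fun mat_coords" for a b by (rule poly_fun_mat_coord)
  have "(\<lambda>A. (\<chi> a b. if b = i then (if a = j then 1 else 0) else A $ a $ b) $ a $ b) \<in> poly_fun mat_coords"
    for a b using comp[of a b] by (cases "b = i"; cases "a = j") (simp_all add: poly_fun.const)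
  from poly_fun_det[OF this]
  have "(\<lambda>A :: complex^'a^'a. det (\<chi> a b. if b = i then (if a = j then 1 else 0) else A $ a $ b)) \<in> poly_fun mat_coords" .
  then show ?case
    by (rule bexI[rotated]) (auto simp: x matrix_inv_component[symmetric] intro: exI[of _ 1])
next
  case (add p q)
  then obtain p' M q' N where *: "p' \<in> poly_fun mat_coords" "\<And>x. invertible x \<Longrightarrow> p' x = p (matrix_inv x) * det x ^ M"
    "q' \<in> poly_fun mat_coords" "\<And>x. invertible x \<Longrightarrow> q' x = q (matrix_inv x) * det x ^ N" by auto
  have det: "(\<lambda>x. det x) \<in> poly_fun mat_coords" by (rule poly_fun_det[OF poly_fun_mat_coord])
  have "(\<lambda>x. p' x * det x ^ N + q' x * det x ^ M) \<in> poly_fun mat_coords"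
    by (intro poly_fun.add poly_fun.mult * poly_fun_power' det)
  then show ?case
    by (rule bexI[rotated]) (auto simp: * algebra_simps power_add intro!: exI[of _ "M + N"])
next
  case (mult p q)
  then obtain p' M q' N where *: "p' \<in> poly_fun mat_coords" "\<And>x. invertible x \<Longrightarrow> p' x = p (matrix_inv x) * det x ^ M"
    "q' \<in> poly_fun mat_coords" "\<And>x. invertible x \<Longrightarrow> q' x = q (matrix_inv x) * det x ^ N" by auto
  have "(\<lambda>x. p' x * q' x) \<in> poly_fun mat_coords" by (intro poly_fun.mult *)
  then show ?case
    by (rule bexI[rotated]) (auto simp: * algebra_simps power_add intro!: exI[of _ "M + N"])
qed

section \<open>Finite-dimensional spaces stable under translation\<close>

text \<open>Unlike \<open>translate\<close> this takes no inverse, so it makes sense for every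
  matrix h and keeps polynomials polynomial.\<close>

definition left_shift :: "complex^'n^'n \<Rightarrow> (complex^'n^'n \<Rightarrow> complex) \<Rightarrow> complex^'n^'n \<Rightarrow> complex" where
  "left_shift h v = (\<lambda>x. v (h ** x))"

lemma linear_left_shift: "Vector_Spaces.linear fscale fscale (left_shift h)"
  by unfold_locales (simp_all add: fun_eq_iff fun_apply left_shift_def)

lemma left_shift_span:
  assumes "\<And>t. t \<in> T \<Longrightarrow> left_shift h t \<in> fun_vs.span T" "v \<in> fun_vs.span T"
  shows "left_shift h v \<in> fun_vs.span T"
proof -
  interpret L: Vector_Spaces.linear fscale fscale "left_shift h" by (rule linear_left_shift)
  have "left_shift h ` fun_vs.span T = fun_vs.span (left_shift h ` T)"
    by (rule L.span_image[symmetric])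
  also have "\<dots> \<subseteq> fun_vs.span T"
    using assms(1) by (intro fun_vs.span_minimal) auto
  finally show ?thesis using assms(2) by blast
qed

text \<open>Local finiteness of the translation action. Row i of h A is a combination of the rows of
  A, so the coordinates span a stable space; sums are handled by the union of two generating sets
  and products by their pairwise products.\<close>

lemma poly_fun_shift_space:
  assumes "p \<in> poly_fun mat_coords"
  shows "\<exists>T. finite T \<and> T \<subseteq> poly_fun mat_coords \<and> p \<in> fun_vs.span T \<and>
    (\<forall>h. \<forall>t\<in>T. left_shift h t \<in> fun_vs.span T)"
  using assms
proof induction
  case (const c)
  show ?case
    by (intro exI[of _ "{\<lambda>_. c}"]) (auto simp: left_shift_def poly_fun.const fun_vs.span_base)
next
  case (coord x)
  let ?T = "mat_coords :: (complex^'a^'a \<Rightarrow> complex) set"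
  have fin: "finite ?T" by (rule finite_mat_coords)
  have "left_shift h t \<in> fun_vs.span ?T" if t: "t \<in> ?T" for h t
  proof -
    obtain i j where "t = (\<lambda>A. A $ i $ j)" using t by (auto simp: mat_coords_def)
    then have "left_shift h t = (\<Sum>k\<in>UNIV. fscale (h $ i $ k) (\<lambda>A. A $ k $ j))"
      by (simp add: fun_eq_iff fun_apply left_shift_def matrix_matrix_mult_def)
    then show ?thesis by (simp only:) (intro fun_vs.span_sum fun_vs.span_scale fun_vs.span_base mat_coord)
  qed
  moreover have "?T \<subseteq> poly_fun mat_coords" by (auto intro: poly_fun.coord)
  ultimately show ?case using fin fun_vs.span_base[OF coord] by (intro exI[of _ ?T]) simp
next
  case (add p q)
  then obtain S T where *: "finite S" "S \<subseteq> poly_fun mat_coords" "p \<in> fun_vs.span S"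
    "\<And>h t. t \<in> S \<Longrightarrow> left_shift h t \<in> fun_vs.span S"
    "finite T" "T \<subseteq> poly_fun mat_coords" "q \<in> fun_vs.span T"
    "\<And>h t. t \<in> T \<Longrightarrow> left_shift h t \<in> fun_vs.span T" by auto
  have sub: "fun_vs.span S \<subseteq> fun_vs.span (S \<union> T)" "fun_vs.span T \<subseteq> fun_vs.span (S \<union> T)"
    by (intro fun_vs.span_mono; blast)+
  have "p + q \<in> fun_vs.span (S \<union> T)" using * sub by (intro fun_vs.span_add) blast+
  then have "(\<lambda>x. p x + q x) \<in> fun_vs.span (S \<union> T)" by (simp only: plus_fun_def)
  moreover have "\<forall>h. \<forall>t\<in>S \<union> T. left_shift h t \<in> fun_vs.span (S \<union> T)"
  proof (intro allI ballI)
    fix h t assume "t \<in> S \<union> T"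
    then show "left_shift h t \<in> fun_vs.span (S \<union> T)" using *(4,8) sub by (elim UnE; blast)
  qed
  ultimately show ?case using * by (intro exI[of _ "S \<union> T"]) simp
next
  case (mult p q)
  then obtain S T where *: "finite S" "S \<subseteq> poly_fun mat_coords" "p \<in> fun_vs.span S"
    "\<And>h t. t \<in> S \<Longrightarrow> left_shift h t \<in> fun_vs.span S"
    "finite T" "T \<subseteq> poly_fun mat_coords" "q \<in> fun_vs.span T"
    "\<And>h t. t \<in> T \<Longrightarrow> left_shift h t \<in> fun_vs.span T" by auto
  let ?M = "(\<lambda>(a, b). a * b) ` (S \<times> T)"
  have prod1: "a * b \<in> fun_vs.span ?M" if a: "a \<in> S" and b: "b \<in> fun_vs.span T" for a b
    using b
  proof (induction rule: fun_vs.span_induct_alt)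
    case base
    then show ?case by (simp add: fun_vs.span_zero)
  next
    case (step c x y)
    have "a * (fscale c x + y) = fscale c (a * x) + a * y" by (simp add: fun_eq_iff fun_apply algebra_simps)
    moreover have "a * x \<in> ?M" using a step(1) by (intro image_eqI[of _ _ "(a, x)"]) auto
    ultimately show ?case
      by (simp only:) (intro fun_vs.span_add fun_vs.span_scale fun_vs.span_base step(2))
  qed
  have prod: "a * b \<in> fun_vs.span ?M" if a: "a \<in> fun_vs.span S" and b: "b \<in> fun_vs.span T" for a b
    using a
  proof (induction rule: fun_vs.span_induct_alt)
    case base
    then show ?case by (simp add: fun_vs.span_zero)
  next
    case (step c x y)
    have "(fscale c x + y) * b = fscale c (x * b) + y * b" by (simp add: fun_eq_iff fun_apply algebra_simps)
    then show ?case
      by (simp only:) (intro fun_vs.span_add fun_vs.span_scale prod1 step b)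
  qed
  have "(\<lambda>x. p x * q x) \<in> fun_vs.span ?M" using prod[OF *(3,7)] by (simp only: times_fun_def)
  moreover have "left_shift h t \<in> fun_vs.span ?M" if t: "t \<in> ?M" for h t
  proof -
    obtain a b where ab: "a \<in> S" "b \<in> T" "t = a * b" using t by auto
    have "left_shift h (a * b) = left_shift h a * left_shift h b"
      by (simp add: fun_eq_iff fun_apply left_shift_def)
    then show ?thesis using prod[OF *(4)[OF ab(1)] *(8)[OF ab(2)]] ab(3) by (simp only:)
  qed
  moreover have "?M \<subseteq> poly_fun mat_coords"
    using *(2,6) by (auto intro: poly_fun_mult)
  ultimately show ?case using *(1,5) by (intro exI[of _ ?M]) simp
qed

text \<open>A dimension count: the injective map into W1 shows that W1 is at least as large as W2,
  while it is contained in W2.\<close>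

lemma subspace_eq_if_injective_image:
  assumes T: "finite T" "W2 \<subseteq> fun_vs.span T" and W1: "fun_vs.subspace W1" "W1 \<subseteq> W2"
    and f: "Vector_Spaces.linear fscale fscale f" "inj f" "f ` W2 \<subseteq> W1"
  shows "W1 = W2"
proof (rule antisym[OF W1(2)])
  interpret L: Vector_Spaces.linear fscale fscale f by (rule f)
  obtain B where B: "B \<subseteq> W2" "fun_vs.independent B" "W2 \<subseteq> fun_vs.span B"
    using fun_vs.basis_exists[of W2] by metis
  have finB: "finite B" using fun_vs.independent_span_bound[OF T(1) B(2)] B(1) T(2) by blast
  have ind: "fun_vs.independent (f ` B)" using L.independent_inj_image[OF B(2) f(2)] .
  have card: "card (f ` B) = card B" using f(2) by (simp add: card_image inj_on_subset)
  \<comment> \<open>A vector v outside the span would give card B + 1 independent vectors in the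
    span of B.\<close>
  have "W2 \<subseteq> fun_vs.span (f ` B)"
  proof
    fix v assume v: "v \<in> W2"
    show "v \<in> fun_vs.span (f ` B)"
    proof (rule ccontr)
      assume nv: "v \<notin> fun_vs.span (f ` B)"
      then have "fun_vs.independent (insert v (f ` B))"
        using fun_vs.independent_insertI ind by blast
      moreover have "insert v (f ` B) \<subseteq> fun_vs.span B"
        using v B(1,3) f(3) W1(2) by blast
      ultimately have "card (insert v (f ` B)) \<le> card B"
        using fun_vs.independent_span_bound[OF finB] by blast
      moreover have "v \<notin> f ` B" using nv fun_vs.span_base by blast
      ultimately show False using card finB by simp
    qed
  qed
  also have "\<dots> \<subseteq> W1" using B(1) f(3) by (intro fun_vs.span_minimal W1(1)) blast
  finally show "W2 \<subseteq> W1" .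
qed

section \<open>Connected algebraic groups\<close>

lemma mem_GL: "A \<in> carrier GL \<longleftrightarrow> invertible A"
  by (simp add: GL_def)

lemma inv_GL:
  assumes "invertible A"
  shows "inv\<^bsub>GL\<^esub> A = matrix_inv A"
  unfolding m_inv_def
proof (intro the_equality conjI)
  note * = matrix_inv_inverse[OF assms]
  show "matrix_inv A \<in> carrier GL" using * by (auto simp: GL_def invertible_def)
  show "A \<otimes>\<^bsub>GL\<^esub> matrix_inv A = \<one>\<^bsub>GL\<^esub>" "matrix_inv A \<otimes>\<^bsub>GL\<^esub> A = \<one>\<^bsub>GL\<^esub>"
    using * by (auto simp: GL_def)
  fix y assume "y \<in> carrier GL \<and> A \<otimes>\<^bsub>GL\<^esub> y = \<one>\<^bsub>GL\<^esub> \<and> y \<otimes>\<^bsub>GL\<^esub> A = \<one>\<^bsub>GL\<^esub>"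
  then have "y ** A = mat 1" by (simp add: GL_def)
  then have "y ** (A ** matrix_inv A) = matrix_inv A" by (simp add: matrix_mul_assoc)
  then show "y = matrix_inv A" using * by simp
qed

lemma algebraic_groupD:
  assumes "algebraic_group G"
  shows algebraic_group_invertible: "A \<in> G \<Longrightarrow> invertible A"
    and algebraic_group_one: "mat 1 \<in> G"
    and algebraic_group_mult: "A \<in> G \<Longrightarrow> C \<in> G \<Longrightarrow> A ** C \<in> G"
    and algebraic_group_inv: "A \<in> G \<Longrightarrow> matrix_inv A \<in> G"
proof -
  have G: "subgroup G GL" using assms by (simp add: algebraic_group_def)
  show inv: "A \<in> G \<Longrightarrow> invertible A" for A using subgroup.mem_carrier[OF G] by (simp add: mem_GL)
  show "mat 1 \<in> G" using subgroup.one_closed[OF G] by (simp add: GL_def)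
  show "A \<in> G \<Longrightarrow> C \<in> G \<Longrightarrow> A ** C \<in> G" using subgroup.m_closed[OF G] by (simp add: GL_def)
  show "matrix_inv A \<in> G" if A: "A \<in> G"
  using subgroup.m_inv_closed[OF G A] inv_GL[OF inv[OF A]] by simp
qed

lemma matrix_inv_unique:
  assumes "A ** C = mat 1" "C ** A = mat 1"
  shows "matrix_inv A = (C :: complex^'n^'n)"
proof -
  have "invertible A" using assms by (auto simp: invertible_def)
  note * = matrix_inv_inverse[OF this]
  have "matrix_inv A = matrix_inv A ** (A ** C)" using assms by simp
  also have "\<dots> = C" using * by (simp add: matrix_mul_assoc)
  finally show ?thesis .
qed

lemma matrix_inv_inv: "invertible A \<Longrightarrow> matrix_inv (matrix_inv A) = (A :: complex^'n^'n)"
  using matrix_inv_inverse[of A] by (intro matrix_inv_unique) auto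

text \<open>G is closed in the general linear group and not necessarily among all matrices, so the
  polynomials vanishing on G detect membership only for invertible x.\<close>

lemma algebraic_group_memI:
  assumes G: "algebraic_group G" and x: "invertible x"
    and van: "\<And>p. p \<in> poly_fun mat_coords \<Longrightarrow> \<forall>y\<in>G. p y = 0 \<Longrightarrow> p x = 0"
  shows "x \<in> G"
proof (rule ccontr)
  assume "x \<notin> G"
  have "openin (fs_top (mat_space (carrier GL))) (carrier GL - G)"
    using G by (auto simp: algebraic_group_def closedin_def)
  moreover have "x \<in> carrier GL - G" using x \<open>x \<notin> G\<close> by (simp add: mem_GL)
  ultimately obtain p where p: "p \<in> poly_fun mat_coords" "p x \<noteq> 0"
    "\<forall>y\<in>carrier GL. p y \<noteq> 0 \<longrightarrow> y \<in> carrier GL - G"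
    unfolding openin_zariski_space by auto
  have "\<forall>y\<in>G. p y = 0"
    using p(3) algebraic_group_invertible[OF G] by (auto simp: mem_GL)
  with van p(1,2) show False by blast
qed

text \<open>In a finite-dimensional translation invariant space of functions, those that vanish near a
  given point form a subspace whose dimension does not depend on the point. This subspace is
  therefore locally constant, and constant on a connected group.\<close>

lemma algebraic_group_irreducible:
  assumes G: "algebraic_group G" and conn: "zariski_connected G"
    and p: "p \<in> poly_fun mat_coords" and q: "q \<in> poly_fun mat_coords"
    and pq: "\<And>x. x \<in> G \<Longrightarrow> p x * q x = 0" and nz: "g \<in> G" "p g \<noteq> 0" and x: "x \<in> G"
  shows "q x = 0"
proof -
  let ?A = "poly_fun mat_coords"
  obtain T where T: "finite T" "T \<subseteq> ?A" "q \<in> fun_vs.span T"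
    "\<And>h t. t \<in> T \<Longrightarrow> left_shift h t \<in> fun_vs.span T" using poly_fun_shift_space[OF q] by auto
  \<comment> \<open>The functions in the span that vanish on a neighbourhood of g in G; the set w
    \<noteq> 0 is the neighbourhood.\<close>
  define I where "I g = {v \<in> fun_vs.span T. \<exists>w\<in>?A. w g \<noteq> 0 \<and> (\<forall>x\<in>G. w x \<noteq> 0 \<longrightarrow> v x = 0)}" for g
  have I_I: "v \<in> I g" if "v \<in> fun_vs.span T" "w \<in> ?A" "w g \<noteq> 0" "\<And>x. x \<in> G \<Longrightarrow> w x \<noteq> 0 \<Longrightarrow> v x = 0" for v w g
    using that by (auto simp: I_def)
  have I_E: "\<exists>w. w \<in> ?A \<and> w g \<noteq> 0 \<and> (\<forall>x\<in>G. w x \<noteq> 0 \<longrightarrow> v x = 0)" if "v \<in> I g" for v g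
    using that by (auto simp: I_def)
  have I_span: "I g \<subseteq> fun_vs.span T" for g by (auto simp: I_def)
  have sub: "fun_vs.subspace (I g)" for g
    unfolding fun_vs.subspace_def
  proof (intro conjI ballI allI)
    show "0 \<in> I g"
      by (rule I_I[of _ "\<lambda>_. 1"]) (auto simp: fun_vs.span_zero poly_fun.const fun_apply)
  next
    fix a b assume ab: "a \<in> I g" "b \<in> I g"
    from I_E[OF ab(1)] obtain u where u: "u \<in> ?A" "u g \<noteq> 0" "\<forall>x\<in>G. u x \<noteq> 0 \<longrightarrow> a x = 0"
      by (elim exE conjE)
    from I_E[OF ab(2)] obtain w where w: "w \<in> ?A" "w g \<noteq> 0" "\<forall>x\<in>G. w x \<noteq> 0 \<longrightarrow> b x = 0"
      by (elim exE conjE)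
    note * = u w
    show "a + b \<in> I g"
    proof (rule I_I)
      show "a + b \<in> fun_vs.span T"
        by (rule fun_vs.span_add[OF subsetD[OF I_span ab(1)] subsetD[OF I_span ab(2)]])
      show "u * w \<in> ?A" using * by (intro poly_fun_mult)
    qed (use * in \<open>auto simp: fun_apply\<close>)
  next
    fix c a assume a: "a \<in> I g"
    from I_E[OF a] obtain w where "w \<in> ?A" "w g \<noteq> 0" "\<forall>x\<in>G. w x \<noteq> 0 \<longrightarrow> a x = 0"
      by (elim exE conjE)
    then show "fscale c a \<in> I g"

      by (intro I_I[of _ w] fun_vs.span_scale subsetD[OF I_span a]) (auto simp: fun_apply)
  qed
  \<comment> \<open>Translation by h carries functions vanishing near g to functions vanishing near
    h^-1 g, which is why the dimension of \<open>I g\<close> does not depend on g.\<close>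
  have shift: "left_shift h v \<in> I (matrix_inv h ** g)" if h: "h \<in> G" and v: "v \<in> I g" for h g v
  proof -
    obtain w where w: "w \<in> ?A" "w g \<noteq> 0" "\<forall>x\<in>G. w x \<noteq> 0 \<longrightarrow> v x = 0"
      using I_E[OF v] by (elim exE conjE)
    note inv = matrix_inv_inverse[OF algebraic_group_invertible[OF G h]]
    show ?thesis
    proof (rule I_I)
      show "left_shift h v \<in> fun_vs.span T"
        by (rule left_shift_span[OF T(4) subsetD[OF I_span v]])
      show "left_shift h w \<in> ?A" unfolding left_shift_def by (rule poly_fun_left_translate[OF w(1)])
      show "left_shift h w (matrix_inv h ** g) \<noteq> 0"
        using w(2) inv by (simp add: left_shift_def matrix_mul_assoc)
    qed (use w(3) algebraic_group_mult[OF G h] in \<open>auto simp: left_shift_def\<close>)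
  qed
  have local: "\<exists>w\<in>?A. w g \<noteq> 0 \<and> (\<forall>x\<in>G. w x \<noteq> 0 \<longrightarrow> I g = I x)" if g: "g \<in> G" for g
  proof -
    obtain B where B: "B \<subseteq> I g" "fun_vs.independent B" "I g \<subseteq> fun_vs.span B"
      using fun_vs.basis_exists[of "I g"] by metis
    have finB: "finite B" using fun_vs.independent_span_bound[OF T(1) B(2)] B(1) I_span by blast
    \<comment> \<open>A basis of \<open>I g\<close> is finite, so one neighbourhood W \<noteq> 0
      serves all of \<open>I g\<close>. There \<open>I g\<close> is contained in \<open>I x\<close>,
      and translating x back to g gives equality.\<close>
    have "\<forall>b\<in>B. \<exists>w. w \<in> ?A \<and> w g \<noteq> 0 \<and> (\<forall>x\<in>G. w x \<noteq> 0 \<longrightarrow> b x = 0)"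
      using B(1) I_E by blast
    from this[unfolded bchoice_iff] obtain w
      where w: "\<forall>b\<in>B. w b \<in> ?A \<and> w b g \<noteq> 0 \<and> (\<forall>x\<in>G. w b x \<noteq> 0 \<longrightarrow> b x = 0)" by (elim exE)
    define W where "W = (\<Prod>b\<in>B. w b)"
    have "W \<in> ?A" unfolding W_def using w by (intro poly_fun_prod) auto
    moreover have Wx: "W x \<noteq> 0 \<longleftrightarrow> (\<forall>b\<in>B. w b x \<noteq> 0)" for x
      using finB by (simp add: W_def fun_apply)
    moreover have "I g = I x" if x: "x \<in> G" "W x \<noteq> 0" for x
    proof -
      have "B \<subseteq> I x"
      proof
        fix b assume b: "b \<in> B"
        then have "b \<in> fun_vs.span T" using B(1) I_span[of g] by blast
        then show "b \<in> I x" using b w x Wx by (intro I_I[of b "w b"]) auto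
      qed
      then have sub12: "I g \<subseteq> I x" using B(3) fun_vs.span_minimal[OF _ sub] by blast
      define h where "h = x ** matrix_inv g"
      have h: "h \<in> G" unfolding h_def
        using x(1) g by (intro algebraic_group_mult[OF G] algebraic_group_inv[OF G])
      note ig = matrix_inv_inverse[OF algebraic_group_invertible[OF G g]]
      note ix = matrix_inv_inverse[OF algebraic_group_invertible[OF G x(1)]]
      have ih: "matrix_inv h = g ** matrix_inv x"
        unfolding h_def using ig ix
        by (intro matrix_inv_unique) (metis matrix_mul_assoc matrix_mul_lid)+
      have hx: "matrix_inv h ** x = g"
        unfolding ih using ix by (simp flip: matrix_mul_assoc)
      show ?thesis
      proof (rule subspace_eq_if_injective_image[OF T(1) I_span sub sub12 linear_left_shift])
        show "inj (left_shift h)"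
        proof (rule injI)
          fix u v assume uv: "left_shift h u = left_shift h v"
          note inv = matrix_inv_inverse[OF algebraic_group_invertible[OF G h]]
          have "left_shift (matrix_inv h) (left_shift h k) = k" for k
            using inv by (simp add: left_shift_def matrix_mul_assoc)
          with uv show "u = v" by metis
        qed
        show "left_shift h ` I x \<subseteq> I g" using shift[OF h, of _ x] by (auto simp: hx)
      qed
    qed
    ultimately show ?thesis using w by (intro bexI[of _ W]) auto
  qed
  \<comment> \<open>The locally constant space makes E open and closed. The given g is in E because
    q vanishes wherever p does not, hence near g.\<close>
  define E where "E = {g \<in> G. q \<in> I g}"
  have "openin (fs_top (mat_space G)) E"
    unfolding openin_zariski_space
  proof (intro conjI ballI)
    fix g assume g: "g \<in> E"
    then have "g \<in> G" by (simp add: E_def)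
    from local[OF this] obtain w where w: "w \<in> ?A" "w g \<noteq> 0" "\<forall>x\<in>G. w x \<noteq> 0 \<longrightarrow> I g = I x"
      by (elim bexE conjE)
    show "\<exists>p\<in>?A. p g \<noteq> 0 \<and> (\<forall>y\<in>G. p y \<noteq> 0 \<longrightarrow> y \<in> E)"
    proof (rule bexI[OF _ w(1)], intro conjI ballI impI w(2))
      fix y assume "y \<in> G" "w y \<noteq> 0"
      then have "I y = I g" using w(3) by blast
      then show "y \<in> E" using g \<open>y \<in> G\<close> by (simp add: E_def)
    qed
  qed (auto simp: E_def)
  moreover have "openin (fs_top (mat_space G)) (G - E)"
    unfolding openin_zariski_space
  proof (intro conjI ballI)
    fix g assume g: "g \<in> G - E"
    then have "g \<in> G" by (simp add: E_def)
    from local[OF this] obtain w where w: "w \<in> ?A" "w g \<noteq> 0" "\<forall>x\<in>G. w x \<noteq> 0 \<longrightarrow> I g = I x"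
      by (elim bexE conjE)
    show "\<exists>p\<in>?A. p g \<noteq> 0 \<and> (\<forall>y\<in>G. p y \<noteq> 0 \<longrightarrow> y \<in> G - E)"
    proof (rule bexI[OF _ w(1)], intro conjI ballI impI w(2))
      fix y assume "y \<in> G" "w y \<noteq> 0"
      then have "I y = I g" using w(3) by blast
      then show "y \<in> G - E" using g \<open>y \<in> G\<close> by (simp add: E_def)
    qed
  qed auto
  then have "closedin (fs_top (mat_space G)) E"
    by (auto simp: closedin_def E_def)
  ultimately have "E = {} \<or> E = G"
    using conn unfolding zariski_connected_def connected_space_clopen_in by simp
  moreover have "g \<in> E"
    using T(3) p nz pq by (auto simp: E_def intro!: I_I[of q p])
  ultimately have "x \<in> E" using x by blast
  then have "q \<in> I x" by (simp add: E_def)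
  from I_E[OF this] obtain w where "w \<in> ?A" "w x \<noteq> 0" "\<forall>y\<in>G. w y \<noteq> 0 \<longrightarrow> q y = 0"
    by (elim exE conjE)
  with x show ?thesis by blast
qed

text \<open>If U and V were disjoint, polynomials defining basic open subsets of them would have
  product zero on G. This is what makes the value of a general translate unique.\<close>

lemma openin_group_Int_nonempty:
  assumes G: "algebraic_group G" "zariski_connected G"
    and U: "openin (fs_top (mat_space G)) U" "U \<noteq> {}" and V: "openin (fs_top (mat_space G)) V" "V \<noteq> {}"
  shows "U \<inter> V \<noteq> {}"
proof
  assume disj: "U \<inter> V = {}"
  obtain x y where xy: "x \<in> U" "y \<in> V" using U V by blast
  from U(1) xy(1) obtain p where p: "p \<in> poly_fun mat_coords" "p x \<noteq> 0" "\<forall>z\<in>G. p z \<noteq> 0 \<longrightarrow> z \<in> U" "x \<in> G"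
    unfolding openin_zariski_space by blast
  from V(1) xy(2) obtain q where q: "q \<in> poly_fun mat_coords" "q y \<noteq> 0" "\<forall>z\<in>G. q z \<noteq> 0 \<longrightarrow> z \<in> V" "y \<in> G"
    unfolding openin_zariski_space by blast
  have "p z * q z = 0" if "z \<in> G" for z using that disj p(3) q(3) by auto
  from algebraic_group_irreducible[OF G p(1) q(1) this p(4,2) q(4)] q(2) show False by simp
qed

text \<open>By the Nullstellensatz \<open>P - c Q\<close> is invertible away from the zeros of \<open>K\<close> for all but
  countably many \<open>c\<close>, so Amitsur's argument applies.\<close>

lemma countable_values_constant:
  fixes G :: "(complex^'n^'n) set"
  assumes G: "algebraic_group G" "zariski_connected G"
    and P: "P \<in> poly_fun mat_coords" and Q: "Q \<in> poly_fun mat_coords" and K: "K \<in> poly_fun mat_coords"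
    and g: "g \<in> G" "K g \<noteq> 0" "Q g \<noteq> 0"
    and val: "\<And>x. x \<in> G \<Longrightarrow> K x \<noteq> 0 \<Longrightarrow> \<exists>c\<in>L. P x = c * Q x \<and> Q x \<noteq> 0" and L: "countable L"
  shows "\<exists>c. \<forall>x\<in>G. P x = c * Q x"
proof -
  let ?A = "poly_fun mat_coords :: (complex^'n^'n \<Rightarrow> complex) set"
  define J where "J = {p \<in> ?A. \<forall>x\<in>G. p x = 0}"
  \<comment> \<open>The determinant is included because the point produced by the Nullstellensatz
    must be invertible in order to lie in G.\<close>
  define K' where "K' = K * det"
  have J: "poly_ideal mat_coords J"
    unfolding poly_ideal_def J_def
    by (auto simp: fun_apply intro: poly_fun_add poly_fun_mult poly_fun_zero)
  have prime: "prime_poly_ideal mat_coords J"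
    unfolding prime_poly_ideal_def
  proof (intro conjI ballI impI J)
    show "1 \<notin> J" using g by (auto simp: J_def fun_apply)
    fix a b assume ab: "a \<in> ?A" "b \<in> ?A" "a * b \<in> J"
    show "a \<in> J \<or> b \<in> J"
    proof (rule ccontr)
      assume "\<not> (a \<in> J \<or> b \<in> J)"
      then obtain x y where xy: "x \<in> G" "a x \<noteq> 0" "y \<in> G" "b y \<noteq> 0" using ab by (auto simp: J_def)
      have "a z * b z = 0" if "z \<in> G" for z using that ab(3) by (auto simp: J_def fun_apply)
      from algebraic_group_irreducible[OF G ab(1,2) this xy(1-3)] xy(4) show False by simp
    qed
  qed
  have det: "det \<in> ?A" using poly_fun_det[OF poly_fun_mat_coord] by simp
  have K': "K' \<in> ?A" unfolding K'_def by (intro poly_fun_mult K det)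
  have detG: "det x \<noteq> 0" if "x \<in> G" for x
    using algebraic_group_invertible[OF G(1) that] by (simp add: invertible_det_nz)
  have "K' \<notin> J" using g detG by (auto simp: J_def K'_def fun_apply)
  have "Q \<notin> J" using g by (auto simp: J_def)
  have "\<exists>c. P - fscale c Q \<in> J"
  proof (rule amitsur[OF prime countable_finite[OF finite_mat_coords] P Q \<open>Q \<notin> J\<close> K' \<open>K' \<notin> J\<close>])
    show "uncountable (UNIV - L)" using L uncountable_UNIV_complex uncountable_minus_countable by blast
    fix c assume c: "c \<in> UNIV - L"
    define p where "p = P - fscale c Q"
    have p: "p \<in> ?A" unfolding p_def by (intro poly_fun_diff P poly_fun_scale Q)
    note ins = poly_ideal_insert[OF J p]
    \<comment> \<open>Otherwise there is a point x of G with K x \<noteq> 0 and P x = c Q x. But P x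
      = d Q x with d in L and Q x \<noteq> 0, so c would be in L.\<close>
    have "\<exists>n. K' ^ n \<in> ideal_insert mat_coords J p"
    proof (rule ccontr)
      assume "\<nexists>n. K' ^ n \<in> ideal_insert mat_coords J p"
      then have no: "K' ^ n \<notin> ideal_insert mat_coords J p" for n by blast
      obtain M where M: "poly_ideal mat_coords M" "ideal_insert mat_coords J p \<subseteq> M" "K' \<notin> M"
        "\<And>a. a \<in> ?A \<Longrightarrow> \<exists>c. a - fscale c 1 \<in> M"
        using nullstellensatz[OF countable_finite[OF finite_mat_coords] ins(1) K' no] by metis
      have "\<forall>i j. \<exists>c. (\<lambda>A. A $ i $ j) - fscale c 1 \<in> M" using M(4)[OF poly_fun_mat_coord] by blast
      then obtain e where e: "\<And>i j. (\<lambda>A. A $ i $ j) - fscale (e i j) 1 \<in> M" by metis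
      \<comment> \<open>The matrix of the residues of the coordinate functions modulo M; by
        \<open>ev\<close> the residue of any polynomial is its value at x.\<close>
      define x where "x = (\<chi> i j. e i j)"
      have ev: "a - fscale (a x) 1 \<in> M" if "a \<in> ?A" for a
        using that
      proof induction
        case (const c)
        have "(\<lambda>_ :: complex^'n^'n. c) - fscale c 1 = 0" by (simp add: fun_eq_iff fun_apply)
        then show ?case using poly_ideal_zero[OF M(1)] by (simp only:)
      next
        case (coord a)
        then obtain i j where "a = (\<lambda>A. A $ i $ j)" by (auto simp: mat_coords_def)
        moreover have "x $ i $ j = e i j" by (simp add: x_def)
        ultimately show ?case using e[of i j] by (simp only:)
      next
        case (add a b)
        have "(\<lambda>x. a x + b x) - fscale (a x + b x) 1 = (a - fscale (a x) 1) + (b - fscale (b x) 1)"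
          by (simp add: fun_eq_iff fun_apply algebra_simps)
        then show ?case using poly_ideal_add[OF M(1) add.IH] by (simp only:)
      next
        case (mult a b)
        have "(\<lambda>x. a x * b x) - fscale (a x * b x) 1 = b * (a - fscale (a x) 1) + fscale (a x) (b - fscale (b x) 1)"
          by (simp add: fun_eq_iff fun_apply algebra_simps)
        then show ?case
          using poly_ideal_add[OF M(1) poly_ideal_mult[OF M(1) mult.hyps(2) mult.IH(1)] poly_ideal_scale[OF M(1) mult.IH(2)]]
          by (simp only:)
      qed
      have one: "1 \<notin> M"
        using M(3) poly_ideal_mult[OF M(1) K', of 1] by auto
      have van: "a x = 0" if a: "a \<in> M" for a
      proof (rule ccontr)
        assume nz: "a x \<noteq> 0"
        have "a \<in> ?A" using a poly_ideal_sub[OF M(1)] by blast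
        from poly_ideal_diff[OF M(1) a ev[OF this]]
        have "fscale (1 / a x) (a - (a - fscale (a x) 1)) \<in> M" by (rule poly_ideal_scale[OF M(1)])
        moreover have "fscale (1 / a x) (a - (a - fscale (a x) 1)) = 1"
          using nz by (simp add: fun_eq_iff fun_apply)
        ultimately show False using one by (simp only:)
      qed
      have "K' x \<noteq> 0"
      proof
        assume "K' x = 0"
        then have "K' - fscale (K' x) 1 = K'" by (simp add: fun_eq_iff fun_apply)
        with ev[OF K'] M(3) show False by (simp only:)
      qed
      then have Kx: "K x \<noteq> 0" "det x \<noteq> 0" by (auto simp: K'_def fun_apply)
      have "x \<in> G"
      proof (rule algebraic_group_memI[OF G(1)])
        show "invertible x" using Kx(2) by (simp add: invertible_det_nz)
        fix a assume "a \<in> ?A" "\<forall>y\<in>G. a y = 0"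
        then have "a \<in> J" by (simp add: J_def)
        then show "a x = 0" using ins(2) M(2) van by blast
      qed
      then obtain d where "d \<in> L" "P x = d * Q x" "Q x \<noteq> 0" using val Kx by blast
      moreover have "p x = 0" using van ins(3) M(2) by blast
      ultimately show False using c by (auto simp: p_def fun_apply)
    qed
    then show "\<exists>n. \<exists>b\<in>?A. K' ^ n - (P - fscale c Q) * b \<in> J"
      by (auto simp: ideal_insert_def p_def)
  qed
  then obtain c where "P - fscale c Q \<in> J" ..
  then have "\<forall>x\<in>G. P x = c * Q x" by (auto simp: J_def fun_apply)
  then show ?thesis ..
qed

section \<open>Homogeneous spaces\<close>

lemma l_coset_GL: "A <#\<^bsub>GL\<^esub> S = (\<lambda>y. A ** y) ` S"
  by (auto simp: l_coset_def GL_def)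

lemma l_coset_GL_mult: "A <#\<^bsub>GL\<^esub> (C <#\<^bsub>GL\<^esub> S) = (A ** C) <#\<^bsub>GL\<^esub> S"
  by (simp add: l_coset_GL image_image matrix_mul_assoc)

lemma l_coset_GL_one: "mat 1 <#\<^bsub>GL\<^esub> S = S"
  by (simp add: l_coset_GL)

locale algebraic_homogeneous_space =
  fixes G H :: "(complex^'n^'n) set"
  assumes group: "algebraic_group G" and conn: "zariski_connected G"
    and subgroup: "algebraic_group H" "H \<subseteq> G"
begin

abbreviation X where "X \<equiv> homogeneous_space G H"
abbreviation P where "P \<equiv> fs_points X"
abbreviation act (infixr \<open>\<cdot>\<close> 75) where "act g x \<equiv> g <#\<^bsub>GL\<^esub> x"

lemmas G_one = algebraic_group_one[OF group]
  and G_mult = algebraic_group_mult[OF group]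
  and G_inv = algebraic_group_inv[OF group]
  and G_invertible = algebraic_group_invertible[OF group]

lemma inv_G:
  assumes "g \<in> G"
  shows "inv\<^bsub>GL\<^esub> g = matrix_inv g" "inv\<^bsub>GL\<^esub> g \<in> G" "g ** inv\<^bsub>GL\<^esub> g = mat 1" "inv\<^bsub>GL\<^esub> g ** g = mat 1"
  using inv_GL[OF G_invertible[OF assms]] G_inv[OF assms] matrix_inv_inverse[OF G_invertible[OF assms]]
  by simp_all

lemma inv_G_inv: "g \<in> G \<Longrightarrow> inv\<^bsub>GL\<^esub> (inv\<^bsub>GL\<^esub> g) = g"
  using inv_G[of g] inv_G(1)[of "inv\<^bsub>GL\<^esub> g"] matrix_inv_inv[OF G_invertible, of g] by simp

lemma points_eq: "P = (\<lambda>g. g \<cdot> H) ` G"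
proof -
  let ?Q = "(\<lambda>g. g \<cdot> H) ` G"
  have "{g \<in> G. g \<cdot> H \<in> ?Q} = G" by auto
  then have "openin (fs_top X) ?Q"
    unfolding openin_homogeneous_space using openin_topspace[of "fs_top (mat_space G)"] by simp
  then have "?Q \<subseteq> P" by (rule openin_subset)
  moreover have "P \<subseteq> ?Q"
    using openin_topspace[of "fs_top X"] unfolding openin_homogeneous_space by blast
  ultimately show ?thesis by blast
qed

lemma points_E:
  assumes "x \<in> P" obtains a where "a \<in> G" "x = a \<cdot> H"
  using assms unfolding points_eq by blast

lemma coset_in_points: "g \<in> G \<Longrightarrow> g \<cdot> H \<in> P"
  unfolding points_eq by blast

lemma act_in_points: "g \<in> G \<Longrightarrow> x \<in> P \<Longrightarrow> g \<cdot> x \<in> P"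
  by (erule points_E) (simp add: l_coset_GL_mult coset_in_points G_mult)

lemma act_inv: "g \<in> G \<Longrightarrow> inv\<^bsub>GL\<^esub> g \<cdot> (g \<cdot> x) = x" "g \<in> G \<Longrightarrow> g \<cdot> (inv\<^bsub>GL\<^esub> g \<cdot> x) = x"
  by (simp_all add: l_coset_GL_mult inv_G(3,4) l_coset_GL_one)

lemma act_in_points_iff: "g \<in> G \<Longrightarrow> g \<cdot> x \<in> P \<longleftrightarrow> x \<in> P"
  using act_in_points[of g x] act_in_points[of "inv\<^bsub>GL\<^esub> g" "g \<cdot> x"] inv_G(2)[of g] act_inv(1)[of g x] by auto

lemma fs_reg_X:
  "fs_reg X U f \<longleftrightarrow> openin (fs_top X) U \<and>
     fs_reg (mat_space G) {g \<in> G. g \<cdot> H \<in> U} (\<lambda>g. f (g \<cdot> H))"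
  by (simp only: homogeneous_space_def Let_def fspace.select_convs)

lemma points_preimage: "{g \<in> G. g \<cdot> H \<in> P} = G"
  using coset_in_points by blast

lemma fs_reg_X_points: "fs_reg X P f \<longleftrightarrow> fs_reg (mat_space G) G (\<lambda>g. f (g \<cdot> H))"
  unfolding fs_reg_X points_preimage by simp

lemma fs_reg_X_openin: "fs_reg X U f \<Longrightarrow> openin (fs_top X) U"
  by (simp add: fs_reg_X)

lemma fs_reg_X_const: "openin (fs_top X) U \<Longrightarrow> fs_reg X U (\<lambda>_. c)"
  unfolding fs_reg_X by (auto intro: fs_reg_poly poly_fun.const simp: openin_homogeneous_space)

lemma fs_reg_X_add: "fs_reg X U f \<Longrightarrow> fs_reg X U h \<Longrightarrow> fs_reg X U (\<lambda>x. f x + h x)"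
  unfolding fs_reg_X by (auto intro: fs_reg_add)

lemma fs_reg_X_mult: "fs_reg X U f \<Longrightarrow> fs_reg X U h \<Longrightarrow> fs_reg X U (\<lambda>x. f x * h x)"
  unfolding fs_reg_X by (auto intro: fs_reg_mult)

lemma fs_reg_X_scale: "fs_reg X U f \<Longrightarrow> fs_reg X U (\<lambda>x. c * f x)"
  by (intro fs_reg_X_mult fs_reg_X_const fs_reg_X_openin)

lemma fs_reg_X_sum:
  assumes "openin (fs_top X) U" "\<And>i. i \<in> S \<Longrightarrow> fs_reg X U (f i)"
  shows "fs_reg X U (\<lambda>x. \<Sum>i\<in>S. f i x)"
  using assms(2)
  by (induction S rule: infinite_finite_induct) (simp_all add: fs_reg_X_const fs_reg_X_add assms(1))

lemma fs_reg_X_cong: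
  assumes "\<And>x. x \<in> U \<Longrightarrow> f x = h x"
  shows "fs_reg X U f \<longleftrightarrow> fs_reg X U h"
  unfolding fs_reg_X using assms by (intro conj_cong refl fs_reg_cong) auto

lemma fs_reg_X_mono:
  assumes "fs_reg X U f" "openin (fs_top X) V" "V \<subseteq> U"
  shows "fs_reg X V f"
  using assms unfolding fs_reg_X
  by (auto intro: fs_reg_mono simp: openin_homogeneous_space)

lemma openin_fs_reg_X_nonzero:
  assumes "fs_reg X U f"
  shows "openin (fs_top X) {x \<in> U. f x \<noteq> 0}"
proof -
  have "{g \<in> G. g \<cdot> H \<in> {x \<in> U. f x \<noteq> 0}} = {g \<in> {g \<in> G. g \<cdot> H \<in> U}. f (g \<cdot> H) \<noteq> 0}" by auto
  then show ?thesis
    using assms openin_fs_reg_nonzero[of mat_coords G "{g \<in> G. g \<cdot> H \<in> U}" "\<lambda>g. f (g \<cdot> H)"]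
    unfolding fs_reg_X openin_homogeneous_space by auto
qed

lemma fs_reg_left_translate:
  assumes "fs_reg (mat_space G) G f" "a \<in> G"
  shows "fs_reg (mat_space G) G (\<lambda>g. f (a ** g))"
proof -
  have "fs_reg (mat_space G) {g \<in> G. a ** g \<in> G} (\<lambda>g. f (a ** g))"
    by (rule fs_reg_pullback_poly[where \<tau> = "\<lambda>g. a ** g", OF _ _ assms(1)])
      (auto intro: G_mult assms poly_fun_left_translate)
  moreover have "{g \<in> G. a ** g \<in> G} = G" using G_mult assms by auto
  ultimately show ?thesis by simp
qed

lemma fs_reg_right_translate:
  assumes "fs_reg (mat_space G) G f" "a \<in> G"
  shows "fs_reg (mat_space G) G (\<lambda>g. f (g ** a))"
proof -
  have "fs_reg (mat_space G) {g \<in> G. g ** a \<in> G} (\<lambda>g. f (g ** a))"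
    by (rule fs_reg_pullback_poly[where \<tau> = "\<lambda>g. g ** a", OF _ _ assms(1)])
      (auto intro: G_mult assms poly_fun_right_translate)
  moreover have "{g \<in> G. g ** a \<in> G} = G" using G_mult assms by auto
  ultimately show ?thesis by simp
qed

lemma fs_reg_X_translate:
  assumes "fs_reg X P f" "g \<in> G"
  shows "fs_reg X P (translate g f)"
  using fs_reg_left_translate[OF assms(1)[unfolded fs_reg_X_points] inv_G(2)[OF assms(2)]]
  unfolding fs_reg_X_points by (simp add: translate_def l_coset_GL_mult)

lemma fs_reg_orbit_map:
  assumes "fs_reg X P f" "x \<in> P"
  shows "fs_reg (mat_space G) G (\<lambda>g. f (g \<cdot> x))"
proof -
  obtain a where a: "a \<in> G" "x = a \<cdot> H" using points_E[OF assms(2)] .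
  show ?thesis
    using fs_reg_right_translate[OF assms(1)[unfolded fs_reg_X_points] a(1)]
    by (simp add: a(2) l_coset_GL_mult)
qed

text \<open>Inversion is polynomial up to a power of the determinant, which has no zero on G. It is
  needed because \<open>translate g\<close> acts through the inverse of g, while orbit maps use g
  itself.\<close>

lemma openin_inverse_preimage:
  assumes "openin (fs_top (mat_space G)) U"
  shows "openin (fs_top (mat_space G)) {g \<in> G. inv\<^bsub>GL\<^esub> g \<in> U}"
  unfolding openin_zariski_space
proof (intro conjI ballI)
  fix x assume x: "x \<in> {g \<in> G. inv\<^bsub>GL\<^esub> g \<in> U}"
  then obtain p where p: "p \<in> poly_fun mat_coords" "p (inv\<^bsub>GL\<^esub> x) \<noteq> 0" "\<forall>y\<in>G. p y \<noteq> 0 \<longrightarrow> y \<in> U"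
    using assms unfolding openin_zariski_space by blast
  obtain q N where q: "q \<in> poly_fun mat_coords" "\<forall>x. invertible x \<longrightarrow> q x = p (matrix_inv x) * det x ^ N"
    using poly_fun_matrix_inv[OF p(1)] by (elim bexE exE)
  have qG: "q y \<noteq> 0 \<longleftrightarrow> p (inv\<^bsub>GL\<^esub> y) \<noteq> 0" if "y \<in> G" for y
    using q(2) G_invertible[OF that] inv_G(1)[OF that] by (simp add: invertible_det_nz)
  show "\<exists>p\<in>poly_fun mat_coords. p x \<noteq> 0 \<and> (\<forall>y\<in>G. p y \<noteq> 0 \<longrightarrow> y \<in> {g \<in> G. inv\<^bsub>GL\<^esub> g \<in> U})"
  proof (rule bexI[OF _ q(1)], intro conjI ballI impI)
    show "q x \<noteq> 0" using x p(2) qG by simp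
    fix y assume "y \<in> G" "q y \<noteq> 0"
    then show "y \<in> {g \<in> G. inv\<^bsub>GL\<^esub> g \<in> U}" using p(3) qG inv_G(2) by simp
  qed
qed auto

lemma dom_of_regular: "dom (of_regular X f) = P"
  by (auto simp: of_regular_def split: if_splits)

lemma the_of_regular: "x \<in> P \<Longrightarrow> (the \<circ> of_regular X f) x = f x"
  by (simp add: of_regular_def)

lemma of_regular_cong: "(\<And>x. x \<in> P \<Longrightarrow> f x = h x) \<Longrightarrow> of_regular X f = of_regular X h"
  by (auto simp: of_regular_def)

lemma points_nonempty: "P \<noteq> {}"
  using coset_in_points[OF G_one] by blast

lemma of_regular_rational: "fs_reg X P f \<Longrightarrow> of_regular X f \<in> rational_funs X"
  unfolding rational_funs_def mem_Collect_eq dom_of_regular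
proof (intro conjI allI impI points_nonempty)
  assume "fs_reg X P f"
  then show "fs_reg X P (the \<circ> of_regular X f)"
    using fs_reg_X_cong[of P "the \<circ> of_regular X f" f] the_of_regular by blast
  fix U h assume "fs_reg X U h" "P \<subseteq> U"
  then show "U = P" using openin_subset[OF fs_reg_X_openin] by blast
qed

lemma translate_of_regular:
  "g \<in> G \<Longrightarrow> translate g (of_regular X f) = of_regular X (translate g f)"
  using act_in_points_iff[OF inv_G(2), of g] by (auto simp: translate_def of_regular_def)

lemma semi_invariant_of_regular:
  "semi_invariant G B H (of_regular X f) \<omega> \<Longrightarrow> b \<in> B \<Longrightarrow> B \<subseteq> G \<Longrightarrow> x \<in> P \<Longrightarrow>
     translate b f x = \<omega> b * f x"
proof -
  assume *: "semi_invariant G B H (of_regular X f) \<omega>" "b \<in> B" "B \<subseteq> G" "x \<in> P"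
  then have "translate b (of_regular X f) x = map_option (\<lambda>z. \<omega> b * z) (of_regular X f x)"
    by (simp add: semi_invariant_def)
  then show ?thesis
    using * unfolding translate_of_regular[OF subsetD[OF *(3,2)]] by (simp add: of_regular_def)
qed

section \<open>Semi-invariants and their weights\<close>

text \<open>At a point where F is nonzero the scaling factor can be read off, which fixes the
  character on B; outside B it is fixed by \<open>extensional\<close>.\<close>

lemma weight_eq:
  assumes "semi_invariant G B H F \<omega>"
  shows "weight G B H F = \<omega>"
  unfolding weight_def
proof (rule the_equality)
  show "semi_invariant G B H F \<omega>" by (rule assms)
  fix \<rho> assume \<rho>: "semi_invariant G B H F \<rho>"
  obtain x z where xz: "F x = Some z" "z \<noteq> 0"
    using assms by (auto simp: semi_invariant_def nonzero_rational_funs_def)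
  have "\<rho> b = \<omega> b" if b: "b \<in> B" for b
  proof -
    have "translate b F = map_option (\<lambda>z. \<omega> b * z) \<circ> F" "translate b F = map_option (\<lambda>z. \<rho> b * z) \<circ> F"
      using assms \<rho> b unfolding semi_invariant_def by blast+
    then have "map_option (\<lambda>z. \<omega> b * z) (F x) = map_option (\<lambda>z. \<rho> b * z) (F x)"
      by (metis comp_apply)
    then show ?thesis using xz by simp
  qed
  moreover have "\<rho> \<in> extensional B" "\<omega> \<in> extensional B"
    using assms \<rho> by (auto simp: semi_invariant_def characters_def)
  ultimately show "\<rho> = \<omega>" by (intro extensionalityI[of \<rho> B \<omega>])
qed

text \<open>The quotient of two semi-invariants of the same weight is constant on the dense orbit.\<close>

lemma semi_invariant_unique:
  assumes B: "B \<subseteq> G" and sph: "spherical G B H" and f: "fs_reg X P f"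
    and sf: "semi_invariant G B H (of_regular X f) \<omega>" and sF: "semi_invariant G B H F \<omega>"
  obtains c where "c \<noteq> 0" "F = of_regular X (\<lambda>x. c * f x)"
proof -
  obtain x0 where x0: "x0 \<in> P" and dense: "fs_top X closure_of ((\<lambda>b. b \<cdot> x0) ` B) = P"
    using sph unfolding spherical_def by blast
  have orb: "\<exists>b\<in>B. b \<cdot> x0 \<in> V" if "openin (fs_top X) V" "V \<noteq> {}" for V
  proof -
    obtain v where "v \<in> V" using \<open>V \<noteq> {}\<close> by blast
    moreover have "v \<in> fs_top X closure_of ((\<lambda>b. b \<cdot> x0) ` B)"
      unfolding dense using \<open>v \<in> V\<close> openin_subset[OF that(1)] by blast
    ultimately show ?thesis using that(1) by (auto simp: in_closure_of)
  qed
  have trF: "translate b F = map_option (\<lambda>z. \<omega> b * z) \<circ> F" if "b \<in> B" for b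
    using sF that unfolding semi_invariant_def by blast
  have \<omega>: "\<omega> b \<noteq> 0" if "b \<in> B" for b
    using sF that by (auto simp: semi_invariant_def characters_def)
  have F: "F \<in> rational_funs X" "\<exists>x\<in>dom F. F x \<noteq> Some 0"
    using sF by (auto simp: semi_invariant_def nonzero_rational_funs_def)
  define k where "k = the \<circ> F"
  have k: "F x = Some (k x)" if "x \<in> dom F" for x using that by (auto simp: k_def)
  have reg: "fs_reg X (dom F) k" and maxF: "\<And>U h. fs_reg X U h \<Longrightarrow> dom F \<subseteq> U \<Longrightarrow>
      (\<And>x. x \<in> dom F \<Longrightarrow> F x = Some (h x)) \<Longrightarrow> U = dom F"
    using F(1) by (auto simp: rational_funs_def k_def)
  note dopen = fs_reg_X_openin[OF reg]
  have tr: "F (inv\<^bsub>GL\<^esub> b \<cdot> x) = map_option (\<lambda>z. \<omega> b * z) (F x)" if "b \<in> B" for b x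
    using trF[OF that] by (simp add: translate_def fun_eq_iff)
  have trf: "f (inv\<^bsub>GL\<^esub> b \<cdot> x) = \<omega> b * f x" if "b \<in> B" "x \<in> P" for b x
    using semi_invariant_of_regular[OF sf that(1) B that(2)] by (simp add: translate_def)
  have bG: "b \<in> G" if "b \<in> B" for b using that B by blast
  \<comment> \<open>The domain of F is open, hence meets the dense orbit, and it is stable under
    B.\<close>
  have domx0: "x0 \<in> dom F"
  proof -
    obtain b where b: "b \<in> B" "b \<cdot> x0 \<in> dom F" using orb[OF dopen] F(2) by blast
    have "F x0 = map_option (\<lambda>z. \<omega> b * z) (F (b \<cdot> x0))"
      using tr[OF b(1), of "b \<cdot> x0"] act_inv(1)[OF bG[OF b(1)]] by simp
    then show ?thesis using b(2) by auto
  qed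
  have Fb: "F x0 = map_option (\<lambda>z. \<omega> b * z) (F (b \<cdot> x0))" "f x0 = \<omega> b * f (b \<cdot> x0)" if "b \<in> B" for b
    using tr[OF that, of "b \<cdot> x0"] trf[OF that act_in_points[OF bG[OF that] x0]]
      act_inv(1)[OF bG[OF that]] by simp_all
  have kb: "k x0 = \<omega> b * k (b \<cdot> x0)" if "b \<in> B" for b
    using Fb(1)[OF that] domx0 by (cases "F (b \<cdot> x0)") (auto simp: k_def)
  have "f x0 \<noteq> 0"
  proof
    assume 0: "f x0 = 0"
    have "{x \<in> P. f x \<noteq> 0} \<noteq> {}"
      using sf by (auto simp: semi_invariant_def nonzero_rational_funs_def of_regular_def split: if_splits)
    from orb[OF openin_fs_reg_X_nonzero[OF f] this] show False using Fb(2) 0 \<omega> by auto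
  qed
  have "k x0 \<noteq> 0"
  proof
    assume 0: "k x0 = 0"
    have "{x \<in> dom F. k x \<noteq> 0} \<noteq> {}" using F(2) by (auto simp: k_def)
    from orb[OF openin_fs_reg_X_nonzero[OF reg] this] show False using kb 0 \<omega> by auto
  qed
  define c where "c = k x0 / f x0"
  have c: "c \<noteq> 0" using \<open>k x0 \<noteq> 0\<close> \<open>f x0 \<noteq> 0\<close> by (simp add: c_def)
  have "k x = c * f x" if x: "x \<in> dom F" for x
  proof (rule ccontr)
    assume ne: "k x \<noteq> c * f x"
    have "fs_reg X (dom F) (\<lambda>x. k x + (- c) * f x)"
      by (intro fs_reg_X_add reg fs_reg_X_scale fs_reg_X_mono[OF f dopen] openin_subset dopen)
    from openin_fs_reg_X_nonzero[OF this] orb[of "{x \<in> dom F. k x + (- c) * f x \<noteq> 0}"] x ne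
    obtain b where b: "b \<in> B" "k (b \<cdot> x0) \<noteq> c * f (b \<cdot> x0)" by auto
    have "\<omega> b * k (b \<cdot> x0) = c * (\<omega> b * f (b \<cdot> x0))"
      using kb[OF b(1)] Fb(2)[OF b(1)] \<open>f x0 \<noteq> 0\<close> by (simp add: c_def)
    then show False using b \<omega> by auto
  qed
  then have Fx: "F x = Some (c * f x)" if "x \<in> dom F" for x using that k by simp
  \<comment> \<open>The function c f is regular on all of P and extends F, whose domain is
    maximal.\<close>
  have "P = dom F"
    by (rule maxF[OF fs_reg_X_scale[OF f] openin_subset[OF dopen] Fx])
  then have "F = of_regular X (\<lambda>x. c * f x)"
    using Fx by (auto simp: of_regular_def fun_eq_iff domIff)
  with c that show ?thesis by blast
qed

section \<open>Units as eigenfunctions of G\<close>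

lemma units_translate:
  assumes "u \<in> units X" "a \<in> G"
  shows "translate a u \<in> units X"
  using assms fs_reg_X_translate[of u a] act_in_points[OF inv_G(2)]
  by (auto simp: units_def translate_def)

text \<open>The eigenvalue at a is u (a x) / u x; comparing two points in cross-multiplied form
  avoids naming it. The integer exponents of a translate in the unit basis determine the ratio of
  its values at x and y, since the constant in front cancels.\<close>

lemma unit_eigenfunction:
  fixes g :: "nat \<Rightarrow> (complex^'n^'n) set \<Rightarrow> complex"
  assumes basis: "unit_basis X m g" and u: "u \<in> units X" and xy: "x \<in> P" "y \<in> P" and a: "a \<in> G"
  shows "u (a \<cdot> x) * u y = u x * u (a \<cdot> y)"
proof -
  let ?A = "poly_fun mat_coords :: (complex^'n^'n \<Rightarrow> complex) set"
  have ureg: "fs_reg X P u" and unz: "\<And>z. z \<in> P \<Longrightarrow> u z \<noteq> 0" using u by (auto simp: units_def)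
  define L where "L = (\<lambda>a. u (a \<cdot> x) / u (a \<cdot> y)) ` G"
  have "L \<subseteq> (\<lambda>e. \<Prod>k<m. g k x powi e k / g k y powi e k) ` ({..<m} \<rightarrow>\<^sub>E (UNIV :: int set))"
    unfolding L_def
  proof (rule image_subsetI)
    fix a assume a: "a \<in> G"
    have "translate (inv\<^bsub>GL\<^esub> a) u \<in> units X" by (rule units_translate[OF u inv_G(2)[OF a]])
    then obtain c e where "\<forall>z\<in>P. translate (inv\<^bsub>GL\<^esub> a) u z = c * (\<Prod>k<m. g k z powi (e k :: int))"
      using basis unfolding unit_basis_def by metis
    then have ce: "u (a \<cdot> z) = c * (\<Prod>k<m. g k z powi e k)" if "z \<in> P" for z
      using that inv_G_inv[OF a] by (simp add: translate_def)
    have "c \<noteq> 0" using ce[OF xy(1)] unz[OF act_in_points[OF a xy(1)]] by auto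
    then have "u (a \<cdot> x) / u (a \<cdot> y) = (\<Prod>k<m. g k x powi e k / g k y powi e k)"
      using ce xy by (simp add: prod_dividef)
    \<comment> \<open>Exponents from position m on are discarded, so that the index set is a finite
      product of copies of the integers, which is countable.\<close>
    also have "\<dots> = (\<Prod>k<m. g k x powi restrict e {..<m} k / g k y powi restrict e {..<m} k)"
      by (intro prod.cong) auto
    finally show "u (a \<cdot> x) / u (a \<cdot> y) \<in>
        (\<lambda>e. \<Prod>k<m. g k x powi e k / g k y powi e k) ` ({..<m} \<rightarrow>\<^sub>E UNIV)"
      by (rule image_eqI[where x = "restrict e {..<m}"]) auto
  qed
  then have L: "countable L" by (rule countable_subset) (intro countable_image countable_PiE; simp)
  obtain g1 g2 where g12: "g1 \<in> G" "x = g1 \<cdot> H" "g2 \<in> G" "y = g2 \<cdot> H"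
    using points_E[OF xy(1)] points_E[OF xy(2)] by metis
  note U = ureg[unfolded fs_reg_X_points]
  obtain p1 q1 where 1: "p1 \<in> ?A" "q1 \<in> ?A" "q1 g1 \<noteq> 0" "\<forall>z\<in>G. q1 z \<noteq> 0 \<longrightarrow> u (z \<cdot> H) * q1 z = p1 z"
    using fs_regE[OF U g12(1)] .
  obtain p2 q2 where 2: "p2 \<in> ?A" "q2 \<in> ?A" "q2 g2 \<noteq> 0" "\<forall>z\<in>G. q2 z \<noteq> 0 \<longrightarrow> u (z \<cdot> H) * q2 z = p2 z"
    using fs_regE[OF U g12(3)] .
  \<comment> \<open>Fractions p1 / q1 and p2 / q2 represent u near x and y. Right translation by g1
    and g2 turns them into functions of the moving element, and u (b x) / u (b y) becomes R b / Q b
    wherever the common denominator K is nonzero.\<close>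
  define K where "K = (\<lambda>a. q1 (a ** g1) * q2 (a ** g2))"
  define R where "R = (\<lambda>a. p1 (a ** g1) * q2 (a ** g2))"
  define Q where "Q = (\<lambda>a. q1 (a ** g1) * p2 (a ** g2))"
  have KA: "K \<in> ?A" and RA: "R \<in> ?A" and QA: "Q \<in> ?A" unfolding K_def R_def Q_def
    by (intro poly_fun.mult poly_fun_right_translate 1 2)+
  have val: "R b = u (b \<cdot> x) * K b" "Q b = u (b \<cdot> y) * K b" if b: "b \<in> G" "K b \<noteq> 0" for b
  proof -
    have "u ((b ** g1) \<cdot> H) * q1 (b ** g1) = p1 (b ** g1)" "u ((b ** g2) \<cdot> H) * q2 (b ** g2) = p2 (b ** g2)"
      using 1(4) 2(4) b g12 G_mult by (auto simp: K_def)
    then show "R b = u (b \<cdot> x) * K b" "Q b = u (b \<cdot> y) * K b"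
      by (simp_all add: R_def Q_def K_def g12 l_coset_GL_mult flip: \<open>_ = p1 _\<close> \<open>_ = p2 _\<close>)
  qed
  have K1: "K (mat 1) \<noteq> 0" using 1(3) 2(3) by (simp add: K_def)
  have uy: "u (b \<cdot> y) \<noteq> 0" "u (b \<cdot> x) \<noteq> 0" if "b \<in> G" for b using unz act_in_points that xy by auto
  have "\<exists>c. \<forall>b\<in>G. R b = c * Q b"
  proof (rule countable_values_constant[OF group conn RA QA KA G_one K1 _ _ L])
    show "Q (mat 1) \<noteq> 0" using val(2)[OF G_one K1] K1 uy(1)[OF G_one] by simp
    fix b assume b: "b \<in> G" "K b \<noteq> 0"
    show "\<exists>c\<in>L. R b = c * Q b \<and> Q b \<noteq> 0"
      using val[OF b] uy[OF b(1)] b by (intro bexI[of _ "u (b \<cdot> x) / u (b \<cdot> y)"]) (auto simp: L_def)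
  qed
  then obtain c where c: "\<And>b. b \<in> G \<Longrightarrow> R b = c * Q b" by blast
  have eq: "u (b \<cdot> x) = c * u (b \<cdot> y)" if b: "b \<in> G" for b
  proof (rule ccontr)
    assume ne: "u (b \<cdot> x) \<noteq> c * u (b \<cdot> y)"
    define d where "d = (\<lambda>b. u (b \<cdot> x) + (\<lambda>_. - c) b * u (b \<cdot> y))"
    have "fs_reg (mat_space G) G d"
      unfolding d_def
      by (intro fs_reg_add fs_reg_mult fs_reg_orbit_map[OF ureg] xy fs_reg_poly poly_fun.const)
        (metis openin_topspace fs_points_zariski_space)
    from openin_fs_reg_nonzero[OF this] have D: "openin (fs_top (mat_space G)) {b \<in> G. d b \<noteq> 0}" .
    moreover have "{b \<in> G. d b \<noteq> 0} \<noteq> {}" using b ne by (auto simp: d_def)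
    moreover have "openin (fs_top (mat_space G)) {b \<in> G. K b \<noteq> 0}" by (rule openin_zariski_space_basic[OF KA])
    moreover have "{b \<in> G. K b \<noteq> 0} \<noteq> {}" using G_one K1 by blast
    ultimately have "{b \<in> G. d b \<noteq> 0} \<inter> {b \<in> G. K b \<noteq> 0} \<noteq> {}"
      by (rule openin_group_Int_nonempty[OF group conn])
    then obtain z where "z \<in> G" "d z \<noteq> 0" "K z \<noteq> 0" by auto
    then show False using val[of z] c[of z] by (simp add: d_def)
  qed
  have "u x = c * u y" using eq[OF G_one] by (simp add: l_coset_GL_one)
  with eq[OF a] show ?thesis by simp
qed

text \<open>The eigenvalue is an orbit map of u divided by a constant, hence regular; applying the
  eigenvector property twice makes it multiplicative.\<close>

lemma unit_semi_invariant:
  assumes basis: "unit_basis X m g" and u: "u \<in> units X" and B: "B \<subseteq> G" "algebraic_group B"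
  shows "\<exists>\<omega>. semi_invariant G B H (of_regular X u) \<omega>"
proof -
  have ureg: "fs_reg X P u" and unz: "\<And>z. z \<in> P \<Longrightarrow> u z \<noteq> 0" using u by (auto simp: units_def)
  obtain x where x: "x \<in> P" using points_nonempty by blast
  define \<rho> where "\<rho> = (\<lambda>b. u (b \<cdot> x) * inverse (u x))"
  have nz: "\<rho> b \<noteq> 0" if "b \<in> G" for b
    using unz[OF x] unz[OF act_in_points[OF that x]] by (simp add: \<rho>_def)
  have eig: "u (b \<cdot> y) = \<rho> b * u y" if "b \<in> G" "y \<in> P" for b y
    using unit_eigenfunction[OF basis u that(2) x that(1)] unz[OF x] by (simp add: \<rho>_def field_simps)
  have mult: "\<rho> (b ** c) = \<rho> b * \<rho> c" if "b \<in> G" "c \<in> G" for b c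
    using eig[OF that(1) act_in_points[OF that(2) x]] by (simp add: \<rho>_def l_coset_GL_mult)
  \<comment> \<open>Inverted because \<open>translate b\<close> composes with the inverse of b, and
    restricted because characters are \<open>extensional\<close>.\<close>
  define \<omega> where "\<omega> = (\<lambda>b\<in>B. inverse (\<rho> b))"
  have "openin (fs_top (mat_space G)) G"
    using openin_topspace[of "fs_top (mat_space G)"] by simp
  then have "fs_reg (mat_space G) G (\<lambda>b. inverse (\<rho> b))"
    unfolding \<rho>_def using nz[unfolded \<rho>_def]
    by (intro fs_reg_inverse fs_reg_mult fs_reg_orbit_map[OF ureg x] fs_reg_poly poly_fun.const)
  then have "fs_reg (mat_space B) {b \<in> B. b \<in> G} (\<lambda>b. inverse (\<rho> b))"
    by (rule fs_reg_pullback_poly[where \<tau> = "\<lambda>b. b", rotated 2]) (use B in auto)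
  moreover have "{b \<in> B. b \<in> G} = B" using B by auto
  ultimately have "fs_reg (mat_space B) B \<omega>"
    using fs_reg_cong[of B \<omega> "\<lambda>b. inverse (\<rho> b)" mat_coords B] by (simp add: \<omega>_def)
  then have "\<omega> \<in> characters B"
    using nz mult B algebraic_group_mult[OF B(2)] by (auto simp: characters_def \<omega>_def subset_eq)
  moreover have "of_regular X u \<in> nonzero_rational_funs X"
    using of_regular_rational[OF ureg] x unz[OF x]
    by (auto simp: nonzero_rational_funs_def dom_of_regular of_regular_def)
  moreover have "translate b (of_regular X u) = map_option (\<lambda>z. \<omega> b * z) \<circ> of_regular X u"
    if b: "b \<in> B" for b
  proof -
    have bG: "b \<in> G" using b B by blast
    have "translate b u y = \<omega> b * u y" if y: "y \<in> P" for y
      using eig[OF bG act_in_points[OF inv_G(2)[OF bG] y]] nz[OF bG] b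
      by (simp add: translate_def act_inv(2)[OF bG] \<omega>_def)
    then show ?thesis
      unfolding translate_of_regular[OF bG] by (auto simp: of_regular_def fun_eq_iff)
  qed
  ultimately show ?thesis unfolding semi_invariant_def by blast
qed

end

section \<open>Puiseux series and evaluation functionals\<close>

lemma pcoeff_from_fls: "n > 0 \<Longrightarrow> pcoeff (Abs_puiseux (from_fls n F)) = from_fls n F"
  by (rule Abs_puiseux_inverse[OF from_fls_carrier])

lemma puiseux_from_fls2:
  obtains n F K where "n > 0" "a = Abs_puiseux (from_fls n F)" "b = Abs_puiseux (from_fls n K)"
  by (rule puiseux_cases3[of a b b]) blast

lemma pcoeff_zero: "pcoeff 0 q = 0"
  using pcoeff_from_fls[of 1 0] from_fls_simps(4)[of 1] by (simp add: from_fls_def)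

lemma pcoeff_add: "pcoeff (a + b) q = pcoeff a q + pcoeff b q"
proof -
  obtain n F K where n: "n > 0" "a = Abs_puiseux (from_fls n F)" "b = Abs_puiseux (from_fls n K)"
    by (rule puiseux_from_fls2)
  show ?thesis
    unfolding n from_fls_simps(1)[OF n(1)] pcoeff_from_fls[OF n(1)] by (simp add: from_fls_def)
qed

lemma pcoeff_sum: "pcoeff (\<Sum>i\<in>S. f i) q = (\<Sum>i\<in>S. pcoeff (f i) q)"
  by (induction S rule: infinite_finite_induct) (simp_all add: pcoeff_zero pcoeff_add)

lemma puiseux_const_from_fls:
  assumes "n > 0"
  shows "puiseux_const c = Abs_puiseux (from_fls n (fls_const c))"
  unfolding puiseux_const_def using assms
  by (intro arg_cong[of _ _ Abs_puiseux] ext) (auto simp: from_fls_def elim!: Ints_cases)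

lemma pcoeff_const_mult: "pcoeff (puiseux_const c * a) q = c * pcoeff a q"
proof -
  obtain n F K where n: "n > 0" "a = Abs_puiseux (from_fls n F)" "a = Abs_puiseux (from_fls n K)"
    by (rule puiseux_from_fls2)
  show ?thesis
    unfolding n(2) puiseux_const_from_fls[OF n(1)] from_fls_simps(7)[OF n(1)] pcoeff_from_fls[OF n(1)]
    by (simp add: from_fls_def)
qed

text \<open>The rationals are not well-ordered; the least exponent exists because the exponents have
  a common denominator, which reduces the claim to the subdegree of a Laurent series.\<close>

lemma puiseux_lowest_term:
  assumes "a \<noteq> 0"
  obtains v where "pcoeff a v \<noteq> 0" "\<And>q. q < v \<Longrightarrow> pcoeff a q = 0"
proof -
  obtain n F K where n: "n > 0" "a = Abs_puiseux (from_fls n F)" "a = Abs_puiseux (from_fls n K)"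
    by (rule puiseux_from_fls2)
  have "F \<noteq> 0" using assms n from_fls_simps(4)[OF n(1)] by auto
  have "pcoeff a (of_int (fls_subdegree F) / of_nat n) \<noteq> 0"
    unfolding n(2) pcoeff_from_fls[OF n(1)] from_fls_int[OF n(1)] using \<open>F \<noteq> 0\<close> by simp
  moreover have "pcoeff a q = 0" if "q < of_int (fls_subdegree F) / of_nat n" for q
  proof (rule ccontr)
    assume "pcoeff a q \<noteq> 0"
    then obtain k where "q = of_int k / of_nat n" "fls_nth F k \<noteq> 0"
      unfolding n(2) pcoeff_from_fls[OF n(1)] using from_fls_nz[OF n(1)] by blast
    then show False using that fls_subdegree_leI[of F k] n(1) by (simp add: divide_less_cancel)
  qed
  ultimately show ?thesis using that by blast
qed

text \<open>Replaces the \<open>LEAST\<close> by conditions on single coefficients, which depend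
  linearly on the series.\<close>

lemma puiseux_val_eq_Fin:
  "puiseux_val a = Fin v \<longleftrightarrow> pcoeff a v \<noteq> 0 \<and> (\<forall>q<v. pcoeff a q = 0)"
proof (cases "a = 0")
  case True
  then show ?thesis by (simp add: puiseux_val_def pcoeff_zero)
next
  case False
  then obtain w where w: "pcoeff a w \<noteq> 0" "\<And>q. q < w \<Longrightarrow> pcoeff a q = 0"
    using puiseux_lowest_term[OF False] by blast
  have "(LEAST q. pcoeff a q \<noteq> 0) = w"
    using w by (intro Least_equality) (auto simp: not_le[symmetric])
  then have "puiseux_val a = Fin w" using False by (simp add: puiseux_val_def)
  moreover have "v = w \<longleftrightarrow> pcoeff a v \<noteq> 0 \<and> (\<forall>q<v. pcoeff a q = 0)"
    using w by (metis not_less_iff_gr_or_eq)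
  ultimately show ?thesis by auto
qed

lemma puiseux_val_neq_Minf: "puiseux_val a \<noteq> Minf"
  by (simp add: puiseux_val_def)

lemma puiseux_val_eq_Pinf: "puiseux_val a = Pinf \<longleftrightarrow> a = 0"
  by (simp add: puiseux_val_def)

lemma Fin_le_puiseux_val:
  assumes "Fin v \<le> puiseux_val a" "q < v"
  shows "pcoeff a q = 0"
proof (cases "puiseux_val a")
  case (Fin w)
  then show ?thesis using assms puiseux_val_eq_Fin[of a w] by auto
next
  case Pinf
  then show ?thesis by (simp add: puiseux_val_eq_Pinf pcoeff_zero)
qed (simp add: puiseux_val_neq_Minf)

text \<open>One nonzero series makes the minimum finite, and it is attained. Thus the coefficients
  at v are not all zero and lower ones cannot interfere with them in a linear combination.\<close>

lemma Min_puiseux_val: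
  assumes "finite S" "j \<in> S" "a j \<noteq> 0"
  shows "\<exists>v. Min ((\<lambda>j. puiseux_val (a j)) ` S) = Fin v \<and> (\<exists>i\<in>S. pcoeff (a i) v \<noteq> 0) \<and>
    (\<forall>j\<in>S. \<forall>q<v. pcoeff (a j) q = 0)"
proof -
  let ?M = "Min ((\<lambda>j. puiseux_val (a j)) ` S)"
  have "?M \<in> (\<lambda>j. puiseux_val (a j)) ` S" using assms by (intro Min_in) auto
  then obtain i where i: "i \<in> S" "?M = puiseux_val (a i)" by auto
  have le: "?M \<le> puiseux_val (a j)" if "j \<in> S" for j using that assms(1) by simp
  have "?M \<noteq> Pinf" using le[OF assms(2)] assms(3) by (auto simp: puiseux_val_eq_Pinf)
  then obtain v where v: "?M = Fin v" using i(2) puiseux_val_neq_Minf[of "a i"]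
    by (cases "puiseux_val (a i)") auto
  then have "pcoeff (a i) v \<noteq> 0" using i(2) by (simp add: puiseux_val_eq_Fin)
  moreover have "\<forall>j\<in>S. \<forall>q<v. pcoeff (a j) q = 0"
    using le Fin_le_puiseux_val unfolding v by blast
  ultimately show ?thesis using v i(1) by blast
qed

lemma puiseux_val_combination:
  assumes "\<And>j q. j \<in> S \<Longrightarrow> q < v \<Longrightarrow> pcoeff (a j) q = 0" "(\<Sum>j\<in>S. c j * pcoeff (a j) v) \<noteq> 0"
  shows "puiseux_val (\<Sum>j\<in>S. puiseux_const (c j) * a j) = Fin v"
  using assms by (simp add: puiseux_val_eq_Fin pcoeff_sum pcoeff_const_mult)

section \<open>Functionals spanned by evaluations at points\<close>

text \<open>Such functionals are defined on all functions. Applied to the moving function f (g x),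
  an evaluation becomes an orbit map, so their dependence on g is regular.\<close>

definition evaluations :: "'p set \<Rightarrow> (('p \<Rightarrow> complex) \<Rightarrow> complex) set" where
  "evaluations S = fun_vs.span ((\<lambda>x f. f x) ` S)"

lemma evaluations_induct [consumes 1, case_names zero step]:
  assumes "l \<in> evaluations S" "Q 0"
    "\<And>c x l. x \<in> S \<Longrightarrow> Q l \<Longrightarrow> Q (fscale c (\<lambda>f. f x) + l)"
  shows "Q l"
  using assms(1) unfolding evaluations_def
  by (induction rule: fun_vs.span_induct_alt) (use assms(2,3) in auto)

lemma evaluations_sum:
  assumes "l \<in> evaluations S"
  shows "l (\<lambda>x. \<Sum>j\<in>I. c j * f j x) = (\<Sum>j\<in>I. c j * l (f j))"
  using assms
  by (induction rule: evaluations_induct)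
    (simp_all add: fun_apply sum_distrib_left sum.distrib algebra_simps)

lemma evaluations_cong:
  assumes "l \<in> evaluations S" "\<And>x. x \<in> S \<Longrightarrow> f x = h x"
  shows "l f = l h"
  using assms by (induction rule: evaluations_induct) (simp_all add: fun_apply)

text \<open>Linearly independent functions are separated by evaluations. In the induction step a
  functional k is found that kills the first n functions but not the next one; a multiple of k
  corrects the last value.\<close>

lemma evaluations_interpolate:
  fixes n :: nat
  assumes "\<And>c. \<forall>x\<in>S. (\<Sum>j<n. c j * f j x) = 0 \<Longrightarrow> \<forall>j<n. c j = 0"
  shows "\<exists>l\<in>evaluations S. \<forall>j<n. l (f j) = e j"
  using assms
proof (induction n arbitrary: e)
  case 0
  show ?case by (auto simp: evaluations_def intro: fun_vs.span_zero)
next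
  case (Suc n)
  have IH: "\<exists>l\<in>evaluations S. \<forall>j<n. l (f j) = e j" for e
  proof (rule Suc.IH)
    fix c assume c: "\<forall>x\<in>S. (\<Sum>j<n. c j * f j x) = 0"
    have "\<forall>j<Suc n. (if j < n then c j else 0) = 0" using c by (intro Suc.prems) simp
    then show "\<forall>j<n. c j = 0" by (auto simp: less_Suc_eq)
  qed
  define d where "d i = (SOME l. l \<in> evaluations S \<and> (\<forall>j<n. l (f j) = (if j = i then 1 else 0)))" for i
  have d': "d i \<in> evaluations S \<and> (\<forall>j<n. d i (f j) = (if j = i then 1 else 0))" for i
    using IH[of "\<lambda>j. if j = i then 1 else 0", unfolded Bex_def, THEN someI_ex] unfolding d_def .
  then have d: "d i \<in> evaluations S" "j < n \<Longrightarrow> d i (f j) = (if j = i then 1 else 0)" for i j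
    by simp_all
  \<comment> \<open>Otherwise f n would be a combination of the earlier functions with coefficients
    d j (f n).\<close>
  have "\<exists>x\<in>S. f n x \<noteq> (\<Sum>j<n. f j x * d j (f n))"
  proof (rule ccontr)
    assume "\<not> ?thesis"
    then have "\<forall>j<Suc n. (if j < n then - d j (f n) else 1) = 0"
      by (intro Suc.prems) (simp add: sum_negf mult.commute)
    then show False by auto
  qed
  then obtain x where x: "x \<in> S" "f n x \<noteq> (\<Sum>j<n. f j x * d j (f n))" by blast
  \<comment> \<open>Evaluation at x, corrected by the dual functionals d j so as to kill the earlier
    functions; the choice of x keeps it nonzero on f n.\<close>
  define k where "k = (\<lambda>f. f x) + (- (\<Sum>j<n. fscale (f j x) (d j)))"
  have kE: "k \<in> evaluations S"
    unfolding k_def using x(1) d(1) unfolding evaluations_def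
    by (intro fun_vs.span_add fun_vs.span_neg fun_vs.span_sum fun_vs.span_scale)
      (auto intro: fun_vs.span_base)
  have k0: "k (f i) = 0" if "i < n" for i
  proof -
    have "(\<Sum>j<n. f j x * d j (f i)) = (\<Sum>j<n. if j = i then f j x else 0)"
      using that by (intro sum.cong) (auto simp: d(2))
    then show ?thesis using that by (simp add: k_def fun_apply)
  qed
  have kn: "k (f n) \<noteq> 0" using x(2) by (simp add: k_def fun_apply)
  obtain l where l: "l \<in> evaluations S" "\<forall>j<n. l (f j) = e j" using IH[of e] by blast
  define l' where "l' = l + fscale ((e n - l (f n)) / k (f n)) k"
  have "l' \<in> evaluations S"
    unfolding l'_def using l(1) kE unfolding evaluations_def
    by (intro fun_vs.span_add fun_vs.span_scale)
  moreover have "\<forall>j<Suc n. l' (f j) = e j"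
    using l(2) k0 kn by (auto simp: l'_def fun_apply less_Suc_eq)
  ultimately show ?case by blast
qed

section \<open>Values of regular functions at a Puiseux point\<close>

context algebraic_homogeneous_space
begin

lemma openin_points: "openin (fs_top X) P"
  by (rule openin_topspace)

lemma puiseux_points_meet: "\<gamma> \<in> puiseux_points X Y \<Longrightarrow> P \<inter> fst \<gamma> \<noteq> {}"
  by (auto simp: puiseux_points_def irreducible_in_def)

lemma defined_at_of_regular: "\<gamma> \<in> puiseux_points X Y \<Longrightarrow> defined_at \<gamma> (of_regular X f)"
  using puiseux_points_meet by (auto simp: defined_at_def dom_of_regular)

context
  fixes \<gamma> Y assumes \<gamma>: "\<gamma> \<in> puiseux_points X Y"
begin

abbreviation val_at where "val_at f \<equiv> pullback \<gamma> (of_regular X f)"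

text \<open>\<open>pullback\<close> feeds the function \<open>the\<close> after
  \<open>of_regular\<close> to the point. Compatibility with restriction, used for equal open sets,
  shows that only values on P count.\<close>

lemma val_at_eq:
  assumes "fs_reg X P f"
  shows "val_at f = snd \<gamma> P f"
proof -
  obtain W \<phi> where W: "\<gamma> = (W, \<phi>)" by (cases \<gamma>)
  have "P \<inter> W \<noteq> {}" using puiseux_points_meet[OF \<gamma>] W by simp
  note compat = \<gamma>[unfolded W puiseux_points_def mem_Collect_eq case_prod_conv, THEN conjunct2,
      THEN conjunct2, THEN conjunct2, THEN spec, of P, THEN mp, OF conjI[OF openin_points this],
      THEN conjunct2, THEN conjunct2, THEN conjunct2, rule_format, of f P "the \<circ> of_regular X f"]
  have "\<phi> P (the \<circ> of_regular X f) = \<phi> P f"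
    using compat \<open>P \<inter> W \<noteq> {}\<close> assms the_of_regular[of _ f] openin_points by blast
  then show ?thesis by (simp add: pullback_def dom_of_regular W)
qed

lemma point_ring_hom:
  shows "snd \<gamma> P (\<lambda>_. c) = puiseux_const c"
    and "fs_reg X P f \<Longrightarrow> fs_reg X P h \<Longrightarrow> snd \<gamma> P (\<lambda>x. f x + h x) = snd \<gamma> P f + snd \<gamma> P h"
    and "fs_reg X P f \<Longrightarrow> fs_reg X P h \<Longrightarrow> snd \<gamma> P (\<lambda>x. f x * h x) = snd \<gamma> P f * snd \<gamma> P h"
    and "fs_reg X P f \<Longrightarrow> snd \<gamma> P f = 0 \<longleftrightarrow> (\<forall>x\<in>P \<inter> fst \<gamma>. f x = 0)"
proof -
  obtain W \<phi> where W: "\<gamma> = (W, \<phi>)" by (cases \<gamma>)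
  have "P \<inter> W \<noteq> {}" using puiseux_points_meet[OF \<gamma>] W by simp
  note hom = \<gamma>[unfolded W puiseux_points_def mem_Collect_eq case_prod_conv, THEN conjunct2,
      THEN conjunct2, THEN conjunct2, THEN spec, of P, THEN mp, OF conjI[OF openin_points this]]
  note hom1 = hom[THEN conjunct1, THEN spec]
    and hom2 = hom[THEN conjunct2, THEN conjunct1, THEN spec, THEN spec, THEN mp]
    and hom3 = hom[THEN conjunct2, THEN conjunct2, THEN conjunct1, THEN spec, THEN mp]
  show "snd \<gamma> P (\<lambda>_. c) = puiseux_const c" using hom1 by (simp add: W)
  show "fs_reg X P f \<Longrightarrow> fs_reg X P h \<Longrightarrow> snd \<gamma> P (\<lambda>x. f x + h x) = snd \<gamma> P f + snd \<gamma> P h"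
    "fs_reg X P f \<Longrightarrow> fs_reg X P h \<Longrightarrow> snd \<gamma> P (\<lambda>x. f x * h x) = snd \<gamma> P f * snd \<gamma> P h"
    using hom2[of f h] by (simp_all add: W)
  show "fs_reg X P f \<Longrightarrow> snd \<gamma> P f = 0 \<longleftrightarrow> (\<forall>x\<in>P \<inter> fst \<gamma>. f x = 0)"
    using hom3[of f] by (simp add: W)
qed

lemma val_at_const: "val_at (\<lambda>_. c) = puiseux_const c"
  using val_at_eq[OF fs_reg_X_const[OF openin_points]] point_ring_hom(1) by simp

lemma val_at_add: "fs_reg X P f \<Longrightarrow> fs_reg X P h \<Longrightarrow> val_at (\<lambda>x. f x + h x) = val_at f + val_at h"
  by (simp add: val_at_eq fs_reg_X_add point_ring_hom(2))

lemma val_at_scale: "fs_reg X P f \<Longrightarrow> val_at (\<lambda>x. c * f x) = puiseux_const c * val_at f"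
  using point_ring_hom(3)[OF fs_reg_X_const[OF openin_points], of f c]
  by (simp add: val_at_eq fs_reg_X_scale point_ring_hom(1))

lemma val_at_zero_iff: "fs_reg X P f \<Longrightarrow> val_at f = 0 \<longleftrightarrow> (\<forall>x\<in>P \<inter> fst \<gamma>. f x = 0)"
  by (simp add: val_at_eq point_ring_hom(4))

lemma puiseux_const_0: "puiseux_const 0 = 0"
  by (simp add: puiseux_const_def zero_puiseux_def)

lemma val_at_combination:
  assumes "\<And>i. i \<in> S \<Longrightarrow> fs_reg X P (f i)"
  shows "val_at (\<lambda>x. \<Sum>i\<in>S. c i * f i x) = (\<Sum>i\<in>S. puiseux_const (c i) * val_at (f i))"
  using assms
proof (induction S rule: infinite_finite_induct)
  case (insert i S)
  have "fs_reg X P (\<lambda>x. \<Sum>i\<in>S. c i * f i x)"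
    using insert.prems by (intro fs_reg_X_sum openin_points fs_reg_X_scale) auto
  then have "val_at (\<lambda>x. c i * f i x + (\<Sum>i\<in>S. c i * f i x)) =
      puiseux_const (c i) * val_at (f i) + (\<Sum>i\<in>S. puiseux_const (c i) * val_at (f i))"
    using insert by (simp add: val_at_add val_at_scale fs_reg_X_scale)
  then show ?case using insert.hyps by simp
qed (simp_all add: val_at_const puiseux_const_0)

text \<open>One nonempty open set of good translates determines the \<open>THE\<close>: any
  competing open set meets it, as G is irreducible.\<close>

lemma spherical_val_eq:
  assumes V: "openin (fs_top (mat_space G)) V" "V \<noteq> {}"
    and val: "\<And>g. g \<in> V \<Longrightarrow> defined_at \<gamma> (translate g F) \<and> puiseux_val (pullback \<gamma> (translate g F)) = Fin v"
  shows "spherical_val G \<gamma> F = v"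
  unfolding spherical_val_def
proof (rule the_equality)
  show "\<exists>U. openin (fs_top (mat_space G)) U \<and> U \<noteq> {} \<and>
     (\<forall>g\<in>U. defined_at \<gamma> (translate g F) \<and> puiseux_val (pullback \<gamma> (translate g F)) = Fin v)"
    using V val by blast
  fix a assume "\<exists>U. openin (fs_top (mat_space G)) U \<and> U \<noteq> {} \<and>
     (\<forall>g\<in>U. defined_at \<gamma> (translate g F) \<and> puiseux_val (pullback \<gamma> (translate g F)) = Fin a)"
  then obtain U where U: "openin (fs_top (mat_space G)) U" "U \<noteq> {}"
    "\<And>g. g \<in> U \<Longrightarrow> puiseux_val (pullback \<gamma> (translate g F)) = Fin a" by blast
  obtain g where "g \<in> U" "g \<in> V" using openin_group_Int_nonempty[OF group conn U(1,2) V] by blast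
  then show "a = v" using U(3) val by fastforce
qed

text \<open>Every translate of a unit is a nonzero multiple of it, so the open set of general
  translates can be taken to be all of G.\<close>

lemma spherical_val_unit:
  assumes basis: "unit_basis X m g" and u: "u \<in> units X" and c: "c \<noteq> 0"
  shows "puiseux_val (val_at u) = Fin (spherical_val G \<gamma> (of_regular X (\<lambda>x. c * u x)))"
proof -
  have reg: "fs_reg X P u" and unz: "\<And>z. z \<in> P \<Longrightarrow> u z \<noteq> 0" using u by (auto simp: units_def)
  have "val_at u \<noteq> 0" using val_at_zero_iff[OF reg] unz puiseux_points_meet[OF \<gamma>] by blast
  then obtain v where v: "puiseux_val (val_at u) = Fin v"
    using puiseux_val_neq_Minf puiseux_val_eq_Pinf by (metis extended.exhaust)
  obtain x where x: "x \<in> P" using points_nonempty by blast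
  have "spherical_val G \<gamma> (of_regular X (\<lambda>x. c * u x)) = v"
  proof (rule spherical_val_eq)
    show "openin (fs_top (mat_space G)) G" using openin_topspace[of "fs_top (mat_space G)"] by simp
    show "G \<noteq> {}" using G_one by blast
    fix h assume h: "h \<in> G"
    define d where "d = c * (u (inv\<^bsub>GL\<^esub> h \<cdot> x) / u x)"
    have d0: "d \<noteq> 0" using c unz[OF x] unz[OF act_in_points[OF inv_G(2)[OF h] x]] by (simp add: d_def)
    \<comment> \<open>Written as a sum with one term, so that the lemmas on linear combinations
      apply.\<close>
    have "translate h (\<lambda>x. c * u x) y = (\<Sum>j\<in>{()}. d * u y)" if "y \<in> P" for y
      using unit_eigenfunction[OF basis u x that inv_G(2)[OF h]] unz[OF x]
      by (simp add: translate_def d_def field_simps)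
    then have eq: "translate h (of_regular X (\<lambda>x. c * u x)) = of_regular X (\<lambda>y. \<Sum>j\<in>{()}. d * u y)"
      unfolding translate_of_regular[OF h] by (rule of_regular_cong)
    have "puiseux_val (\<Sum>j\<in>{()}. puiseux_const d * val_at u) = Fin v"
      using v d0 by (intro puiseux_val_combination) (auto simp: puiseux_val_eq_Fin)
    then have "puiseux_val (val_at (\<lambda>y. \<Sum>j\<in>{()}. d * u y)) = Fin v"
      using val_at_combination[of "{()}" "\<lambda>_. u" "\<lambda>_. d"] reg by simp
    then show "defined_at \<gamma> (translate h (of_regular X (\<lambda>x. c * u x))) \<and>
        puiseux_val (pullback \<gamma> (translate h (of_regular X (\<lambda>x. c * u x)))) = Fin v"
      unfolding eq using defined_at_of_regular[OF \<gamma>] by blast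
  qed
  with v show ?thesis by simp
qed

text \<open>The lowest coefficient of a translate is a linear functional of the translate, hence a
  combination of evaluations, and so a regular function of the group element.\<close>

lemma spherical_val_translates:
  fixes f :: "nat \<Rightarrow> (complex^'n^'n) set \<Rightarrow> complex"
  assumes f0: "fs_reg X P (f 0)" "\<exists>x\<in>P. f 0 x \<noteq> 0"
    and tr: "\<And>j. j < s \<Longrightarrow> \<exists>g\<in>G. \<forall>x\<in>P. f j x = translate g (f 0) x"
    and ind: "\<And>c. \<forall>x\<in>P. (\<Sum>j<s. c j * f j x) = 0 \<Longrightarrow> \<forall>j<s. c j = 0"
    and gen: "\<And>g. g \<in> G \<Longrightarrow> \<exists>c. \<forall>x\<in>P. translate g (f 0) x = (\<Sum>j<s. c j * f j x)"
    and c: "c \<noteq> 0"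
  shows "Min ((\<lambda>j. puiseux_val (val_at (f j))) ` {..<s}) =
    Fin (spherical_val G \<gamma> (of_regular X (\<lambda>x. c * f 0 x)))" (is ?T)
    and "\<exists>j<s. val_at (f j) \<noteq> 0" (is ?N)
proof -
  have reg: "fs_reg X P (f j)" if j: "j < s" for j
  proof -
    obtain g where g: "g \<in> G" "\<forall>x\<in>P. f j x = translate g (f 0) x" using tr[OF j] by blast
    then show ?thesis using fs_reg_X_translate[OF f0(1) g(1)] fs_reg_X_cong[of P "f j" "translate g (f 0)"] by blast
  qed
  obtain w where w: "w \<in> P" "w \<in> fst \<gamma>" using puiseux_points_meet[OF \<gamma>] by blast
  show N: ?N
  proof (rule ccontr)
    assume "\<not> ?N"
    then have fw: "f j w = 0" if "j < s" for j using val_at_zero_iff[OF reg[OF that]] that w by blast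
    \<comment> \<open>G acts transitively: x is moved to the point w of \<open>fst \<gamma>\<close>,
      where all f j vanish, and the translate of f 0 is a combination of the f j.\<close>
    have "f 0 x = 0" if x: "x \<in> P" for x
    proof -
      obtain a b where ab: "a \<in> G" "x = a \<cdot> H" "b \<in> G" "w = b \<cdot> H" using points_E x w(1) by metis
      define h where "h = b ** inv\<^bsub>GL\<^esub> a"
      have h: "h \<in> G" unfolding h_def using ab inv_G(2) G_mult by blast
      have "h \<cdot> x = w"
        unfolding h_def ab(2,4) l_coset_GL_mult by (simp add: inv_G(4)[OF ab(1)] flip: matrix_mul_assoc)
      then have "x = inv\<^bsub>GL\<^esub> h \<cdot> w" using act_inv(1)[OF h] by metis
      moreover obtain c where "translate h (f 0) w = (\<Sum>j<s. c j * f j w)" using gen[OF h] w(1) by blast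
      ultimately show ?thesis using fw by (simp add: translate_def)
    qed
    with f0(2) show False by blast
  qed
  then obtain j0 where j0: "j0 \<in> {..<s}" "val_at (f j0) \<noteq> 0" by blast
  obtain v where v: "Min ((\<lambda>j. puiseux_val (val_at (f j))) ` {..<s}) = Fin v"
    and iv: "\<exists>i\<in>{..<s}. pcoeff (val_at (f i)) v \<noteq> 0"
    and low: "\<forall>j\<in>{..<s}. \<forall>q<v. pcoeff (val_at (f j)) q = 0"
    using Min_puiseux_val[of "{..<s}" j0 "\<lambda>j. val_at (f j)", OF finite_lessThan j0] by (elim exE conjE)
  from iv obtain i where i: "i < s" "pcoeff (val_at (f i)) v \<noteq> 0" by auto
  obtain l where l: "l \<in> evaluations P" "\<forall>j<s. l (f j) = pcoeff (val_at (f j)) v"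
    using evaluations_interpolate[where S = P and n = s and f = f and e = "\<lambda>j. pcoeff (val_at (f j)) v"] ind by blast
  have Gopen: "openin (fs_top (mat_space G)) G" using openin_topspace[of "fs_top (mat_space G)"] by simp
  have "fs_reg (mat_space G) G (\<lambda>g. l (\<lambda>x. f 0 (g \<cdot> x)))"
    using l(1)
  proof (induction rule: evaluations_induct)
    case zero
    then show ?case by (auto simp: fun_apply intro: fs_reg_poly Gopen poly_fun.const)
  next
    case (step c x l)
    show ?case
      unfolding fun_apply
      by (rule fs_reg_add[OF fs_reg_mult[OF fs_reg_poly[OF Gopen poly_fun.const]
          fs_reg_orbit_map[OF f0(1) step(1)]] step(2)])
  qed
  \<comment> \<open>Regularity is known for g acting on points; passing to the inverse gives an open
    condition on \<open>translate g\<close>.\<close>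
  from openin_inverse_preimage[OF openin_fs_reg_nonzero[OF this]]
  have "openin (fs_top (mat_space G)) {g \<in> G. inv\<^bsub>GL\<^esub> g \<in> {g \<in> G. l (\<lambda>x. f 0 (g \<cdot> x)) \<noteq> 0}}" .
  moreover have "{g \<in> G. inv\<^bsub>GL\<^esub> g \<in> {g \<in> G. l (\<lambda>x. f 0 (g \<cdot> x)) \<noteq> 0}} = {g \<in> G. l (translate g (f 0)) \<noteq> 0}"
    using inv_G(2) by (auto simp: translate_def)
  ultimately have V: "openin (fs_top (mat_space G)) {g \<in> G. l (translate g (f 0)) \<noteq> 0}" by simp
  have "spherical_val G \<gamma> (of_regular X (\<lambda>x. c * f 0 x)) = v"
  proof (rule spherical_val_eq[OF V])
    obtain g where "g \<in> G" "\<forall>x\<in>P. f i x = translate g (f 0) x" using tr[OF i(1)] by blast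
    then have "l (translate g (f 0)) \<noteq> 0"
      using evaluations_cong[OF l(1), of "f i" "translate g (f 0)"] l(2) i by auto
    then show "{g \<in> G. l (translate g (f 0)) \<noteq> 0} \<noteq> {}" using \<open>g \<in> G\<close> by blast
    fix h assume "h \<in> {g \<in> G. l (translate g (f 0)) \<noteq> 0}"
    then have h: "h \<in> G" "l (translate h (f 0)) \<noteq> 0" by auto
    obtain e where e: "\<forall>x\<in>P. translate h (f 0) x = (\<Sum>j<s. e j * f j x)" using gen[OF h(1)] by blast
    have "l (translate h (f 0)) = l (\<lambda>x. \<Sum>j<s. e j * f j x)"
      by (rule evaluations_cong[OF l(1) bspec[OF e]])
    also have "\<dots> = (\<Sum>j<s. e j * l (f j))" by (rule evaluations_sum[OF l(1)])
    finally have ne: "(\<Sum>j<s. e j * pcoeff (val_at (f j)) v) \<noteq> 0" using h(2) l(2) by simp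
    have "translate h (\<lambda>x. c * f 0 x) x = (\<Sum>j<s. (c * e j) * f j x)" if "x \<in> P" for x
      using e that by (simp add: translate_def sum_distrib_left mult.assoc)
    then have eq: "translate h (of_regular X (\<lambda>x. c * f 0 x)) = of_regular X (\<lambda>x. \<Sum>j<s. (c * e j) * f j x)"
      unfolding translate_of_regular[OF h(1)] by (rule of_regular_cong)
    have "puiseux_val (\<Sum>j<s. puiseux_const (c * e j) * val_at (f j)) = Fin v"
    proof (rule puiseux_val_combination)
      have "(\<Sum>j<s. c * e j * pcoeff (val_at (f j)) v) = c * (\<Sum>j<s. e j * pcoeff (val_at (f j)) v)"
        by (simp add: sum_distrib_left mult.assoc)
      then show "(\<Sum>j<s. c * e j * pcoeff (val_at (f j)) v) \<noteq> 0" using c ne by simp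
    qed (use low in auto)
    then have "puiseux_val (val_at (\<lambda>x. \<Sum>j<s. (c * e j) * f j x)) = Fin v"
      using val_at_combination[of "{..<s}" f "\<lambda>j. c * e j"] reg by simp
    then show "defined_at \<gamma> (translate h (of_regular X (\<lambda>x. c * f 0 x))) \<and>
        puiseux_val (pullback \<gamma> (translate h (of_regular X (\<lambda>x. c * f 0 x)))) = Fin v"
      unfolding eq using defined_at_of_regular[OF \<gamma>] by blast
  qed
  with v show ?T by simp
qed

end

end

section \<open>Comparison of the two tropicalizations\<close>

theorem theorem3p2:
  fixes G B H :: "(complex^'n^'n) set"
    and D :: "nat \<Rightarrow> (complex^'n^'n) set set" and Y :: "(complex^'n^'n) set set"
    and f :: "nat \<Rightarrow> nat \<Rightarrow> (complex^'n^'n) set \<Rightarrow> complex" and s :: "nat \<Rightarrow> nat" and r :: nat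
    and g :: "nat \<Rightarrow> (complex^'n^'n) set \<Rightarrow> complex" and m :: nat
  assumes "connected_reductive G" and "simply_connected_type G" and "borel_subgroup G B"
    and "algebraic_group H" and "H \<subseteq> G" and "spherical G B H"
    and "trivial_class_group (homogeneous_space G H)"
    and "bij_betw D {..<r} (colors G B H)"
    and "color_equations G B H r D s f"
    and "unit_basis (homogeneous_space G H) m g"
    and "closedin (fs_top (homogeneous_space G H)) Y"
  shows "dual_coords G B H r f m g ` spherical_trop G B H Y =
         psi r s m ` toric_trop (homogeneous_space G H) r s f m g Y"
proof -
  interpret algebraic_homogeneous_space G H
    using assms(1,4,5) by unfold_locales (auto simp: connected_reductive_def)
  have B: "B \<subseteq> G" "algebraic_group B" using assms(3) by (auto simp: borel_subgroup_def)
  have F: "fs_reg X P (f i 0)" "\<exists>\<omega>. semi_invariant G B H (of_regular X (f i 0)) \<omega>"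
      "\<And>j. j < s i \<Longrightarrow> \<exists>g\<in>G. \<forall>x\<in>P. f i j x = translate g (f i 0) x"
      "\<And>c. \<forall>x\<in>P. (\<Sum>j<s i. c j * f i j x) = 0 \<Longrightarrow> \<forall>j<s i. c j = 0"
      "\<And>g. g \<in> G \<Longrightarrow> \<exists>c. \<forall>x\<in>P. translate g (f i 0) x = (\<Sum>j<s i. c j * f i j x)"
    if "i < r" for i
    using assms(9) that unfolding color_equations_def Let_def by simp_all
  have F0: "\<exists>x\<in>P. f i 0 x \<noteq> 0" if i: "i < r" for i
  proof -
    obtain \<omega> x where "x \<in> dom (of_regular X (f i 0))" "of_regular X (f i 0) x \<noteq> Some 0"
      using F(2)[OF i] by (auto simp: semi_invariant_def nonzero_rational_funs_def)
    then show ?thesis by (auto simp: of_regular_def split: if_splits)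
  qed
  have U: "g k \<in> units X" if "k < m" for k using assms(10) that by (simp add: unit_basis_def)
  \<comment> \<open>Identifies the arbitrary choice in \<open>spherical_trop\<close>, and ensures
    that the coordinates of a tropical point are read inside \<open>weight_lattice\<close>, where
    the restricted function is not \<open>undefined\<close>.\<close>
  have sem: "\<exists>c. c \<noteq> 0 \<and> (SOME F. semi_invariant G B H F (weight G B H (of_regular X h))) = of_regular X (\<lambda>x. c * h x) \<and>
      weight G B H (of_regular X h) \<in> weight_lattice G B H"
    if h: "fs_reg X P h" "\<exists>\<omega>. semi_invariant G B H (of_regular X h) \<omega>" for h
  proof -
    obtain \<omega> where \<omega>: "semi_invariant G B H (of_regular X h) \<omega>" using h(2) by blast
    have "semi_invariant G B H (SOME F. semi_invariant G B H F \<omega>) \<omega>"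
      by (rule someI[of "\<lambda>F. semi_invariant G B H F \<omega>", OF \<omega>])
    then obtain c where "c \<noteq> 0" "(SOME F. semi_invariant G B H F \<omega>) = of_regular X (\<lambda>x. c * h x)"
      using semi_invariant_unique[OF B(1) assms(6) h(1) \<omega>] by blast
    then show ?thesis using \<omega> unfolding weight_eq[OF \<omega>] weight_lattice_def by blast
  qed
  define l where "l \<gamma> = (\<lambda>\<omega>\<in>weight_lattice G B H. spherical_val G \<gamma> (SOME F. semi_invariant G B H F \<omega>))" for \<gamma>
  define t where "t \<gamma> = (\<lambda>i\<in>{..<r}. \<lambda>j\<in>{..<s i}. puiseux_val (pullback \<gamma> (of_regular X (f i j))),
           \<lambda>k\<in>{..<m}. puiseux_val (pullback \<gamma> (of_regular X (g k))))" for \<gamma>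
  have main: "dual_coords G B H r f m g (l \<gamma>) = psi r s m (t \<gamma>)" if \<gamma>: "\<gamma> \<in> puiseux_points X Y" for \<gamma>
  proof -
    have 1: "Min ((\<lambda>j. puiseux_val (pullback \<gamma> (of_regular X (f i j)))) ` {..<s i}) =
        Fin (l \<gamma> (weight G B H (of_regular X (f i 0))))"
      and 2: "\<exists>j<s i. pullback \<gamma> (of_regular X (f i j)) \<noteq> 0" if i: "i < r" for i
    proof -
      obtain c where c: "c \<noteq> 0"
        "(SOME F. semi_invariant G B H F (weight G B H (of_regular X (f i 0)))) = of_regular X (\<lambda>x. c * f i 0 x)"
        "weight G B H (of_regular X (f i 0)) \<in> weight_lattice G B H"
        using sem[OF F(1,2)[OF i]] by blast
      note * = spherical_val_translates[OF \<gamma> F(1)[OF i] F0[OF i] F(3)[OF i] F(4)[OF i] F(5)[OF i] c(1)]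
      show "Min ((\<lambda>j. puiseux_val (pullback \<gamma> (of_regular X (f i j)))) ` {..<s i}) =
          Fin (l \<gamma> (weight G B H (of_regular X (f i 0))))"
        using *(1) c(2,3) by (simp add: l_def)
      show "\<exists>j<s i. pullback \<gamma> (of_regular X (f i j)) \<noteq> 0" by (rule *(2))
    qed
    have 3: "puiseux_val (pullback \<gamma> (of_regular X (g k))) = Fin (l \<gamma> (weight G B H (of_regular X (g k))))"
      if k: "k < m" for k
    proof -
      have "fs_reg X P (g k)" using U[OF k] by (simp add: units_def)
      then obtain c where c: "c \<noteq> 0"
        "(SOME F. semi_invariant G B H F (weight G B H (of_regular X (g k)))) = of_regular X (\<lambda>x. c * g k x)"
        "weight G B H (of_regular X (g k)) \<in> weight_lattice G B H"
        using sem unit_semi_invariant[OF assms(10) U[OF k] B] by blast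
      then show ?thesis using spherical_val_unit[OF \<gamma> assms(10) U[OF k] c(1)] by (simp add: l_def)
    qed
    \<comment> \<open>\<open>psi\<close> is restricted to this set and \<open>undefined\<close>
      outside it.\<close>
    have "t \<gamma> \<in> toric_trop_Z0 r s m"
      unfolding toric_trop_Z0_def t_def
    proof (intro SigmaI restrict_PiE_iff[THEN iffD2] ballI)
      fix i assume "i \<in> {..<r}"
      then obtain j where j: "j < s i" "pullback \<gamma> (of_regular X (f i j)) \<noteq> 0" using 2 by blast
      then have "(\<lambda>j\<in>{..<s i}. puiseux_val (pullback \<gamma> (of_regular X (f i j)))) j \<noteq> Pinf"
        by (simp add: puiseux_val_eq_Pinf)
      with j(1) show "(\<lambda>j\<in>{..<s i}. puiseux_val (pullback \<gamma> (of_regular X (f i j)))) \<in>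
          {a \<in> {..<s i} \<rightarrow>\<^sub>E - {Minf}. \<exists>j<s i. a j \<noteq> Pinf}"
        by (auto simp: puiseux_val_neq_Minf simp del: restrict_apply intro!: restrict_PiE_iff[THEN iffD2])
    next
      fix k assume "k \<in> {..<m}"
      then show "puiseux_val (pullback \<gamma> (of_regular X (g k))) \<in> range Fin" using 3 by simp
    qed
    then have "psi r s m (t \<gamma>) = (\<lambda>i\<in>{..<r}. THE q. Fin q = Min (fst (t \<gamma>) i ` {..<s i}),
        \<lambda>k\<in>{..<m}. THE q. Fin q = snd (t \<gamma>) k)"
      by (simp add: psi_def case_prod_beta)
    also have "\<dots> = dual_coords G B H r f m g (l \<gamma>)"
      unfolding dual_coords_def Let_def
    proof (intro arg_cong2[where f = Pair] restrict_ext)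
      fix i assume i: "i \<in> {..<r}"
      have "fst (t \<gamma>) i ` {..<s i} = (\<lambda>j. puiseux_val (pullback \<gamma> (of_regular X (f i j)))) ` {..<s i}"
        using i by (auto simp: t_def)
      then show "(THE q. Fin q = Min (fst (t \<gamma>) i ` {..<s i})) = l \<gamma> (weight G B H (of_regular X (f i 0)))"
        using 1[of i] i by auto
    next
      fix k assume "k \<in> {..<m}"
      then show "(THE q. Fin q = snd (t \<gamma>) k) = l \<gamma> (weight G B H (of_regular X (g k)))"
        using 3[of k] by (auto simp: t_def)
    qed
    finally show ?thesis by simp
  qed
  have "dual_coords G B H r f m g ` spherical_trop G B H Y =
      (\<lambda>\<gamma>. dual_coords G B H r f m g (l \<gamma>)) ` puiseux_points X Y"
    unfolding spherical_trop_def l_def image_image ..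
  also have "\<dots> = (\<lambda>\<gamma>. psi r s m (t \<gamma>)) ` puiseux_points X Y"
    by (intro image_cong refl main)
  also have "\<dots> = psi r s m ` toric_trop X r s f m g Y"
    unfolding toric_trop_def t_def image_image ..
  finally show ?thesis .
qed

end
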